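(* Let $\phi:\mathbb D\to\mathbb D$ be a parabolic inner function of positive hyperbolic step. Then for every unimodular constant $\tau$ there exists a non-constant inner function $u$ such that $u\circ\phi=\tau u$.
   Context: $\mathbb D$ is the open unit disk, $\mathbb T$ its boundary. For $n\in\mathbb N_0$, $\phi^{[n]}$ denotes the $n$-th iterate of $\phi$. The pseudo-hyperbolic distance is $\rho(z_1,z_2)=\left|\frac{z_2-z_1}{1-\overline{z_2}z_1}\right|$. A holomorphic self-map $\phi$ of $\mathbb D$ is of positive hyperbolic step if $\lim_{n\to\infty}\rho(\phi^{[n]}(z_0),\phi^{[n+1]}(z_0))>0$ for some $z_0\in\mathbb D$. A holomorphic self-map of $\mathbb D$ is parabolic if its Denjoy--Wolff point lies on $\mathbb T$ and its angular derivative there equals $1$. *)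

theory Defs
  imports "HOL-Complex_Analysis.Complex_Analysis"
begin

definition self_map_disk :: "(complex \<Rightarrow> complex) \<Rightarrow> bool" where
  "self_map_disk f \<longleftrightarrow> f holomorphic_on ball 0 1 \<and> f ` ball 0 1 \<subseteq> ball 0 1"

definition radial_limit :: "(complex \<Rightarrow> complex) \<Rightarrow> real \<Rightarrow> complex \<Rightarrow> bool" where
  "radial_limit f t l \<longleftrightarrow> ((\<lambda>r::real. f (complex_of_real r * cis t)) \<longlongrightarrow> l) (at_left 1)"

definition inner_function :: "(complex \<Rightarrow> complex) \<Rightarrow> bool" where
  "inner_function f \<longleftrightarrow> f holomorphic_on ball 0 1 \<and> (\<forall>z\<in>ball 0 1. norm (f z) \<le> 1) \<and>
     (AE t in lebesgue. t \<in> {0..2*pi} \<longrightarrow> (\<exists>l. radial_limit f t l \<and> norm l = 1))"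

definition pseudo_hyp :: "complex \<Rightarrow> complex \<Rightarrow> real" where
  "pseudo_hyp z1 z2 = norm ((z2 - z1) / (1 - cnj z2 * z1))"

definition positive_hyperbolic_step :: "(complex \<Rightarrow> complex) \<Rightarrow> bool" where
  "positive_hyperbolic_step f \<longleftrightarrow>
     (\<exists>z0\<in>ball 0 1. \<exists>L>0. (\<lambda>n. pseudo_hyp ((f ^^ n) z0) ((f ^^ Suc n) z0)) \<longlonglongrightarrow> L)"

definition stolz_angle :: "complex \<Rightarrow> real \<Rightarrow> complex set" where
  "stolz_angle w M = {z \<in> ball 0 1. norm (w - z) \<le> M * (1 - norm z)}"

definition angular_limit :: "(complex \<Rightarrow> complex) \<Rightarrow> complex \<Rightarrow> complex \<Rightarrow> bool" where
  "angular_limit g w l \<longleftrightarrow> (\<forall>M>1. (g \<longlongrightarrow> l) (at w within stolz_angle w M))"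

definition angular_derivative :: "(complex \<Rightarrow> complex) \<Rightarrow> complex \<Rightarrow> complex \<Rightarrow> bool" where
  "angular_derivative f w c \<longleftrightarrow> angular_limit f w w \<and>
     angular_limit (\<lambda>z. (f z - w) / (z - w)) w c"

definition boundary_DW_point :: "(complex \<Rightarrow> complex) \<Rightarrow> complex \<Rightarrow> bool" where
  "boundary_DW_point f w \<longleftrightarrow> norm w = 1 \<and> (\<forall>z\<in>ball 0 1. (\<lambda>n. (f ^^ n) z) \<longlonglongrightarrow> w)"

definition parabolic :: "(complex \<Rightarrow> complex) \<Rightarrow> bool" where
  "parabolic f \<longleftrightarrow> self_map_disk f \<and> (\<exists>w. boundary_DW_point f w \<and> angular_derivative f w 1)"

end

theory Submission
  imports Defs
begin

text \<open>
  Move the Denjoy--Wolff point to \<open>\<infinity>\<close> in the upper half-plane and let \<open>x\<^sub>n + i y\<^sub>n\<close> be the orbit of \<open>z\<^sub>0\<close> there.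
  After Pommerenke, the normalised iterates \<open>g\<^sub>n = (\<phi>\<^sup>n - x\<^sub>n) / y\<^sub>n\<close> subconverge to some \<open>g\<close> with \<open>g \<circ> \<phi> = g + b\<close>,
  where \<open>b \<noteq> 0\<close> is real because the hyperbolic step is positive. Then \<open>u = exp (i c g)\<close> satisfies
  \<open>u \<circ> \<phi> = exp (i c b) u\<close>, and a suitable \<open>c > 0\<close> gives the multiplier \<open>\<tau>\<close>.

  It remains to see that \<open>u\<close> is inner. In the disc, the Cayley transforms \<open>f\<^sub>n\<close> of \<open>g\<^sub>n\<close> are inner and each divides the
  next one with a quotient bounded by \<open>1\<close> (Schwarz lemma), so their limit is a convergent infinite product of inner
  functions and hence inner. All of this is done with the \<open>L\<^sup>2\<close> means \<open>\<integral> |u (r e\<^sup>i\<^sup>t)|\<^sup>2 dt \<longrightarrow> 2 \<pi>\<close>; that these means imply the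
  existence of unimodular radial limits follows from the weak-type estimate for the radial maximal function,
  applied to \<open>u - u (R \<cdot>)\<close>.
\<close>

section \<open>Means over circles and the Poisson integral\<close>

text \<open>Innerness concerns boundary values, and for a composition with \<open>\<phi>\<close>
  these would require knowing how \<open>\<phi>\<close> transports null sets of the circle. Square
  means over interior circles avoid this: for them composition becomes an estimate with Poisson
  integrals. Boundary values enter only where the hypothesis on \<open>\<phi>\<close> is translated
  into means and where the conclusion on \<open>u\<close> is translated back.

  In the dynamical part the obstacle is that the g_n are known to converge only along a subsequence,
  whereas the exact relation expresses g_n o \<phi> through g_(n+1). Both must have the same limit;
  this is forced by showing that the transition maps from one normalisation to the next tend to the
  identity along the subsequence. Besides giving b \<noteq> 0, the positive step is used there, to
  cancel a limit of moduli. The limit equation is a priori g o \<phi> = \<mu> g + b with \<mu> \<ge>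
  1, and it is the angular derivative 1 that excludes \<mu> > 1.\<close>

definition circ_mean :: "(complex \<Rightarrow> 'a::banach) \<Rightarrow> real \<Rightarrow> 'a" where
  "circ_mean h r = integral {0..2*pi} (\<lambda>t. h (of_real r * cis t)) /\<^sub>R (2*pi)"

lemma circ_mean_real: "circ_mean h r = integral {0..2*pi} (\<lambda>t. h (of_real r * cis t)) / (2*pi)"
  for h :: "complex \<Rightarrow> real"
  unfolding circ_mean_def real_scaleR_def divide_inverse by (rule mult.commute)

lemma continuous_on_circle_param:
  assumes "continuous_on (sphere 0 \<bar>r\<bar>) h"
  shows "continuous_on S (\<lambda>t. h (of_real r * cis t))"
  by (rule continuous_on_compose2[OF assms], intro continuous_intros) (auto simp: norm_mult)

lemma integrable_circle:
  fixes h :: "complex \<Rightarrow> 'a::banach"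
  assumes "continuous_on (sphere 0 \<bar>r\<bar>) h"
  shows "(\<lambda>t. h (of_real r * cis t)) integrable_on {a..b}"
  by (intro integrable_continuous_real continuous_on_circle_param assms)

lemma circ_mean_cong:
  assumes "\<And>z. norm z = \<bar>r\<bar> \<Longrightarrow> f z = g z"
  shows "circ_mean f r = circ_mean g r"
  using assms by (simp add: circ_mean_def norm_mult)

lemma circ_mean_add:
  assumes "continuous_on (sphere 0 \<bar>r\<bar>) f" "continuous_on (sphere 0 \<bar>r\<bar>) g"
  shows "circ_mean (\<lambda>z. f z + g z) r = circ_mean f r + circ_mean g r"
  using assms by (simp add: circ_mean_def integral_add integrable_circle scaleR_add_right)

lemma circ_mean_diff:
  assumes "continuous_on (sphere 0 \<bar>r\<bar>) f" "continuous_on (sphere 0 \<bar>r\<bar>) g"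
  shows "circ_mean (\<lambda>z. f z - g z) r = circ_mean f r - circ_mean g r"
  using assms by (simp add: circ_mean_def integral_diff integrable_circle scaleR_diff_right)

lemma circ_mean_const [simp]: "circ_mean (\<lambda>z. c) r = c"
  by (simp add: circ_mean_def)

lemma circ_mean_linear:
  assumes "continuous_on (sphere 0 \<bar>r\<bar>) f" "bounded_linear h"
  shows "circ_mean (\<lambda>z. h (f z)) r = h (circ_mean f r)"
proof -
  interpret bounded_linear h by fact
  show ?thesis
    using integral_linear[OF integrable_circle[OF assms(1)] assms(2)]
    by (simp add: circ_mean_def o_def scaleR)
qed

lemma circ_mean_cmult_real:
  "circ_mean (\<lambda>z. c * f z) r = c * circ_mean f r" for c :: real
  by (simp add: circ_mean_def)

lemma circ_mean_mono:
  fixes f g :: "complex \<Rightarrow> real"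
  assumes "continuous_on (sphere 0 \<bar>r\<bar>) f" "continuous_on (sphere 0 \<bar>r\<bar>) g"
    and "\<And>z. norm z = \<bar>r\<bar> \<Longrightarrow> f z \<le> g z"
  shows "circ_mean f r \<le> circ_mean g r"
proof -
  have "integral {0..2*pi} (\<lambda>t. f (of_real r * cis t)) \<le> integral {0..2*pi} (\<lambda>t. g (of_real r * cis t))"
    by (intro integral_le integrable_circle assms) (auto simp: norm_mult)
  then show ?thesis
    by (simp add: circ_mean_def divide_simps)
qed

lemma circ_mean_nonneg:
  fixes f :: "complex \<Rightarrow> real"
  assumes "continuous_on (sphere 0 \<bar>r\<bar>) f" "\<And>z. norm z = \<bar>r\<bar> \<Longrightarrow> 0 \<le> f z"
  shows "0 \<le> circ_mean f r"
  using circ_mean_mono[of r "\<lambda>_. 0" f] assms by simp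

lemma circ_mean_swap:
  fixes k :: "complex \<Rightarrow> complex \<Rightarrow> real"
  assumes "continuous_on (sphere 0 \<bar>r\<bar> \<times> sphere 0 \<bar>s\<bar>) (\<lambda>(x, y). k x y)"
  shows "circ_mean (\<lambda>x. circ_mean (\<lambda>y. k x y) s) r = circ_mean (\<lambda>y. circ_mean (\<lambda>x. k x y) r) s"
proof -
  have "continuous_on (cbox (0,0) (2*pi,2*pi)) (\<lambda>p. (\<lambda>(x, y). k x y) ((\<lambda>p. (of_real r * cis (fst p), of_real s * cis (snd p))) p))"
    by (rule continuous_on_compose2[OF assms], intro continuous_intros) (auto simp: norm_mult)
  then have "continuous_on (cbox (0,0) (2*pi,2*pi)) (\<lambda>(x,y). k (of_real r * cis x) (of_real s * cis y))"
    by (simp add: case_prod_unfold)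
  from integral_swap_continuous[OF this] show ?thesis
    by (simp add: circ_mean_def)
qed

text \<open>On the circle dz = i z dt, so the contour integral of \<open>f\<close> is 2 pi i times
  the mean of \<open>f z * z\<close>.\<close>

lemma circ_mean_eqI_contour:
  assumes "0 < r" "(f has_contour_integral 2 * of_real pi * \<i> * I) (circlepath 0 r)"
    and "\<And>z. norm z = r \<Longrightarrow> g z = f z * z"
  shows "circ_mean g r = I"
proof -
  have "((\<lambda>t. f (0 + of_real r * cis t) * r * \<i> * cis t) has_integral 2 * of_real pi * \<i> * I) {0..2*pi}"
    using assms(2) unfolding circlepath_def
    by (subst (asm) has_contour_integral_part_circlepath_iff) (auto simp: algebra_simps)
  then have "((\<lambda>t. f (0 + of_real r * cis t) * r * \<i> * cis t * (-\<i>)) has_integral 2 * of_real pi * \<i> * I * (-\<i>)) {0..2*pi}"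
    by (rule has_integral_mult_left)
  then have "((\<lambda>t. g (of_real r * cis t)) has_integral 2 * of_real pi * I) {0..2*pi}"
    by (rule has_integral_eq_rhs[OF has_integral_eq, rotated])
       (use assms(1,3) in \<open>auto simp: norm_mult mult_ac\<close>)
  then show ?thesis
    by (simp add: circ_mean_def integral_unique scaleR_conv_of_real)
qed

section \<open>The Poisson kernel of a circle of arbitrary radius\<close>

definition poisson_kernel :: "complex \<Rightarrow> complex \<Rightarrow> real" where
  "poisson_kernel \<zeta> w = ((norm \<zeta>)\<^sup>2 - (norm w)\<^sup>2) / (norm (\<zeta> - w))\<^sup>2"

lemma poisson_kernel_eq_Re:
  assumes "\<zeta> \<noteq> w"
  shows "poisson_kernel \<zeta> w = Re ((\<zeta> + w) / (\<zeta> - w))"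
proof -
  have "(\<zeta> + w) / (\<zeta> - w) = (\<zeta> + w) * cnj (\<zeta> - w) / of_real ((norm (\<zeta> - w))\<^sup>2)"
    using assms by (simp only: complex_norm_square) (simp add: divide_simps)
  then have "Re ((\<zeta> + w) / (\<zeta> - w)) = Re ((\<zeta> + w) * cnj (\<zeta> - w)) / (norm (\<zeta> - w))\<^sup>2"
    by (metis Re_divide_of_real)
  also have "Re ((\<zeta> + w) * cnj (\<zeta> - w)) = (norm \<zeta>)\<^sup>2 - (norm w)\<^sup>2"
    unfolding cmod_power2 by (simp add: algebra_simps power2_eq_square)
  finally show ?thesis by (simp add: poisson_kernel_def)
qed

lemma poisson_kernel_nonneg: "norm w \<le> norm \<zeta> \<Longrightarrow> 0 \<le> poisson_kernel \<zeta> w"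
  by (simp add: poisson_kernel_def power_mono)

text \<open>Harnack's bound: the distance from \<open>w\<close> to \<open>\<zeta>\<close> is at
  least \<open>norm \<zeta> - norm w\<close>, and one factor cancels in the difference of squares.
  The lower bound uses the largest possible distance instead.\<close>

lemma poisson_kernel_le:
  assumes "norm w < norm \<zeta>"
  shows "poisson_kernel \<zeta> w \<le> (norm \<zeta> + norm w) / (norm \<zeta> - norm w)"
proof -
  have "(norm \<zeta> - norm w)\<^sup>2 \<le> (norm (\<zeta> - w))\<^sup>2"
    using assms by (intro power_mono) (auto simp: norm_triangle_ineq2)
  then have "poisson_kernel \<zeta> w \<le> ((norm \<zeta>)\<^sup>2 - (norm w)\<^sup>2) / (norm \<zeta> - norm w)\<^sup>2"
    unfolding poisson_kernel_def using assms
    by (intro divide_left_mono mult_pos_pos zero_less_power) (auto simp: power_mono)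
  also have "\<dots> = (norm \<zeta> + norm w) / (norm \<zeta> - norm w)"
    using assms by (simp add: power2_eq_square square_diff_square_factored)
  finally show ?thesis .
qed

lemma poisson_kernel_ge:
  assumes "norm w < norm \<zeta>"
  shows "(norm \<zeta> - norm w) / (norm \<zeta> + norm w) \<le> poisson_kernel \<zeta> w"
proof -
  have "(norm (\<zeta> - w))\<^sup>2 \<le> (norm \<zeta> + norm w)\<^sup>2"
    by (intro power_mono) (auto simp: norm_triangle_ineq4)
  moreover have "norm (\<zeta> - w) > 0" "norm \<zeta> + norm w > 0"
    using assms norm_ge_zero[of w] by (auto simp del: norm_ge_zero)
  ultimately have "((norm \<zeta>)\<^sup>2 - (norm w)\<^sup>2) / (norm \<zeta> + norm w)\<^sup>2 \<le> poisson_kernel \<zeta> w"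
    unfolding poisson_kernel_def using assms by (intro divide_left_mono) (auto simp: power_mono)
  moreover have "((norm \<zeta>)\<^sup>2 - (norm w)\<^sup>2) / (norm \<zeta> + norm w)\<^sup>2 = (norm \<zeta> - norm w) / (norm \<zeta> + norm w)"
    using \<open>norm \<zeta> + norm w > 0\<close> by (simp add: power2_eq_square square_diff_square_factored)
  ultimately show ?thesis by simp
qed

lemma continuous_on_poisson_kernel [continuous_intros]:
  assumes "continuous_on S f" "continuous_on S g" "\<And>x. x \<in> S \<Longrightarrow> f x \<noteq> g x"
  shows "continuous_on S (\<lambda>x. poisson_kernel (f x) (g x))"
  unfolding poisson_kernel_def using assms by (intro continuous_intros) auto

text \<open>Cauchy's formula at \<open>w\<close> for \<open>z \<mapsto> f z * (s\<^sup>2 - |w|\<^sup>2) / (s\<^sup>2 - cnj w * z)\<close>, whose value at \<open>w\<close> is \<open>f w\<close>.\<close>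
lemma poisson_integral:
  assumes f: "continuous_on (cball 0 s) f" "f holomorphic_on ball 0 s" and w: "norm w < s"
  shows "circ_mean (\<lambda>z. of_real (poisson_kernel z w) * f z) s = f w"
proof -
  define h where "h z = f z * of_real (s\<^sup>2 - (norm w)\<^sup>2) / (of_real (s\<^sup>2) - cnj w * z)" for z
  have s: "0 < s" using w norm_ge_zero[of w] by linarith
  have nz: "of_real (s\<^sup>2) - cnj w * z \<noteq> 0" if "norm z \<le> s" for z
  proof
    assume "of_real (s\<^sup>2) - cnj w * z = 0"
    then have "s\<^sup>2 = norm w * norm z"
      by (metis abs_of_nonneg complex_mod_cnj eq_iff_diff_eq_0 norm_mult norm_of_real zero_le_power2)
    moreover have "norm w * norm z \<le> norm w * s" "norm w * s < s * s"
      using w that s by (auto intro: mult_left_mono)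
    ultimately show False by (simp add: power2_eq_square)
  qed
  have "((\<lambda>z. h z / (z - w)) has_contour_integral 2 * of_real pi * \<i> * h w) (circlepath 0 s)"
    unfolding h_def
    by (intro Cauchy_integral_circlepath continuous_intros holomorphic_intros f) (use w nz in auto)
  moreover have "of_real (poisson_kernel z w) * f z = h z / (z - w) * z" if "norm z = s" for z
  proof -
    have zw: "z \<noteq> w" "z \<noteq> 0" using that w s by auto
    have *: "of_real (s\<^sup>2) - cnj w * z = z * cnj (z - w)"
      using that by (simp add: complex_norm_square[symmetric] algebra_simps flip: that)
    have "of_real (poisson_kernel z w) = of_real (s\<^sup>2 - (norm w)\<^sup>2) / ((z - w) * cnj (z - w))"
      using that unfolding poisson_kernel_def of_real_divide complex_norm_square[of "z - w"] by simp
    then show ?thesis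
      unfolding h_def * using zw by (simp add: mult.commute)
  qed
  ultimately have "circ_mean (\<lambda>z. of_real (poisson_kernel z w) * f z) s = h w"
    using s by (intro circ_mean_eqI_contour[of s "\<lambda>z. h z / (z - w)"])
  also have "h w = f w"
  proof -
    have "of_real (s\<^sup>2) - cnj w * w = of_real (s\<^sup>2 - (norm w)\<^sup>2)"
      by (simp only: of_real_diff complex_norm_square mult.commute)
    then show ?thesis
      using nz[of w] w unfolding h_def by auto
  qed
  finally show ?thesis .
qed

lemma circ_mean_holomorphic:
  assumes "continuous_on (cball 0 r) f" "f holomorphic_on ball 0 r" "0 < r"
  shows "circ_mean f r = f 0"
proof -
  have "circ_mean f r = circ_mean (\<lambda>z. of_real (poisson_kernel z 0) * f z) r"
    using assms(3) by (intro circ_mean_cong) (auto simp: poisson_kernel_def)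
  then show ?thesis using poisson_integral[OF assms(1,2), of 0] assms(3) by simp
qed

lemma circ_mean_poisson_kernel:
  assumes "norm w < s"
  shows "circ_mean (\<lambda>z. poisson_kernel z w) s = 1"
proof -
  have s: "0 < s" using assms norm_ge_zero[of w] by linarith
  have "circ_mean (\<lambda>z. of_real (poisson_kernel z w) * 1) s = (1::complex)"
    using assms by (intro poisson_integral) auto
  moreover have "circ_mean (\<lambda>z. complex_of_real (poisson_kernel z w)) s = of_real (circ_mean (\<lambda>z. poisson_kernel z w) s)"
    using assms s by (intro circ_mean_linear continuous_intros bounded_linear_of_real) auto
  ultimately show ?thesis by simp
qed

text \<open>With respect to the probability density \<open>poisson_kernel z w\<close> the function
  \<open>f\<close> has mean \<open>f w\<close>, so this splits a second moment into squared mean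
  plus variance. Dropping the variance gives subharmonicity of |f|^2; estimating it gives the
  Lipschitz bound needed for compositions.\<close>

lemma poisson_variance:
  assumes f: "continuous_on (cball 0 s) f" "f holomorphic_on ball 0 s" and w: "norm w < s"
  shows "circ_mean (\<lambda>z. poisson_kernel z w * (norm (f z))\<^sup>2) s
     = (norm (f w))\<^sup>2 + circ_mean (\<lambda>z. poisson_kernel z w * (norm (f z - f w))\<^sup>2) s"
proof -
  have s: "0 < s" using w norm_ge_zero[of w] by linarith
  have cf: "continuous_on (sphere 0 \<bar>s\<bar>) f"
    using f(1) s by (auto elim: continuous_on_subset)
  have cp: "continuous_on (sphere 0 \<bar>s\<bar>) (\<lambda>z. poisson_kernel z w)"
    using w s by (intro continuous_intros) auto
  \<comment> \<open>\<open>L\<close> is the cross term in the expansion of |f z - f w|^2; it is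
    real-linear and therefore passes through the Poisson mean.\<close>
  define L where "L x = 2 * Re (x * cnj (f w))" for x
  have L: "bounded_linear L" unfolding L_def
    by (intro bounded_linear_intros bounded_linear_compose[OF bounded_linear_mult_right] bounded_linear_compose[OF bounded_linear_Re] bounded_linear_mult_left)
  have pf: "circ_mean (\<lambda>z. poisson_kernel z w * L (f z)) s = L (f w)"
  proof -
    have "circ_mean (\<lambda>z. L (of_real (poisson_kernel z w) * f z)) s = L (circ_mean (\<lambda>z. of_real (poisson_kernel z w) * f z) s)"
      by (intro circ_mean_linear L continuous_intros cf cp)
    then show ?thesis
      using poisson_integral[OF f w] by (simp add: L_def algebra_simps)
  qed
  have cL: "continuous_on (sphere 0 \<bar>s\<bar>) (\<lambda>z. L (f z))"
    using L cf by (rule bounded_linear.continuous_on)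
  have pc: "circ_mean (\<lambda>z. poisson_kernel z w * (norm (f w))\<^sup>2) s = (norm (f w))\<^sup>2"
    using circ_mean_cmult_real[of "(norm (f w))\<^sup>2" "\<lambda>z. poisson_kernel z w" s] circ_mean_poisson_kernel[OF w]
    by (simp add: mult.commute)
  have sq: "(norm (f z - f w))\<^sup>2 = (norm (f z))\<^sup>2 - L (f z) + (norm (f w))\<^sup>2" for z
    unfolding L_def cmod_power2 by (simp add: algebra_simps power2_eq_square)
  have "circ_mean (\<lambda>z. poisson_kernel z w * (norm (f z - f w))\<^sup>2) s
      = circ_mean (\<lambda>z. (poisson_kernel z w * (norm (f z))\<^sup>2 - poisson_kernel z w * L (f z)) + poisson_kernel z w * (norm (f w))\<^sup>2) s"
    by (intro circ_mean_cong) (simp add: sq algebra_simps)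
  also have "\<dots> = circ_mean (\<lambda>z. poisson_kernel z w * (norm (f z))\<^sup>2) s - L (f w) + (norm (f w))\<^sup>2"
    by (subst circ_mean_add circ_mean_diff, (intro continuous_intros cf cp cL)+)+ (simp add: pf pc)
  also have "L (f w) = 2 * (norm (f w))\<^sup>2"
    unfolding L_def complex_norm_square[symmetric] by (simp only: Re_complex_of_real)
  finally show ?thesis by simp
qed

lemma norm_square_le_poisson:
  assumes f: "continuous_on (cball 0 s) f" "f holomorphic_on ball 0 s" and w: "norm w < s"
  shows "(norm (f w))\<^sup>2 \<le> circ_mean (\<lambda>z. poisson_kernel z w * (norm (f z))\<^sup>2) s"
proof -
  have s: "0 < s" using w norm_ge_zero[of w] by linarith
  have cf: "continuous_on (sphere 0 \<bar>s\<bar>) f"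
    using f(1) s by (auto elim: continuous_on_subset)
  have "0 \<le> circ_mean (\<lambda>z. poisson_kernel z w * (norm (f z - f w))\<^sup>2) s"
    using w s by (intro circ_mean_nonneg continuous_intros cf mult_nonneg_nonneg poisson_kernel_nonneg) auto
  then show ?thesis using poisson_variance[OF assms] by simp
qed

text \<open>As a function of \<open>z\<close> the kernel at \<open>\<phi> z\<close> is the real part
  of the holomorphic function (\<zeta> + \<phi>) / (\<zeta> - \<phi>), so it has the mean value
  property.\<close>

lemma circ_mean_poisson_kernel_compose:
  assumes "continuous_on (cball 0 r) \<phi>" "\<phi> holomorphic_on ball 0 r" "0 < r"
    and "\<And>z. norm z \<le> r \<Longrightarrow> norm (\<phi> z) < norm \<zeta>"
  shows "circ_mean (\<lambda>z. poisson_kernel \<zeta> (\<phi> z)) r = poisson_kernel \<zeta> (\<phi> 0)"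
proof -
  have nz: "\<zeta> \<noteq> \<phi> z" if "norm z \<le> r" for z using assms(4)[OF that] by (metis less_irrefl)
  have c: "continuous_on (cball 0 r) (\<lambda>z. (\<zeta> + \<phi> z) / (\<zeta> - \<phi> z))"
    using nz by (intro continuous_intros assms) auto
  have "circ_mean (\<lambda>z. (\<zeta> + \<phi> z) / (\<zeta> - \<phi> z)) r = (\<zeta> + \<phi> 0) / (\<zeta> - \<phi> 0)"
    using nz by (intro circ_mean_holomorphic c holomorphic_intros assms) auto
  moreover have "circ_mean (\<lambda>z. Re ((\<zeta> + \<phi> z) / (\<zeta> - \<phi> z))) r = Re (circ_mean (\<lambda>z. (\<zeta> + \<phi> z) / (\<zeta> - \<phi> z)) r)"
    using assms(3) by (intro circ_mean_linear bounded_linear_Re continuous_on_subset[OF c]) auto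
  moreover have "circ_mean (\<lambda>z. poisson_kernel \<zeta> (\<phi> z)) r = circ_mean (\<lambda>z. Re ((\<zeta> + \<phi> z) / (\<zeta> - \<phi> z))) r"
    using assms(3) nz by (intro circ_mean_cong poisson_kernel_eq_Re) auto
  ultimately show ?thesis using poisson_kernel_eq_Re[OF nz, of 0] assms(3) by simp
qed

text \<open>On \<open>|z| = s\<close> the integrand is \<open>f z * cnj (f (cnj (R s\<^sup>2 / z)))\<close>, which is holomorphic in an annulus
  containing the circle of radius \<open>s * sqrt R\<close>; on the latter circle \<open>cnj (R s\<^sup>2 / z) = z\<close>.\<close>
lemma circ_mean_mult_cnj_dilation:
  assumes f: "f holomorphic_on ball 0 1" and s: "0 < s" "s < 1" and R: "0 < R" "R \<le> 1"
  shows "circ_mean (\<lambda>z. f z * cnj (f (of_real R * z))) s = of_real (circ_mean (\<lambda>z. (norm (f z))\<^sup>2) (s * sqrt R))"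
proof -
  define h where "h z = cnj (f (cnj z))" for z
  have h: "h holomorphic_on ball 0 1"
  proof -
    have "cnj ` ball 0 1 = ball (0::complex) 1"
      by (auto simp: image_cnj_conv_vimage_cnj)
    then show ?thesis
      using holomorphic_on_compose_cnj_cnj[of f "ball 0 1"] f by (simp add: h_def[abs_def] o_def)
  qed
  define A where "A = ball (0::complex) 1 - cball 0 (R * s\<^sup>2)"
  define G where "G z = f z * h (of_real (R * s\<^sup>2) / z) / z" for z
  have Rs: "0 < R * s\<^sup>2" using s R by simp
  have A: "open A" by (auto simp: A_def)
  have sub: "(\<lambda>z. of_real (R * s\<^sup>2) / z) ` A \<subseteq> ball 0 1"
  proof clarsimp
    fix z assume "z \<in> A"
    then have "R * s\<^sup>2 < norm z" by (auto simp: A_def)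
    then show "norm (of_real R * (of_real s)\<^sup>2 / z) < 1"
      using Rs R s by (auto simp: norm_divide norm_mult norm_power divide_simps)
  qed
  have zA: "z \<noteq> 0" if "z \<in> A" for z using that Rs by (auto simp: A_def)
  have hA: "(h \<circ> (\<lambda>z. of_real (R * s\<^sup>2) / z)) holomorphic_on A"
    by (rule holomorphic_on_compose_gen[OF _ h sub]) (intro holomorphic_intros, use zA in auto)
  have G: "G holomorphic_on A"
    unfolding G_def using hA zA
    by (intro holomorphic_intros holomorphic_on_subset[OF f]) (auto simp: o_def A_def)
  have s2: "0 < s * sqrt R" "s * sqrt R \<le> s" "R * s\<^sup>2 < s * sqrt R"
  proof -
    show "0 < s * sqrt R" using s R by simp
    show "s * sqrt R \<le> s" using s R by (simp add: mult_le_cancel_left1)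
    have "R \<le> sqrt R" using R by (simp add: real_le_rsqrt power2_eq_square mult_le_one mult_left_le)
    then have "R * s * s \<le> s * sqrt R * s"
      using s by simp
    also have "\<dots> < s * sqrt R" using s R by simp
    finally show "R * s\<^sup>2 < s * sqrt R" by (simp add: power2_eq_square mult_ac)
  qed
  have s3: "s * sqrt R < 1" "R * s\<^sup>2 < s" using s2 s by linarith+
  \<comment> \<open>The linear homotopy moves points along radii, so all intermediate moduli lie
    between \<open>s * sqrt R\<close> and \<open>s\<close>, inside the annulus.\<close>
  have seg: "closed_segment (circlepath 0 s t) (circlepath 0 (s * sqrt R) t) \<subseteq> A" for t
  proof
    fix x assume "x \<in> closed_segment (circlepath 0 s t) (circlepath 0 (s * sqrt R) t)"
    then obtain a where a: "0 \<le> a" "a \<le> 1" "x = (1 - a) *\<^sub>R circlepath 0 s t + a *\<^sub>R circlepath 0 (s * sqrt R) t"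
      by (auto simp: closed_segment_def)
    define e where "e = exp (2 * of_real pi * \<i> * of_real t)"
    have "x = of_real ((1 - a) * s + a * (s * sqrt R)) * e"
      unfolding a(3) circlepath e_def by (simp add: scaleR_conv_of_real algebra_simps)
    moreover have "norm e = 1" by (simp add: e_def)
    moreover have "s * sqrt R \<le> (1 - a) * s + a * (s * sqrt R)" "(1 - a) * s + a * (s * sqrt R) \<le> s"
      using a(1,2) s2 mult_left_mono[OF s2(2) a(1)] mult_left_mono[OF s2(2), of "1-a"] by (auto simp: algebra_simps)
    ultimately have "s * sqrt R \<le> norm x" "norm x \<le> s" 
      using s2(1) by (auto simp: norm_mult simp del: of_real_add of_real_mult of_real_diff)
    then show "x \<in> A" using s2 s by (auto simp: A_def)
  qed
  have "homotopic_loops A (circlepath 0 s) (circlepath 0 (s * sqrt R))"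
    using seg by (intro homotopic_loops_linear) auto
  then have eq: "contour_integral (circlepath 0 s) G = contour_integral (circlepath 0 (s * sqrt R)) G"
    using A G by (intro Cauchy_theorem_homotopic_loops) auto
  have int: "(G has_contour_integral contour_integral (circlepath 0 \<rho>) G) (circlepath 0 \<rho>)" 
    if "R * s\<^sup>2 < \<rho>" "\<rho> < 1" for \<rho>
    using that Rs A G
    by (intro has_contour_integral_integral contour_integrable_holomorphic_simple[of _ A])
       (auto simp: A_def)
  have m: "circ_mean (\<lambda>z. f z * h (of_real (R * s\<^sup>2) / z)) \<rho> = contour_integral (circlepath 0 \<rho>) G / (2 * of_real pi * \<i>)"
    if "R * s\<^sup>2 < \<rho>" "\<rho> < 1" for \<rho>
    using that Rs int[OF that]
    by (intro circ_mean_eqI_contour[of _ G]) (auto simp: G_def)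
  have "circ_mean (\<lambda>z. f z * h (of_real (R * s\<^sup>2) / z)) s = circ_mean (\<lambda>z. f z * h (of_real (R * s\<^sup>2) / z)) (s * sqrt R)"
    using m[OF s3(2) s(2)] m[OF s2(3) s3(1)] eq by (simp only:)
  moreover have "circ_mean (\<lambda>z. f z * h (of_real (R * s\<^sup>2) / z)) s = circ_mean (\<lambda>z. f z * cnj (f (of_real R * z))) s"
  proof (rule circ_mean_cong)
    fix z :: complex assume "norm z = \<bar>s\<bar>"
    then have "of_real (s\<^sup>2) = z * cnj z" "z \<noteq> 0"
      using s by (auto simp flip: complex_norm_square)
    then have "of_real (R * s\<^sup>2) / z = of_real R * cnj z" by (simp only: of_real_mult) simp
    then show "f z * h (of_real (R * s\<^sup>2) / z) = f z * cnj (f (of_real R * z))"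
      by (simp add: h_def)
  qed
  moreover have "circ_mean (\<lambda>z. f z * h (of_real (R * s\<^sup>2) / z)) (s * sqrt R) = circ_mean (\<lambda>z. of_real ((norm (f z))\<^sup>2)) (s * sqrt R)"
  proof (rule circ_mean_cong)
    fix z :: complex assume z: "norm z = \<bar>s * sqrt R\<bar>"
    then have "z \<noteq> 0" using s2 by auto
    have "of_real ((norm z)\<^sup>2) = z * cnj z" by (rule complex_norm_square)
    moreover have "(norm z)\<^sup>2 = R * s\<^sup>2" using z R by (simp add: power_mult_distrib)
    ultimately have "of_real (R * s\<^sup>2) / z = cnj z" using \<open>z \<noteq> 0\<close> by simp
    then show "f z * h (of_real (R * s\<^sup>2) / z) = of_real ((norm (f z))\<^sup>2)"
      by (simp add: h_def complex_norm_square del: of_real_power)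
  qed
  moreover have "circ_mean (\<lambda>z. complex_of_real ((norm (f z))\<^sup>2)) (s * sqrt R) = of_real (circ_mean (\<lambda>z. (norm (f z))\<^sup>2) (s * sqrt R))"
    using s2(1) s3(1)
    by (intro circ_mean_linear bounded_linear_of_real continuous_intros continuous_on_subset[OF holomorphic_on_imp_continuous_on[OF f]]) auto
  ultimately show ?thesis by simp
qed

text \<open>In Taylor coefficients this is the sum of |a_n|^2 s^(2n) (1 - R^n)^2, expanded. The
  mixed term is a mean over the circle of geometric-mean radius, so the difference is small as soon
  as the three means are close to each other.\<close>

lemma circ_mean_norm_diff_dilation:
  assumes f: "f holomorphic_on ball 0 1" and s: "0 < s" "s < 1" and R: "0 < R" "R \<le> 1"
  shows "circ_mean (\<lambda>z. (norm (f z - f (of_real R * z)))\<^sup>2) s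
    = circ_mean (\<lambda>z. (norm (f z))\<^sup>2) s + circ_mean (\<lambda>z. (norm (f z))\<^sup>2) (s * R)
      - 2 * circ_mean (\<lambda>z. (norm (f z))\<^sup>2) (s * sqrt R)"
proof -
  have c: "continuous_on (sphere 0 \<bar>s\<bar>) f"
    using s by (intro continuous_on_subset[OF holomorphic_on_imp_continuous_on[OF f]]) auto
  have cR: "continuous_on (sphere 0 \<bar>s\<bar>) (\<lambda>z. f (of_real R * z))"
  proof (rule continuous_on_compose2[OF holomorphic_on_imp_continuous_on[OF f]])
    show "(\<lambda>z. complex_of_real R * z) ` sphere 0 \<bar>s\<bar> \<subseteq> ball 0 1"
    proof (rule image_subsetI)
      fix z :: complex assume "z \<in> sphere 0 \<bar>s\<bar>"
      then have "norm (of_real R * z) = R * s" using s R by (simp add: norm_mult)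
      also have "\<dots> \<le> s" using s R by (simp add: mult_left_le_one_le)
      finally show "of_real R * z \<in> ball 0 1" using s by simp
    qed
  qed (intro continuous_intros)
  have "circ_mean (\<lambda>z. (norm (f z - f (of_real R * z)))\<^sup>2) s
    = circ_mean (\<lambda>z. ((norm (f z))\<^sup>2 + (norm (f (of_real R * z)))\<^sup>2) - 2 * Re (f z * cnj (f (of_real R * z)))) s"
    unfolding cmod_power2 by (intro circ_mean_cong) (simp add: power2_eq_square algebra_simps)
  also have "\<dots> = circ_mean (\<lambda>z. (norm (f z))\<^sup>2) s + circ_mean (\<lambda>z. (norm (f (of_real R * z)))\<^sup>2) s
     - 2 * circ_mean (\<lambda>z. Re (f z * cnj (f (of_real R * z)))) s"
    by (subst circ_mean_diff circ_mean_add, (intro continuous_intros c cR)+)+ (simp only: circ_mean_cmult_real)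
  also have "circ_mean (\<lambda>z. (norm (f (of_real R * z)))\<^sup>2) s = circ_mean (\<lambda>z. (norm (f z))\<^sup>2) (s * R)"
    by (simp add: circ_mean_def mult_ac)
  also have "circ_mean (\<lambda>z. Re (f z * cnj (f (of_real R * z)))) s = Re (circ_mean (\<lambda>z. f z * cnj (f (of_real R * z))) s)"
    by (intro circ_mean_linear bounded_linear_Re continuous_intros c cR)
  finally show ?thesis
    using circ_mean_mult_cnj_dilation[OF assms] by simp
qed

section \<open>The radial maximal function\<close>

lemma integral_periodic:
  fixes g :: "real \<Rightarrow> real"
  assumes cont: "continuous_on UNIV g" and per: "\<And>x. g (x + T) = g x" and T: "0 < T" and a: "-T \<le> a" "a \<le> T"
  shows "integral {a..a+T} g = integral {0..T} g"
proof -
  have int: "g integrable_on {c..d}" for c d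
    using cont by (meson continuous_on_subset integrable_continuous_real subset_UNIV)
  have shift: "integral {c+T..d+T} g = integral {c..d} g" for c d
    using integral_shift_Icc_real[of c d g T] per by (simp add: o_def add.commute)
  have *: "integral {a..a+T} g = integral {0..T} g" if "0 \<le> a" "a \<le> T" for a
  proof -
    have "integral {a..a+T} g = integral {a..T} g + integral {0+T..a+T} g"
      using that T int Henstock_Kurzweil_Integration.integral_combine[where a=a and c=T and b="a + T" and f=g] by simp
    also have "\<dots> = integral {0..T} g"
      unfolding shift using that T int Henstock_Kurzweil_Integration.integral_combine[where a=0 and c=a and b=T and f=g] by simp
    finally show ?thesis .
  qed
  show ?thesis
  proof (cases "0 \<le> a")
    case False
    have "integral {a..a+T} g = integral {a+T..a+T+T} g" using shift[of a "a+T"] by simp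
    then show ?thesis using *[of "a+T"] False a by simp
  qed (use * a in auto)
qed

text \<open>Half the angle lies in [0, pi/4], where cosine is at least sqrt 2 / 2. The mean value
  theorem yields one such factor and the double-angle formula another; their product is 1/2.\<close>

lemma half_le_sin:
  assumes "0 \<le> y" "y \<le> pi / 2"
  shows "y / 2 \<le> sin y"
proof (cases "y = 0")
  case False
  define x where "x = y / 2"
  have x: "0 < x" "x \<le> pi / 4" using False assms by (auto simp: x_def)
  obtain \<xi> where \<xi>: "0 < \<xi>" "\<xi> < x" "sin x - sin 0 = (x - 0) * cos \<xi>"
    using MVT2[of 0 x sin cos] x by (auto intro: DERIV_sin)
  have "cos (pi / 4) \<le> cos \<xi>" "cos (pi / 4) \<le> cos x"
    using \<xi> x by (auto intro!: cos_monotone_0_pi_le)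
  then have c: "sqrt 2 / 2 \<le> cos \<xi>" "sqrt 2 / 2 \<le> cos x"
    by (auto simp: cos_45)
  have "x * (sqrt 2 / 2) \<le> sin x" using \<xi> c x by (auto intro: mult_left_mono)
  then have "(x * (sqrt 2 / 2)) * (sqrt 2 / 2) \<le> sin x * cos x"
    using c x by (intro mult_mono) (auto intro: sin_ge_zero)
  then have "x / 2 \<le> sin x * cos x" by (simp add: mult.assoc)
  moreover have "sin y = 2 * sin x * cos x" using sin_double[of x] by (simp add: x_def)
  ultimately show ?thesis by (auto simp: x_def)
qed simp

text \<open>The chord from 1 to \<open>cis x\<close> has length at least |x| / 2. Moving from 1 to
  \<open>\<rho>\<close> costs 1 - \<rho>, which is itself at most the distance from
  \<open>\<rho>\<close> to the circle; this loses a second factor 2.\<close>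

lemma norm_cis_diff_ge:
  assumes "\<bar>x\<bar> \<le> pi" "0 \<le> \<rho>" "\<rho> \<le> 1"
  shows "\<bar>x\<bar> / 4 \<le> norm (cis x - of_real \<rho>)"
proof -
  have "(norm (cis x - 1))\<^sup>2 = (2 * sin (x/2))\<^sup>2"
  proof -
    have "(norm (cis x - 1))\<^sup>2 = 2 - 2 * cos x"
      unfolding cmod_power2 using sin_cos_squared_add[of x] by (simp add: power2_eq_square algebra_simps)
    then show ?thesis using cos_double_sin[of "x/2"] by (simp add: power_mult_distrib)
  qed
  then have "norm (cis x - 1) = \<bar>2 * sin (x/2)\<bar>"
    by (metis abs_norm_cancel power2_eq_iff_nonneg abs_ge_zero power2_abs)
  also have "\<dots> = 2 * \<bar>sin (\<bar>x\<bar>/2)\<bar>" by (cases "x \<ge> 0") (auto simp: abs_mult)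
  finally have "\<bar>x\<bar> / 2 \<le> norm (cis x - 1)"
    using half_le_sin[of "\<bar>x\<bar>/2"] assms by auto
  also have "\<dots> \<le> norm (cis x - of_real \<rho>) + norm (of_real \<rho> - (1::complex))"
    using norm_triangle_ineq[of "cis x - of_real \<rho>" "of_real \<rho> - 1"] by simp
  also have "norm (of_real \<rho> - (1::complex)) = 1 - \<rho>"
    using assms by (metis abs_minus_commute abs_of_nonneg diff_ge_0_iff_ge norm_of_real of_real_1 of_real_diff)
  also have "1 - \<rho> \<le> norm (cis x - of_real \<rho>)"
    using norm_triangle_ineq2[of "cis x" "of_real \<rho>"] assms by simp
  finally show ?thesis by simp
qed

lemma poisson_kernel_cis:
  assumes "0 < s"
  shows "poisson_kernel (of_real s * cis \<theta>) (of_real (s * \<rho>) * cis t)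
     = (1 - \<rho>\<^sup>2) / (norm (cis (\<theta> - t) - of_real \<rho>))\<^sup>2"
proof -
  have "of_real s * cis \<theta> - of_real (s * \<rho>) * cis t = of_real s * cis t * (cis (\<theta> - t) - of_real \<rho>)"
    by (simp add: algebra_simps cis_mult)
  then have "(norm (of_real s * cis \<theta> - of_real (s * \<rho>) * cis t))\<^sup>2 = s\<^sup>2 * (norm (cis (\<theta> - t) - of_real \<rho>))\<^sup>2"
    by (simp add: norm_mult power_mult_distrib)
  moreover have "(norm (of_real s * cis \<theta>))\<^sup>2 - (norm (of_real (s * \<rho>) * cis t))\<^sup>2 = s\<^sup>2 * (1 - \<rho>\<^sup>2)"
    by (simp add: norm_mult power_mult_distrib algebra_simps)
  ultimately show ?thesis
    using assms unfolding poisson_kernel_def by simp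
qed

text \<open>The dyadic majorant reduces the radial maximal function to averages over intervals centred at \<open>t\<close>.\<close>
lemma poisson_dyadic_bound:
  assumes \<rho>: "1/2 \<le> \<rho>" "\<rho> < 1" and x: "\<bar>x\<bar> \<le> pi" and N: "pi \<le> 2 ^ N * (1 - \<rho>)"
  shows "(1 - \<rho>\<^sup>2) / (norm (cis x - of_real \<rho>))\<^sup>2
    \<le> (\<Sum>k\<le>N. 128 / (4 ^ k * (1 - \<rho>)) * (if \<bar>x\<bar> \<le> 2 ^ k * (1 - \<rho>) then 1 else 0))"
proof -
  define \<delta> where "\<delta> = 1 - \<rho>"
  have \<delta>: "0 < \<delta>" using \<rho> by (simp add: \<delta>_def)
  define k where "k = (LEAST k. \<bar>x\<bar> \<le> 2 ^ k * \<delta>)"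
  have ex: "\<bar>x\<bar> \<le> 2 ^ N * \<delta>" using x N by (simp add: \<delta>_def)
  have k: "\<bar>x\<bar> \<le> 2 ^ k * \<delta>" unfolding k_def by (rule LeastI) (rule ex)
  have kN: "k \<le> N" unfolding k_def by (rule Least_le) (rule ex)
  have num: "1 - \<rho>\<^sup>2 \<le> 2 * \<delta>"
    using \<rho> mult_left_mono[of "1 + \<rho>" 2 "1 - \<rho>"] by (simp add: \<delta>_def power2_eq_square algebra_simps)
  have n1: "\<delta> \<le> norm (cis x - of_real \<rho>)"
    using norm_triangle_ineq2[of "cis x" "of_real \<rho>"] \<rho> by (simp add: \<delta>_def)
  have "(1 - \<rho>\<^sup>2) / (norm (cis x - of_real \<rho>))\<^sup>2 \<le> 128 / (4 ^ k * \<delta>)"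
  proof -
    \<comment> \<open>The 8 is 2 * 4: minimality of \<open>k\<close> gives |x| > 2^(k-1) \<delta>,
      and the chord bound divides by 4. For k = 0 the distance \<delta> to the circle is used
      instead. Doubling the square of 8 gives the 128 of the statement.\<close>
    define m where "m = 2 ^ k * \<delta> / 8"
    have m: "0 < m" using \<delta> by (simp add: m_def)
    have mle: "m \<le> norm (cis x - of_real \<rho>)"
    proof (cases k)
      case 0
      then show ?thesis using n1 \<delta> by (simp add: m_def)
    next
      case (Suc j)
      then have "\<not> \<bar>x\<bar> \<le> 2 ^ j * \<delta>" using not_less_Least[of j "\<lambda>k. \<bar>x\<bar> \<le> 2 ^ k * \<delta>"] by (simp add: k_def)
      then have "m \<le> \<bar>x\<bar> / 4" using Suc by (simp add: m_def mult.commute)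
      then show ?thesis using norm_cis_diff_ge[OF x, of \<rho>] \<rho> by simp
    qed
    have "(1 - \<rho>\<^sup>2) / (norm (cis x - of_real \<rho>))\<^sup>2 \<le> (2 * \<delta>) / m\<^sup>2"
      using num mle m \<delta> by (intro frac_le power_mono) auto
    also have "\<dots> = 128 / (4 ^ k * \<delta>)"
    proof -
      have "m\<^sup>2 = 4 ^ k * \<delta>\<^sup>2 / 64"
        by (simp add: m_def power_mult_distrib power_divide power2_eq_square flip: power_mult_distrib)
      then show ?thesis using \<delta> by (simp only:) (simp add: power2_eq_square)
    qed
    finally show ?thesis .
  qed
  also have "\<dots> = 128 / (4 ^ k * \<delta>) * (if \<bar>x\<bar> \<le> 2 ^ k * \<delta> then 1 else 0)" using k by simp
  also have "\<dots> \<le> (\<Sum>k\<le>N. 128 / (4 ^ k * \<delta>) * (if \<bar>x\<bar> \<le> 2 ^ k * \<delta> then 1 else 0))"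
    using kN \<delta> by (intro member_le_sum[of k "{..N}" "\<lambda>k. 128 / (4 ^ k * \<delta>) * (if \<bar>x\<bar> \<le> 2 ^ k * \<delta> then 1 else 0)"]) auto
  finally show ?thesis by (simp add: \<delta>_def)
qed

text \<open>By contraposition: if all integrals are below \<open>c * r\<close>, the k-th dyadic term
  is at most 128 c 2^(-k), the sum at most 256 c, and 256 / (2 pi) is below 64. The restriction r
  \<le> 2 pi keeps the intervals within three periods.\<close>

lemma radial_average_large:
  assumes f: "continuous_on (cball 0 s) f" "f holomorphic_on ball 0 s" and s: "0 < s"
    and \<rho>: "1/2 \<le> \<rho>" "\<rho> < 1" and t: "0 \<le> t" "t \<le> 2 * pi"
    and large: "(norm (f (of_real (s * \<rho>) * cis t)))\<^sup>2 > 64 * c"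
  shows "\<exists>r. 0 < r \<and> r \<le> 2 * pi \<and> c * r \<le> integral {t-r..t+r} (\<lambda>\<theta>. (norm (f (of_real s * cis \<theta>)))\<^sup>2)"
proof (rule ccontr)
  define h where "h \<theta> = (norm (f (of_real s * cis \<theta>)))\<^sup>2" for \<theta>
  assume "\<not> ?thesis"
  then have small: "integral {t-r..t+r} h < c * r" if "0 < r" "r \<le> 2 * pi" for r
    using that unfolding h_def[abs_def] by force
  define \<delta> where "\<delta> = 1 - \<rho>"
  have \<delta>: "0 < \<delta>" "\<delta> \<le> 1/2" using \<rho> by (auto simp: \<delta>_def)
  have cf: "continuous_on (sphere 0 \<bar>s\<bar>) f" using s by (auto intro: continuous_on_subset[OF f(1)])
  have hc: "continuous_on S h" for S
    unfolding h_def using cf by (intro continuous_intros continuous_on_circle_param)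
  have h0: "0 \<le> h \<theta>" for \<theta> by (simp add: h_def)
  \<comment> \<open>\<open>N\<close> is large enough for the widest interval to have radius at least
    pi and, being least, small enough for that radius not to exceed 2 pi. It is not 0 because
    \<delta> \<le> 1/2.\<close>
  define N where "N = (LEAST N. pi \<le> 2 ^ N * \<delta>)"
  obtain n :: nat where "pi / \<delta> < 2 ^ n" using real_arch_pow[of 2 "pi/\<delta>"] by auto
  then have "pi \<le> 2 ^ n * \<delta>" using \<delta> by (simp add: field_simps)
  then have N: "pi \<le> 2 ^ N * \<delta>" unfolding N_def by (rule LeastI)
  have "N \<noteq> 0" using N \<delta> pi_gt3 by (intro notI) auto
  then obtain j where j: "N = Suc j" by (cases N) auto
  then have "\<not> pi \<le> 2 ^ j * \<delta>" using not_less_Least[of j "\<lambda>k. pi \<le> 2 ^ k * \<delta>"] by (simp add: N_def)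
  then have N2: "2 ^ N * \<delta> \<le> 2 * pi" using j by simp
  have rk: "0 < 2 ^ k * \<delta>" "2 ^ k * \<delta> \<le> 2 * pi" if "k \<le> N" for k
  proof -
    show "0 < 2 ^ k * \<delta>" using \<delta> by simp
    have "2 ^ k * \<delta> \<le> 2 ^ N * \<delta>" using that \<delta> by (intro mult_right_mono power_increasing) auto
    then show "2 ^ k * \<delta> \<le> 2 * pi" using N2 by simp
  qed
  have c: "0 < c" 
  proof -
    have "0 \<le> integral {t-1..t+1} h" by (intro integral_nonneg integrable_continuous_real hc h0)
    also have "\<dots> < c * 1" using pi_gt3 by (intro small) auto
    finally show ?thesis by simp
  qed
  define p where "p \<theta> = (1 - \<rho>\<^sup>2) / (norm (cis (\<theta> - t) - of_real \<rho>))\<^sup>2" for \<theta>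
  have nz: "cis x \<noteq> of_real \<rho>" for x
    using \<rho> by (metis abs_of_nonneg less_irrefl norm_cis norm_of_real half_gt_zero_iff less_eq_real_def less_le_trans zero_less_one)
  have pc: "continuous_on S p" for S
    unfolding p_def using nz by (intro continuous_intros) auto
  have "(norm (f (of_real (s * \<rho>) * cis t)))\<^sup>2 \<le> circ_mean (\<lambda>z. poisson_kernel z (of_real (s * \<rho>) * cis t) * (norm (f z))\<^sup>2) s"
    using s \<rho> by (intro norm_square_le_poisson f) (auto simp: norm_mult)
  also have "\<dots> = integral {0..2*pi} (\<lambda>\<theta>. p \<theta> * h \<theta>) / (2 * pi)"
    unfolding circ_mean_real p_def h_def poisson_kernel_cis[OF s] ..
  \<comment> \<open>The period is centred at \<open>t\<close> because the dyadic majorant holds only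
    for |\<theta> - t| \<le> pi.\<close>
  also have "integral {0..2*pi} (\<lambda>\<theta>. p \<theta> * h \<theta>) = integral {t-pi..t-pi+2*pi} (\<lambda>\<theta>. p \<theta> * h \<theta>)"
  proof (rule integral_periodic[symmetric])
    have c2: "cis (x + 2 * pi) = cis x" for x by (simp add: complex_eq_iff)
    have "cis (x + 2 * pi - t) = cis (x - t)" for x using c2[of "x - t"] by (simp add: algebra_simps)
    then show "p (x + 2 * pi) * h (x + 2 * pi) = p x * h x" for x
      by (simp add: p_def h_def c2)
    show "continuous_on UNIV (\<lambda>\<theta>. p \<theta> * h \<theta>)" by (intro continuous_intros pc hc)
  qed (use t in auto)
  also have "integral {t-pi..t-pi+2*pi} (\<lambda>\<theta>. p \<theta> * h \<theta>) \<le> (\<Sum>k\<le>N. 128 / (4 ^ k * \<delta>) * integral {t-2^k*\<delta>..t+2^k*\<delta>} h)"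
  proof -
    have 1: "((\<lambda>\<theta>. if \<theta> \<in> {t-pi..t-pi+2*pi} then p \<theta> * h \<theta> else 0) has_integral integral {t-pi..t-pi+2*pi} (\<lambda>\<theta>. p \<theta> * h \<theta>)) UNIV"
      unfolding has_integral_restrict_UNIV
      by (intro integrable_integral integrable_continuous_real continuous_intros pc hc)
    have 2: "((\<lambda>\<theta>. \<Sum>k\<le>N. 128 / (4 ^ k * \<delta>) * (if \<theta> \<in> {t-2^k*\<delta>..t+2^k*\<delta>} then h \<theta> else 0)) has_integral
        (\<Sum>k\<le>N. 128 / (4 ^ k * \<delta>) * integral {t-2^k*\<delta>..t+2^k*\<delta>} h)) UNIV"
      by (intro has_integral_sum has_integral_mult_right finite_atMost, unfold has_integral_restrict_UNIV,
          intro integrable_integral integrable_continuous_real hc)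
    show ?thesis
    proof (rule has_integral_le[OF 1 2])
      fix \<theta> :: real
      show "(if \<theta> \<in> {t-pi..t-pi+2*pi} then p \<theta> * h \<theta> else 0) \<le> (\<Sum>k\<le>N. 128 / (4 ^ k * \<delta>) * (if \<theta> \<in> {t-2^k*\<delta>..t+2^k*\<delta>} then h \<theta> else 0))"
      proof (cases "\<theta> \<in> {t-pi..t-pi+2*pi}")
        case True
        then have "\<bar>\<theta> - t\<bar> \<le> pi" by auto
        then have "p \<theta> \<le> (\<Sum>k\<le>N. 128 / (4 ^ k * \<delta>) * (if \<bar>\<theta> - t\<bar> \<le> 2 ^ k * \<delta> then 1 else 0))"
          using poisson_dyadic_bound[OF \<rho>, of "\<theta> - t" N] N unfolding p_def \<delta>_def by simp
        then have "p \<theta> * h \<theta> \<le> (\<Sum>k\<le>N. 128 / (4 ^ k * \<delta>) * (if \<bar>\<theta> - t\<bar> \<le> 2 ^ k * \<delta> then 1 else 0)) * h \<theta>"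
          using h0 by (rule mult_right_mono)
        also have "\<dots> = (\<Sum>k\<le>N. 128 / (4 ^ k * \<delta>) * (if \<theta> \<in> {t-2^k*\<delta>..t+2^k*\<delta>} then h \<theta> else 0))"
          unfolding sum_distrib_right by (intro sum.cong) (auto simp: abs_le_iff)
        finally show ?thesis using True by simp
      next
        case False
        have "0 \<le> (\<Sum>k\<le>N. 128 / (4 ^ k * \<delta>) * (if \<theta> \<in> {t-2^k*\<delta>..t+2^k*\<delta>} then h \<theta> else 0))"
          using h0 \<delta> by (intro sum_nonneg) auto
        then show ?thesis using False by (simp only: if_False)
      qed
    qed
  qed
  also have "(\<Sum>k\<le>N. 128 / (4 ^ k * \<delta>) * integral {t-2^k*\<delta>..t+2^k*\<delta>} h) \<le> (\<Sum>k\<le>N. 128 * c * (1/2) ^ k)"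
  proof (rule sum_mono)
    fix k assume "k \<in> {..N}"
    then have "integral {t-2^k*\<delta>..t+2^k*\<delta>} h \<le> c * (2 ^ k * \<delta>)" using small rk[of k] by force
    then have "128 / (4 ^ k * \<delta>) * integral {t-2^k*\<delta>..t+2^k*\<delta>} h \<le> 128 / (4 ^ k * \<delta>) * (c * (2 ^ k * \<delta>))"
      using \<delta> by (intro mult_left_mono) auto
    also have "(4::real) ^ k = 2 ^ k * 2 ^ k" by (simp flip: power_mult_distrib)
    finally show "128 / (4 ^ k * \<delta>) * integral {t-2^k*\<delta>..t+2^k*\<delta>} h \<le> 128 * c * (1/2) ^ k"
      using \<delta> \<open>(4::real) ^ k = 2 ^ k * 2 ^ k\<close> by (simp add: field_simps)
  qed
  also have "(\<Sum>k\<le>N. 128 * c * (1/2) ^ k) \<le> 128 * c * 2"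
  proof -
    have "(\<Sum>k\<le>N. (1/2) ^ k) \<le> (2::real)"
      by (subst sum_gp0) (simp add: field_simps)
    then show ?thesis using c by (simp flip: sum_distrib_left)
  qed
  finally have "(norm (f (of_real (s * \<rho>) * cis t)))\<^sup>2 \<le> 128 * c * 2 / (2 * pi)"
    by (simp add: divide_right_mono)
  also have "\<dots> \<le> 64 * c" using c pi_gt3 by (simp add: field_simps)
  finally show False using large by simp
qed

text \<open>Vitali's lemma selects disjoint intervals whose fivefold enlargements still cover
  \<open>E\<close>. An enlargement has length 10 r, at most 10 / c times the integral of
  \<open>h\<close> over the original interval, and disjointness bounds the sum of these integrals by
  the one over [a, b].\<close>

lemma weak_type_covering:
  fixes h :: "real \<Rightarrow> real"
  assumes cont: "continuous_on UNIV h" and h0: "\<And>x. 0 \<le> h x" and c: "0 < c"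
    and cov: "\<And>t. t \<in> E \<Longrightarrow> \<exists>r. 0 < r \<and> a \<le> t - r \<and> t + r \<le> b \<and> c * r \<le> integral {t-r..t+r} h"
  shows "emeasure lborel E \<le> ennreal (10 / c * integral {a..b} h)"
proof -
  obtain r where r: "\<And>t. t \<in> E \<Longrightarrow> 0 < r t \<and> a \<le> t - r t \<and> t + r t \<le> b \<and> c * r t \<le> integral {t-r t..t+r t} h"
    using cov by metis
  have rB: "0 < r t \<and> r t \<le> b - a" if "t \<in> E" for t using r[OF that] by linarith
  obtain C where C: "countable C" "C \<subseteq> E"
     "pairwise (\<lambda>i j. disjnt (ball i (r i)) (ball j (r j))) C"
     "E \<subseteq> (\<Union>i\<in>C. ball i (5 * r i))"
    by (rule Vitali_covering_lemma_balls[where S=E and K=E and a="\<lambda>x. x" and r=r and B="b - a"]) (use rB in auto)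
  have hm[measurable]: "h \<in> borel_measurable borel"
    using cont by (rule borel_measurable_continuous_onI)
  define \<nu> where "\<nu> = density lborel (\<lambda>x. ennreal (h x) * indicator {a..b} x)"
  have int: "h integrable_on {x..y}" for x y
    using cont by (meson continuous_on_subset integrable_continuous_real subset_UNIV)
  have nn: "(\<integral>\<^sup>+x. ennreal (h x) * indicator {x1..y1} x \<partial>lborel) = ennreal (integral {x1..y1} h)" for x1 y1
  proof -
    have "integral\<^sup>N lborel (\<lambda>x. if x \<in> {x1..y1} then h x else 0) = integral {x1..y1} h"
    proof (rule nn_integral_has_integral_lborel)
      show "((\<lambda>x. if x \<in> {x1..y1} then h x else 0) has_integral integral {x1..y1} h) UNIV"
        unfolding has_integral_restrict_UNIV by (intro integrable_integral int)
    qed (auto simp: h0)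
    moreover have "(\<integral>\<^sup>+x. ennreal (h x) * indicator {x1..y1} x \<partial>lborel) = integral\<^sup>N lborel (\<lambda>x. if x \<in> {x1..y1} then h x else 0)"
      by (intro nn_integral_cong) (auto simp: indicator_def)
    ultimately show ?thesis by simp
  qed
  define J where "J = to_nat_on C ` C"
  define A where "A q n = (if n \<in> J then ball (from_nat_into C n) (q * r (from_nat_into C n)) else {})" for q n
  have fn: "from_nat_into C n \<in> C" if "n \<in> J" for n
    using that C(1) by (auto simp: J_def)
  have inj: "from_nat_into C m \<noteq> from_nat_into C n" if "m \<in> J" "n \<in> J" "m \<noteq> n" for m n
    using that C(1) by (auto simp: J_def)
  have Am: "range (A q) \<subseteq> sets lborel" for q by (auto simp: A_def)
  have dis: "disjoint_family (A 1)"
    unfolding disjoint_family_on_def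
  proof (intro ballI impI)
    fix m n :: nat assume "m \<noteq> n"
    show "A 1 m \<inter> A 1 n = {}"
    proof (cases "m \<in> J \<and> n \<in> J")
      case True
      then show ?thesis
        using C(3) fn inj[OF _ _ \<open>m \<noteq> n\<close>] by (auto simp: A_def pairwise_def disjnt_def)
    qed (auto simp: A_def)
  qed
  have comp: "emeasure lborel (A 5 n) \<le> ennreal (10 / c) * emeasure \<nu> (A 1 n)" for n
  proof (cases "n \<in> J")
    case True
    define t where "t = from_nat_into C n"
    have t: "t \<in> E" using fn[OF True] C(2) by (auto simp: t_def)
    note rt = r[OF t]
    have b: "ball t (r t) = {t - r t<..<t + r t}" by (rule ball_eq_greaterThanLessThan)
    have "emeasure \<nu> (ball t (r t)) = (\<integral>\<^sup>+x. ennreal (h x) * indicator {a..b} x * indicator (ball t (r t)) x \<partial>lborel)"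
      unfolding \<nu>_def by (subst emeasure_density) auto
    also have "\<dots> = (\<integral>\<^sup>+x. ennreal (h x) * indicator {t - r t..t + r t} x \<partial>lborel)"
    proof (rule nn_integral_cong_AE)
      have "AE x in lborel. x \<noteq> t - r t" "AE x in lborel. x \<noteq> t + r t"
        by (auto intro: AE_lborel_singleton)
      then show "AE x in lborel. ennreal (h x) * indicator {a..b} x * indicator (ball t (r t)) x = ennreal (h x) * indicator {t - r t..t + r t} x"
        by eventually_elim (use rt b in \<open>auto simp: indicator_def\<close>)
    qed
    also have "\<dots> = ennreal (integral {t - r t..t + r t} h)" by (rule nn)
    finally have e: "emeasure \<nu> (A 1 n) = ennreal (integral {t - r t..t + r t} h)"
      using True by (simp add: A_def t_def)
    have "emeasure lborel (A 5 n) = ennreal (10 * r t)"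
      using True rt by (simp add: A_def ball_eq_greaterThanLessThan flip: t_def)
    also have "\<dots> \<le> ennreal (10 / c * integral {t - r t..t + r t} h)"
      using rt c by (intro ennreal_leI) (simp add: field_simps)
    also have "\<dots> = ennreal (10 / c) * emeasure \<nu> (A 1 n)"
      unfolding e using c by (intro ennreal_mult) (auto intro!: integral_nonneg int h0)
    finally show ?thesis .
  qed (simp add: A_def)
  have "E \<subseteq> (\<Union>n. A 5 n)"
  proof
    fix x assume "x \<in> E"
    then obtain i where "i \<in> C" "x \<in> ball i (5 * r i)" using C(4) by auto
    then have "x \<in> A 5 (to_nat_on C i)" using C(1) by (auto simp: A_def J_def)
    then show "x \<in> (\<Union>n. A 5 n)" by auto
  qed
  then have "emeasure lborel E \<le> emeasure lborel (\<Union>n. A 5 n)"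
    using Am[of 5] by (intro emeasure_mono) auto
  also have "\<dots> \<le> (\<Sum>n. emeasure lborel (A 5 n))"
    by (rule emeasure_subadditive_countably) (rule Am)
  also have "\<dots> \<le> (\<Sum>n. ennreal (10 / c) * emeasure \<nu> (A 1 n))"
    by (intro suminf_le comp) auto
  also have "\<dots> = ennreal (10 / c) * emeasure \<nu> (\<Union>n. A 1 n)"
    using Am[of 1] dis by (simp add: suminf_emeasure \<nu>_def)
  also have "\<dots> \<le> ennreal (10 / c) * emeasure \<nu> (space \<nu>)"
    by (intro mult_left_mono emeasure_space) auto
  also have "emeasure \<nu> (space \<nu>) = ennreal (integral {a..b} h)"
    unfolding \<nu>_def by (simp add: emeasure_density nn)
  also have "ennreal (10 / c) * \<dots> = ennreal (10 / c * integral {a..b} h)"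
    using c by (intro ennreal_mult[symmetric]) (auto intro!: integral_nonneg int h0)
  finally show ?thesis .
qed

section \<open>Innerness in mean\<close>

lemma continuous_on_circle_holomorphic:
  assumes "f holomorphic_on ball 0 1" "\<bar>r\<bar> < 1"
  shows "continuous_on (sphere 0 \<bar>r\<bar>) f"
  using assms by (intro continuous_on_subset[OF holomorphic_on_imp_continuous_on]) auto

text \<open>The maximal function is a supremum over uncountably many radii; writing its superlevel
  set as a union of open sets settles measurability.\<close>

lemma open_radial_large:
  assumes f: "f holomorphic_on ball 0 1" and s: "s \<le> 1"
  shows "open {t. \<exists>r. 1/2 < r \<and> r < s \<and> l < (norm (f (of_real r * cis t)))\<^sup>2}"
proof -
  have "open {t. l < (norm (f (of_real r * cis t)))\<^sup>2}" if "1/2 < r" "r < s" for r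
    using that s
    by (intro open_Collect_less continuous_intros continuous_on_circle_param continuous_on_circle_holomorphic[OF f]) auto
  moreover have "{t. \<exists>r. 1/2 < r \<and> r < s \<and> l < (norm (f (of_real r * cis t)))\<^sup>2}
      = (\<Union>r\<in>{1/2<..<s}. {t. l < (norm (f (of_real r * cis t)))\<^sup>2})"
    by auto
  ultimately show ?thesis by auto
qed

text \<open>Intervals of radius at most 2 pi around points of [0, 2 pi] stay in [-2 pi, 4 pi], that
  is, in three periods; hence 6 pi. The 640 is 10 from the covering times 64 from the dyadic
  sum.\<close>

lemma radial_maximal_measure_aux:
  assumes f: "f holomorphic_on ball 0 1" and l: "0 < l" and s: "0 < s" "s < 1"
  shows "emeasure lborel {t \<in> {0..2*pi}. \<exists>r. 1/2 < r \<and> r < s \<and> l < (norm (f (of_real r * cis t)))\<^sup>2}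
    \<le> ennreal (640 / l * (6 * pi * circ_mean (\<lambda>z. (norm (f z))\<^sup>2) s))"
proof -
  define h where "h \<theta> = (norm (f (of_real s * cis \<theta>)))\<^sup>2" for \<theta>
  have hc: "continuous_on UNIV h"
    unfolding h_def using s by (intro continuous_intros continuous_on_circle_param continuous_on_circle_holomorphic[OF f]) auto
  have int: "h integrable_on {c..d}" for c d
    using hc by (meson continuous_on_subset integrable_continuous_real subset_UNIV)
  have per: "h (x + 2 * pi) = h x" for x
  proof -
    have "cis (x + 2 * pi) = cis x" by (simp add: complex_eq_iff)
    then show ?thesis by (simp only: h_def)
  qed
  have f': "continuous_on (cball 0 s) f" "f holomorphic_on ball 0 s"
    using s by (auto intro!: continuous_on_subset[OF holomorphic_on_imp_continuous_on[OF f]] holomorphic_on_subset[OF f])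
  have "emeasure lborel {t \<in> {0..2*pi}. \<exists>r. 1/2 < r \<and> r < s \<and> l < (norm (f (of_real r * cis t)))\<^sup>2}
     \<le> ennreal (10 / (l / 64) * integral {-2*pi..4*pi} h)"
  proof (rule weak_type_covering[OF hc])
    fix t assume "t \<in> {t \<in> {0..2*pi}. \<exists>r. 1/2 < r \<and> r < s \<and> l < (norm (f (of_real r * cis t)))\<^sup>2}"
    then obtain r where r: "1/2 < r" "r < s" "l < (norm (f (of_real r * cis t)))\<^sup>2" and t: "0 \<le> t" "t \<le> 2 * pi"
      by auto
    have rs: "s * (r / s) = r" using s by simp
    have "1/2 \<le> r / s" "r / s < 1" using r s by (auto simp: field_simps)
    moreover have "(norm (f (of_real (s * (r / s)) * cis t)))\<^sup>2 > 64 * (l / 64)"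
      unfolding rs using r by simp
    ultimately obtain q where "0 < q" "q \<le> 2 * pi" "l / 64 * q \<le> integral {t-q..t+q} h"
      using radial_average_large[OF f' s(1) _ _ t, of "r / s" "l / 64"] unfolding h_def by blast
    then show "\<exists>r. 0 < r \<and> -2*pi \<le> t - r \<and> t + r \<le> 4*pi \<and> l / 64 * r \<le> integral {t-r..t+r} h"
      using t by (intro exI[of _ q]) auto
  qed (use l in \<open>auto simp: h_def\<close>)
  also have "integral {-2*pi..4*pi} h = integral {-2*pi..0} h + (integral {0..2*pi} h + integral {2*pi..4*pi} h)"
    using int Henstock_Kurzweil_Integration.integral_combine[where a="-2*pi" and c=0 and b="4*pi" and f=h]
      Henstock_Kurzweil_Integration.integral_combine[where a=0 and c="2*pi" and b="4*pi" and f=h] by simp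
  also have "\<dots> = 3 * integral {0..2*pi} h"
    using integral_periodic[OF hc per, of "-2*pi"] integral_periodic[OF hc per, of "2*pi"] by simp
  also have "\<dots> = 6 * pi * circ_mean (\<lambda>z. (norm (f z))\<^sup>2) s"
    unfolding circ_mean_real h_def by simp
  finally show ?thesis by simp
qed

lemma radial_maximal_measure:
  assumes f: "f holomorphic_on ball 0 1" and l: "0 < l" and s0: "s0 < 1"
    and bound: "\<And>s. s0 < s \<Longrightarrow> s < 1 \<Longrightarrow> circ_mean (\<lambda>z. (norm (f z))\<^sup>2) s \<le> \<epsilon>"
  shows "emeasure lborel {t \<in> {0..2*pi}. \<exists>r. 1/2 < r \<and> r < 1 \<and> l < (norm (f (of_real r * cis t)))\<^sup>2}
    \<le> ennreal (640 / l * (6 * pi * \<epsilon>))"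
proof -
  define m where "m = max s0 (1/2)"
  \<comment> \<open>The estimate on a circle of radius s sees only radii r < s, so r < 1 is
    exhausted by r < \<open>S n\<close> and the measure passes to the increasing union. The shift by
    2 puts even \<open>S 0\<close> strictly above \<open>m\<close>.\<close>
  define S where "S n = 1 - (1 - m) / (real n + 2)" for n
  define E where "E s = {t \<in> {0..2*pi}. \<exists>r. 1/2 < r \<and> r < s \<and> l < (norm (f (of_real r * cis t)))\<^sup>2}" for s
  have m: "1/2 \<le> m" "s0 \<le> m" "m < 1" using s0 by (auto simp: m_def)
  have S: "m < S n" "S n < 1" for n
  proof -
    have "(1 - m) / (real n + 2) < 1 - m" using m by (simp add: divide_less_eq)
    then show "m < S n" by (simp add: S_def)
    show "S n < 1" using m by (simp add: S_def)
  qed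
  have mono: "S i \<le> S j" if "i \<le> j" for i j
    unfolding S_def using m that by (intro diff_left_mono divide_left_mono) auto
  have "E 1 = (\<Union>n. E (S n))"
  proof (intro equalityI subsetI)
    fix t assume "t \<in> E 1"
    then obtain r where r: "1/2 < r" "r < 1" "l < (norm (f (of_real r * cis t)))\<^sup>2" "t \<in> {0..2*pi}"
      by (auto simp: E_def)
    obtain n where n: "(1 - m) / (1 - r) < real n" using reals_Archimedean2 by blast
    then have "(1 - m) / (1 - r) < real n + 2" by simp
    then have "r < S n" using r m by (simp add: S_def field_simps)
    then show "t \<in> (\<Union>n. E (S n))" using r by (auto simp: E_def)
  next
    fix t assume "t \<in> (\<Union>n. E (S n))"
    then show "t \<in> E 1" using S(2) unfolding E_def by (auto intro: less_trans)
  qed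
  moreover have "(SUP n. emeasure lborel (E (S n))) = emeasure lborel (\<Union>n. E (S n))"
  proof (rule SUP_emeasure_incseq)
    show "incseq (\<lambda>n. E (S n))"
      using mono unfolding incseq_def E_def by (auto intro: less_le_trans)
    have "E (S n) \<in> sets borel" for n
    proof -
      have "E (S n) = {0..2*pi} \<inter> {t. \<exists>r. 1/2 < r \<and> r < S n \<and> l < (norm (f (of_real r * cis t)))\<^sup>2}"
        by (auto simp: E_def)
      then show ?thesis using open_radial_large[OF f, of "S n" l] S(2)[of n] by auto
    qed
    then show "range (\<lambda>n. E (S n)) \<subseteq> sets lborel" by auto
  qed
  moreover have "emeasure lborel (E (S n)) \<le> ennreal (640 / l * (6 * pi * \<epsilon>))" for n
  proof -
    have "emeasure lborel (E (S n)) \<le> ennreal (640 / l * (6 * pi * circ_mean (\<lambda>z. (norm (f z))\<^sup>2) (S n)))"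
      unfolding E_def using S[of n] m by (intro radial_maximal_measure_aux f l) auto
    also have "\<dots> \<le> ennreal (640 / l * (6 * pi * \<epsilon>))"
      using S[of n] m l by (intro ennreal_leI mult_left_mono bound) auto
    finally show ?thesis .
  qed
  ultimately have "emeasure lborel (E 1) \<le> ennreal (640 / l * (6 * pi * \<epsilon>))"
    by (metis SUP_least)
  then show ?thesis by (simp add: E_def)
qed

text \<open>An \<open>L\<^sup>2\<close> form of innerness, which behaves well under composition and limits.\<close>
definition mean_inner :: "(complex \<Rightarrow> complex) \<Rightarrow> bool" where
  "mean_inner u \<longleftrightarrow> u holomorphic_on ball 0 1 \<and> (\<forall>z\<in>ball 0 1. norm (u z) \<le> 1) \<and>
     ((\<lambda>r. circ_mean (\<lambda>z. (norm (u z))\<^sup>2) r) \<longlongrightarrow> 1) (at_left 1)"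

lemma circ_mean_norm_square_le_1:
  assumes "u holomorphic_on ball 0 1" "\<And>z. z \<in> ball 0 1 \<Longrightarrow> norm (u z) \<le> 1" "\<bar>r\<bar> < 1"
  shows "circ_mean (\<lambda>z. (norm (u z))\<^sup>2) r \<le> 1"
proof -
  have "circ_mean (\<lambda>z. (norm (u z))\<^sup>2) r \<le> circ_mean (\<lambda>z. 1) r"
    using assms by (intro circ_mean_mono continuous_intros continuous_on_circle_holomorphic) (auto simp: power_le_one)
  then show ?thesis by simp
qed

lemma mean_inner_eventually:
  assumes "mean_inner u" "0 < \<epsilon>"
  obtains r0 where "0 < r0" "r0 < 1" "\<And>r. r0 \<le> r \<Longrightarrow> r < 1 \<Longrightarrow> 1 - \<epsilon> < circ_mean (\<lambda>z. (norm (u z))\<^sup>2) r"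
proof -
  have "\<forall>\<^sub>F r in at_left 1. 1 - \<epsilon> < circ_mean (\<lambda>z. (norm (u z))\<^sup>2) r"
    using assms by (intro order_tendstoD(1)[of _ 1]) (auto simp: mean_inner_def)
  then obtain b where b: "b < 1" "\<And>r. b < r \<Longrightarrow> r < 1 \<Longrightarrow> 1 - \<epsilon> < circ_mean (\<lambda>z. (norm (u z))\<^sup>2) r"
    using eventually_at_left[of 0 "1::real"] by auto
  show ?thesis
    by (rule that[of "(max b 0 + 1) / 2"]) (use b in auto)
qed

text \<open>In the identity for dilation differences two means are at most 1, and the subtracted one
  exceeds 1 - \<epsilon> because its radius \<open>s * sqrt R\<close> is still at least
  \<open>R\<close>.\<close>

lemma mean_inner_dilation:
  assumes u: "mean_inner u" and \<epsilon>: "0 < \<epsilon>"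
  obtains R where "1/2 \<le> R" "R < 1"
    "\<And>r. R \<le> r \<Longrightarrow> r < 1 \<Longrightarrow> 1 - \<epsilon> < circ_mean (\<lambda>z. (norm (u z))\<^sup>2) r"
    "\<And>s. sqrt R < s \<Longrightarrow> s < 1 \<Longrightarrow> circ_mean (\<lambda>z. (norm (u z - u (of_real R * z)))\<^sup>2) s \<le> 2 * \<epsilon>"
proof -
  obtain r0 where r0: "0 < r0" "r0 < 1" "\<And>r. r0 \<le> r \<Longrightarrow> r < 1 \<Longrightarrow> 1 - \<epsilon> < circ_mean (\<lambda>z. (norm (u z))\<^sup>2) r"
    using mean_inner_eventually[OF u \<epsilon>] by blast
  define R where "R = max r0 (1/2)"
  have R: "1/2 \<le> R" "R < 1" "r0 \<le> R" using r0 by (auto simp: R_def)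
  show ?thesis
  proof (rule that[of R])
    fix s assume s: "sqrt R < s" "s < 1"
    have "0 < sqrt R" using R by simp
    then have s0: "0 < s" using s by linarith
    have "sqrt R * sqrt R \<le> s * sqrt R" using s R by (intro mult_right_mono) auto
    then have "r0 \<le> s * sqrt R" using R by simp
    moreover have "s * sqrt R < 1 * 1" using s R by (intro mult_strict_mono) auto
    ultimately have "1 - \<epsilon> < circ_mean (\<lambda>z. (norm (u z))\<^sup>2) (s * sqrt R)" using r0 by simp
    moreover have "circ_mean (\<lambda>z. (norm (u z))\<^sup>2) s \<le> 1" 
      using u s s0 by (intro circ_mean_norm_square_le_1) (auto simp: mean_inner_def)
    moreover have "circ_mean (\<lambda>z. (norm (u z))\<^sup>2) (s * R) \<le> 1" 
    proof -
      have "s * R < 1 * 1" using s R by (intro mult_strict_mono) auto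
      then show ?thesis using u s0 R by (intro circ_mean_norm_square_le_1) (auto simp: mean_inner_def abs_mult)
    qed
    moreover have "circ_mean (\<lambda>z. (norm (u z - u (of_real R * z)))\<^sup>2) s
       = circ_mean (\<lambda>z. (norm (u z))\<^sup>2) s + circ_mean (\<lambda>z. (norm (u z))\<^sup>2) (s * R)
      - 2 * circ_mean (\<lambda>z. (norm (u z))\<^sup>2) (s * sqrt R)"
      using u s s0 R by (intro circ_mean_norm_diff_dilation) (auto simp: mean_inner_def)
    ultimately show "circ_mean (\<lambda>z. (norm (u z - u (of_real R * z)))\<^sup>2) s \<le> 2 * \<epsilon>" by simp
  qed (use R r0 in auto)
qed

section \<open>Equivalence of mean innerness and innerness\<close>

lemma nn_integral_circle:
  assumes "continuous_on (sphere 0 \<bar>r\<bar>) h" "\<And>z. 0 \<le> h z"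
  shows "(\<integral>\<^sup>+t. ennreal (h (of_real r * cis t)) * indicator {0..2*pi} t \<partial>lborel) = ennreal (2 * pi * circ_mean h r)"
proof -
  let ?h = "\<lambda>t. h (of_real r * cis t)"
  have [measurable]: "?h \<in> borel_measurable borel"
    by (intro borel_measurable_continuous_onI continuous_on_circle_param assms)
  have "integral\<^sup>N lborel (\<lambda>t. if t \<in> {0..2*pi} then ?h t else 0) = integral {0..2*pi} ?h"
  proof (rule nn_integral_has_integral_lborel)
    show "((\<lambda>t. if t \<in> {0..2*pi} then ?h t else 0) has_integral integral {0..2*pi} ?h) UNIV"
      unfolding has_integral_restrict_UNIV by (intro integrable_integral integrable_circle assms)
  qed (auto simp: assms)
  moreover have "(\<integral>\<^sup>+t. ennreal (?h t) * indicator {0..2*pi} t \<partial>lborel) = integral\<^sup>N lborel (\<lambda>t. if t \<in> {0..2*pi} then ?h t else 0)"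
    by (intro nn_integral_cong) (auto simp: indicator_def)
  ultimately show ?thesis by (simp add: circ_mean_real)
qed

text \<open>By Borel--Cantelli, for almost every \<open>t\<close> the dilations of \<open>u\<close>
  converge to \<open>u\<close> uniformly on the radius. Each dilation is continuous up to r = 1, so
  the two limits may be interchanged and the radial limit exists.\<close>

lemma mean_inner_radial_limit:
  assumes u: "mean_inner u"
  shows "AE t in lborel. t \<in> {0..2*pi} \<longrightarrow> (\<exists>l. radial_limit u t l)"
proof -
  have hol: "u holomorphic_on ball 0 1" using u by (simp add: mean_inner_def)
  \<comment> \<open>A mean square error of order 8^(-k) against the threshold 4^(-k) leaves
    exceptional sets of measure of order 2^(-k), which is summable, while the deviation 2^(-k)
    outside them still tends to 0.\<close>
  define P where "P k R \<longleftrightarrow> 1/2 \<le> R \<and> R < 1 \<and> (\<forall>s. sqrt R < s \<longrightarrow> s < 1 \<longrightarrow>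
     circ_mean (\<lambda>z. (norm (u z - u (of_real R * z)))\<^sup>2) s \<le> 2 * (1/8) ^ k)" for k R
  have "\<exists>R. P k R" for k
  proof -
    obtain R where "1/2 \<le> R" "R < 1"
      "\<And>s. sqrt R < s \<Longrightarrow> s < 1 \<Longrightarrow> circ_mean (\<lambda>z. (norm (u z - u (of_real R * z)))\<^sup>2) s \<le> 2 * (1/8) ^ k"
      by (rule mean_inner_dilation[OF u, of "(1/8) ^ k"]) auto
    then show ?thesis unfolding P_def by blast
  qed
  then obtain R where PR: "\<And>k. P k (R k)" by metis
  have R: "1/2 \<le> R k" "R k < 1" for k using PR[of k] by (auto simp: P_def)
  define h where "h k z = u z - u (of_real (R k) * z)" for k z
  have Rz: "of_real (R k) * z \<in> ball 0 1" if "norm z \<le> 1" for k and z :: complex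
  proof -
    have "R k * norm z \<le> R k" using that R[of k] by (intro mult_left_le) auto
    then have "R k * norm z < 1" using R(2)[of k] by linarith
    then show ?thesis using R(1)[of k] by (simp add: norm_mult)
  qed
  have holh: "h k holomorphic_on ball 0 1" for k
  proof -
    have "(u \<circ> (\<lambda>z. of_real (R k) * z)) holomorphic_on ball 0 1"
      using Rz by (intro holomorphic_on_compose_gen[OF _ hol] holomorphic_intros) force
    then show ?thesis unfolding h_def by (intro holomorphic_intros hol) (simp add: o_def)
  qed
  define E where "E k = {t \<in> {0..2*pi}. \<exists>r. 1/2 < r \<and> r < 1 \<and> (1/4) ^ k < (norm (h k (of_real r * cis t)))\<^sup>2}" for k
  have Em: "E k \<in> sets lborel" for k
  proof -
    have "E k = {0..2*pi} \<inter> {t. \<exists>r. 1/2 < r \<and> r < 1 \<and> (1/4) ^ k < (norm (h k (of_real r * cis t)))\<^sup>2}"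
      by (auto simp: E_def)
    then show ?thesis using open_radial_large[OF holh, of 1 "(1/4) ^ k" k] by auto
  qed
  have Ee: "emeasure lborel (E k) \<le> ennreal (7680 * pi * (1/2) ^ k)" for k
  proof -
    have "sqrt (R k) < 1" using R[of k] by simp
    then have "emeasure lborel (E k) \<le> ennreal (640 / (1/4) ^ k * (6 * pi * (2 * (1/8) ^ k)))"
      unfolding E_def using PR[of k]
      by (intro radial_maximal_measure[OF holh, of _ "sqrt (R k)"]) (auto simp: P_def h_def)
    also have "(1/8::real) ^ k = (1/4) ^ k * (1/2) ^ k" by (simp flip: power_mult_distrib)
    finally show ?thesis by (simp add: mult_ac)
  qed
  have "AE t in lborel. eventually (\<lambda>k. t \<in> space lborel - E k) sequentially"
  proof (rule borel_cantelli_AE1[OF Em])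
    show fin: "emeasure lborel (E k) < \<infinity>" for k
      using le_less_trans[OF Ee[of k] ennreal_less_top] by simp
    have me: "measure lborel (E k) \<le> 7680 * pi * (1/2) ^ k" for k
      unfolding measure_def by (rule enn2real_leI[OF _ Ee]) simp
    have "summable (\<lambda>k. 7680 * pi * (1/2) ^ k)" by (intro summable_mult summable_geometric) simp
    then show "summable (\<lambda>k. measure lborel (E k))"
    proof (rule summable_comparison_test'[where N=0])
      show "norm (measure lborel (E k)) \<le> 7680 * pi * (1/2) ^ k" for k
        unfolding real_norm_def abs_of_nonneg[OF measure_nonneg] by (rule me)
    qed
  qed
  then show ?thesis
  proof eventually_elim
    case (elim t)
    show ?case
    proof
      assume t: "t \<in> {0..2*pi}"
      define I where "I = {1/2<..<(1::real)}"
      define v where "v k = u (of_real (R k) * cis t)" for k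
      have close: "\<forall>\<^sub>F k in sequentially. \<forall>r\<in>I. norm (u (of_real r * cis t) - u (of_real (R k * r) * cis t)) \<le> (1/2) ^ k"
        using elim
      proof eventually_elim
        case (elim k)
        show ?case
        proof
          fix r assume "r \<in> I"
          moreover have "\<not> (1/2 < r \<and> r < 1 \<and> (1/4) ^ k < (norm (h k (of_real r * cis t)))\<^sup>2)"
            using elim t unfolding E_def by blast
          ultimately have "(norm (h k (of_real r * cis t)))\<^sup>2 \<le> (1/4) ^ k"
            unfolding I_def greaterThanLessThan_iff by linarith
          also have "\<dots> = ((1/2) ^ k)\<^sup>2" by (simp add: power2_eq_square flip: power_mult_distrib)
          finally have "norm (h k (of_real r * cis t)) \<le> (1/2) ^ k"
            by (rule power2_le_imp_le) auto
          then show "norm (u (of_real r * cis t) - u (of_real (R k * r) * cis t)) \<le> (1/2) ^ k"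
            by (simp add: h_def mult_ac)
        qed
      qed
      have lim: "((\<lambda>r. u (of_real (R k * r) * cis t)) \<longlongrightarrow> v k) (at 1 within I)" for k
      proof -
        have "isCont u (of_real (R k) * cis t)"
          using Rz[of "cis t" k] hol by (intro continuous_on_interior[of "ball 0 1"] holomorphic_on_imp_continuous_on) auto
        moreover have "((\<lambda>r. of_real (R k * r) * cis t) \<longlongrightarrow> of_real (R k * 1) * cis t) (at 1 within I)"
          by (intro tendsto_intros)
        ultimately show ?thesis unfolding v_def mult_1_right by (rule isCont_tendsto_compose)
      qed
      have I: "at 1 within I = at_left 1"
        unfolding I_def by (rule at_within_nhd[of _ "{1/2<..}"]) auto
      have ul: "uniform_limit I (\<lambda>k r. u (of_real (R k * r) * cis t)) (\<lambda>r. u (of_real r * cis t)) sequentially"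
      proof (rule uniform_limitI)
        fix e :: real assume "0 < e"
        have "(\<lambda>k. (1/2) ^ k :: real) \<longlonglongrightarrow> 0" by (intro LIMSEQ_realpow_zero) auto
        then have "\<forall>\<^sub>F k in sequentially. (1/2) ^ k < e" using \<open>0 < e\<close> by (rule order_tendstoD)
        then show "\<forall>\<^sub>F k in sequentially. \<forall>r\<in>I. dist (u (of_real (R k * r) * cis t)) (u (of_real r * cis t)) < e"
          using close
        proof eventually_elim
          case (elim k)
          then show ?case by (force simp: dist_norm norm_minus_commute)
        qed
      qed
      have "Cauchy v"
      proof (rule metric_CauchyI)
        fix e :: real assume "0 < e"
        then have "\<forall>\<^sub>F k in sequentially. \<forall>r\<in>I. dist (u (of_real (R k * r) * cis t)) (u (of_real r * cis t)) < e / 3"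
          using uniform_limitD[OF ul, of "e/3"] by simp
        then obtain K where K: "\<And>k r. k \<ge> K \<Longrightarrow> r \<in> I \<Longrightarrow> dist (u (of_real (R k * r) * cis t)) (u (of_real r * cis t)) < e / 3"
          unfolding eventually_sequentially by auto
        have "dist (v m) (v n) < e" if "m \<ge> K" "n \<ge> K" for m n
        proof -
          have "dist (v m) (v n) \<le> 2 * e / 3"
          proof (rule tendsto_upperbound)
            show "((\<lambda>r. dist (u (of_real (R m * r) * cis t)) (u (of_real (R n * r) * cis t))) \<longlongrightarrow> dist (v m) (v n)) (at 1 within I)"
              by (intro tendsto_intros lim)
            have "dist (u (of_real (R m * r) * cis t)) (u (of_real (R n * r) * cis t)) \<le> 2 * e / 3" if "r \<in> I" for r
              using K[OF \<open>m \<ge> K\<close> that] K[OF \<open>n \<ge> K\<close> that]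
                dist_triangle2[of "u (of_real (R m * r) * cis t)" "u (of_real (R n * r) * cis t)" "u (of_real r * cis t)"]
              by linarith
            then show "\<forall>\<^sub>F r in at 1 within I. dist (u (of_real (R m * r) * cis t)) (u (of_real (R n * r) * cis t)) \<le> 2 * e / 3"
              by (auto simp: eventually_at_topological)
          qed (simp add: I)
          then show ?thesis using \<open>0 < e\<close> by simp
        qed
        then show "\<exists>M. \<forall>m\<ge>M. \<forall>n\<ge>M. dist (v m) (v n) < e" by blast
      qed
      then obtain l where l: "v \<longlonglongrightarrow> l" using Cauchy_convergent convergent_def by blast
      have "((\<lambda>r. u (of_real r * cis t)) \<longlongrightarrow> l) (at 1 within I)"
        by (rule swap_uniform_limit[OF always_eventually[OF allI[OF lim]] l ul]) simp
      then show "\<exists>l. radial_limit u t l" unfolding radial_limit_def I by blast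
    qed
  qed
qed

text \<open>Once radial limits exist, Fatou's lemma for 1 - |u|^2 along radii tending to 1 shows
  that they are unimodular almost everywhere.\<close>

theorem mean_inner_imp_inner_function:
  assumes u: "mean_inner u"
  shows "inner_function u"
proof -
  have hol: "u holomorphic_on ball 0 1" and le: "\<And>z. z \<in> ball 0 1 \<Longrightarrow> norm (u z) \<le> 1"
    using u by (auto simp: mean_inner_def)
  define \<rho> where "\<rho> n = 1 - 1 / (real n + 2)" for n
  have \<rho>: "0 < \<rho> n" "\<rho> n < 1" for n by (auto simp: \<rho>_def field_simps)
  have "\<rho> \<longlonglongrightarrow> 1" unfolding \<rho>_def by real_asymp
  then have fl: "filterlim \<rho> (at_left 1) sequentially"
    using \<rho> by (auto simp: filterlim_at intro!: always_eventually less_imp_neq)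
  \<comment> \<open>On the disc this is 1 - |u|^2; the absolute value makes it nonnegative in the
    whole plane, also where \<open>u\<close> is arbitrary.\<close>
  define q where "q z = \<bar>1 - (norm (u z))\<^sup>2\<bar>" for z
  define F where "F n t = ennreal (q (of_real (\<rho> n) * cis t)) * indicator {0..2*pi} t" for n t
  have qc: "continuous_on (sphere 0 \<bar>\<rho> n\<bar>) q" for n
    unfolding q_def using \<rho>[of n] by (intro continuous_intros continuous_on_circle_holomorphic[OF hol]) auto
  have [measurable]: "(\<lambda>t. q (of_real (\<rho> n) * cis t)) \<in> borel_measurable borel" for n
    by (intro borel_measurable_continuous_onI continuous_on_circle_param qc)
  have Fm[measurable]: "F n \<in> borel_measurable lborel" for n unfolding F_def by measurable
  have m: "circ_mean q (\<rho> n) = 1 - circ_mean (\<lambda>z. (norm (u z))\<^sup>2) (\<rho> n)" for n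
  proof -
    have "circ_mean q (\<rho> n) = circ_mean (\<lambda>z. 1 - (norm (u z))\<^sup>2) (\<rho> n)"
      using \<rho>[of n] le by (intro circ_mean_cong) (auto simp: q_def power_le_one)
    also have "\<dots> = 1 - circ_mean (\<lambda>z. (norm (u z))\<^sup>2) (\<rho> n)"
      using \<rho>[of n] by (subst circ_mean_diff, (intro continuous_intros continuous_on_circle_holomorphic[OF hol])+) auto
    finally show ?thesis .
  qed
  have "(\<lambda>n. circ_mean (\<lambda>z. (norm (u z))\<^sup>2) (\<rho> n)) \<longlonglongrightarrow> 1"
    using u filterlim_compose[OF _ fl] by (auto simp: mean_inner_def)
  then have "(\<lambda>n. ennreal (2 * pi * circ_mean q (\<rho> n))) \<longlonglongrightarrow> ennreal (2 * pi * (1 - 1))"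
    unfolding m by (intro tendsto_intros)
  then have "(\<lambda>n. integral\<^sup>N lborel (F n)) \<longlonglongrightarrow> 0"
    unfolding F_def by (subst nn_integral_circle[OF qc]) (auto simp: q_def)
  then have "liminf (\<lambda>n. integral\<^sup>N lborel (F n)) = 0"
    by (intro lim_imp_Liminf) auto
  then have "(\<integral>\<^sup>+t. liminf (\<lambda>n. F n t) \<partial>lborel) = 0"
    using nn_integral_liminf[of F lborel] Fm by simp
  then have "AE t in lborel. liminf (\<lambda>n. F n t) = 0"
    by (subst (asm) nn_integral_0_iff_AE) auto
  then have "AE t in lborel. t \<in> {0..2*pi} \<longrightarrow> (\<exists>l. radial_limit u t l \<and> norm l = 1)"
    using mean_inner_radial_limit[OF u]
  proof eventually_elim
    case (elim t)
    show ?case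
    proof
      assume t: "t \<in> {0..2*pi}"
      then obtain l where l: "radial_limit u t l" using elim by blast
      then have "(\<lambda>n. u (of_real (\<rho> n) * cis t)) \<longlonglongrightarrow> l"
        unfolding radial_limit_def using filterlim_compose[OF _ fl] by blast
      then have "(\<lambda>n. ennreal (q (of_real (\<rho> n) * cis t))) \<longlonglongrightarrow> ennreal \<bar>1 - (norm l)\<^sup>2\<bar>"
        unfolding q_def by (intro tendsto_intros)
      then have "(\<lambda>n. F n t) \<longlonglongrightarrow> ennreal \<bar>1 - (norm l)\<^sup>2\<bar>" using t by (simp add: F_def)
      then have "liminf (\<lambda>n. F n t) = ennreal \<bar>1 - (norm l)\<^sup>2\<bar>" by (intro lim_imp_Liminf) auto
      then have "\<bar>1 - (norm l)\<^sup>2\<bar> \<le> 0" using elim by simp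
      then have "(norm l)\<^sup>2 = 1\<^sup>2" by simp
      then have "norm l = 1" by (rule power2_eq_imp_eq) auto
      then show "\<exists>l. radial_limit u t l \<and> norm l = 1" using l by blast
    qed
  qed
  then show ?thesis
    unfolding inner_function_def using hol le by (auto intro: AE_completion)
qed

text \<open>Dominated convergence with bound 1. As that theorem concerns sequences, the limit at 1
  is tested along arbitrary sequences of radii.\<close>

theorem inner_function_imp_mean_inner:
  assumes "inner_function u"
  shows "mean_inner u"
proof -
  have hol: "u holomorphic_on ball 0 1" and le: "\<And>z. z \<in> ball 0 1 \<Longrightarrow> norm (u z) \<le> 1"
    and ae: "AE t in lborel. t \<in> {0..2*pi} \<longrightarrow> (\<exists>l. radial_limit u t l \<and> norm l = 1)"
    using assms unfolding inner_function_def AE_completion_iff by auto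
  have "((\<lambda>r. circ_mean (\<lambda>z. (norm (u z))\<^sup>2) r) \<longlongrightarrow> 1) (at_left 1)"
  proof (rule tendsto_at_left_sequentially[of 0])
    fix S :: "nat \<Rightarrow> real" assume S: "\<And>n. S n < 1" "\<And>n. 0 < S n" "S \<longlonglongrightarrow> 1"
    then have fl: "filterlim S (at_left 1) sequentially" by (auto simp: filterlim_at intro!: always_eventually less_imp_neq)
    define g where "g n t = (norm (u (of_real (S n) * cis t)))\<^sup>2" for n t
    have gc: "continuous_on X (g n)" for n X
      unfolding g_def using S(1,2)[of n] by (intro continuous_intros continuous_on_circle_param continuous_on_circle_holomorphic[OF hol]) auto
    have g1: "\<bar>g n t\<bar> \<le> 1" for n t
      unfolding g_def using S(1,2)[of n] le[of "of_real (S n) * cis t"] by (simp add: norm_mult power_le_one)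
    have [measurable]: "g n \<in> borel_measurable borel" for n
      by (intro borel_measurable_continuous_onI gc)
    have "(\<lambda>n. \<integral>t. indicator {0..2*pi} t *\<^sub>R g n t \<partial>lborel) \<longlonglongrightarrow> (\<integral>t. indicator {0..2*pi} t *\<^sub>R 1 \<partial>lborel)"
    proof (rule integral_dominated_convergence[where w="indicator {0..2*pi}"])
      show "AE t in lborel. (\<lambda>n. indicator {0..2*pi} t *\<^sub>R g n t) \<longlonglongrightarrow> indicator {0..2*pi} t *\<^sub>R (1::real)"
        using ae
      proof eventually_elim
        case (elim t)
        show ?case
        proof (cases "t \<in> {0..2*pi}")
          case True
          then obtain l where l: "radial_limit u t l" "norm l = 1" using elim by blast
          have "(\<lambda>n. u (of_real (S n) * cis t)) \<longlonglongrightarrow> l"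
            using l(1) unfolding radial_limit_def by (rule filterlim_compose[OF _ fl])
          then have "(\<lambda>n. g n t) \<longlonglongrightarrow> (norm l)\<^sup>2" unfolding g_def by (intro tendsto_intros)
          then show ?thesis using True l by simp
        qed simp
      qed
      show "AE t in lborel. norm (indicator {0..2*pi} t *\<^sub>R g n t) \<le> indicator {0..2*pi} t" for n
        using g1 by (intro AE_I2) (simp add: indicator_def)
    qed auto
    moreover have "(\<integral>t. indicator {0..2*pi} t *\<^sub>R g n t \<partial>lborel) = integral {0..2*pi} (g n)" for n
      using set_borel_integral_eq_integral(2)[OF borel_integrable_atLeastAtMost'[OF gc]]
      by (simp add: set_lebesgue_integral_def)
    ultimately have "(\<lambda>n. integral {0..2*pi} (g n)) \<longlonglongrightarrow> 2 * pi" by simp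
    then have "(\<lambda>n. integral {0..2*pi} (g n) / (2 * pi)) \<longlonglongrightarrow> 2 * pi / (2 * pi)"
      by (intro tendsto_intros) auto
    then show "(\<lambda>n. circ_mean (\<lambda>z. (norm (u z))\<^sup>2) (S n)) \<longlonglongrightarrow> 1"
      by (simp add: circ_mean_real g_def[abs_def])
  qed simp
  then show ?thesis using hol le by (simp add: mean_inner_def)
qed

section \<open>Composition of inner functions\<close>

text \<open>A Poisson integral is harmonic and remains so after composition with \<phi>, so the mean
  value property applies. Concretely, Fubini lets the mean over \<open>z\<close> act on the kernel
  alone.\<close>

lemma poisson_subordination:
  assumes \<phi>: "\<phi> holomorphic_on ball 0 1" and r: "0 < r" "r < 1"
    and s: "\<And>z. norm z \<le> r \<Longrightarrow> norm (\<phi> z) < s" and g: "continuous_on (sphere 0 s) g"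
  shows "circ_mean (\<lambda>z. circ_mean (\<lambda>\<zeta>. poisson_kernel \<zeta> (\<phi> z) * g \<zeta>) s) r
    = circ_mean (\<lambda>\<zeta>. poisson_kernel \<zeta> (\<phi> 0) * g \<zeta>) s"
proof -
  have "norm (\<phi> 0) < s" using s[of 0] r by simp
  then have s0: "0 < s" using norm_ge_zero[of "\<phi> 0"] by linarith
  have \<phi>c: "continuous_on (cball 0 r) \<phi>"
    using r by (intro continuous_on_subset[OF holomorphic_on_imp_continuous_on[OF \<phi>]]) auto
  have nz: "\<zeta> \<noteq> \<phi> z" if "norm \<zeta> = s" "norm z \<le> r" for \<zeta> z using s[of z] that by auto
  have "circ_mean (\<lambda>z. circ_mean (\<lambda>\<zeta>. poisson_kernel \<zeta> (\<phi> z) * g \<zeta>) s) r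
      = circ_mean (\<lambda>\<zeta>. circ_mean (\<lambda>z. poisson_kernel \<zeta> (\<phi> z) * g \<zeta>) r) s"
  proof (rule circ_mean_swap)
    have "continuous_on (sphere 0 r \<times> sphere 0 s) (\<lambda>p. poisson_kernel (snd p) (\<phi> (fst p)) * g (snd p))"
      by (intro continuous_intros continuous_on_compose2[OF \<phi>c] continuous_on_compose2[OF g]) (use nz in auto)
    then show "continuous_on (sphere 0 \<bar>r\<bar> \<times> sphere 0 \<bar>s\<bar>) (\<lambda>(z, \<zeta>). poisson_kernel \<zeta> (\<phi> z) * g \<zeta>)"
      using r s0 by (simp add: case_prod_unfold)
  qed
  also have "\<dots> = circ_mean (\<lambda>\<zeta>. poisson_kernel \<zeta> (\<phi> 0) * g \<zeta>) s"
  proof (rule circ_mean_cong)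
    fix \<zeta> :: complex assume \<zeta>: "norm \<zeta> = \<bar>s\<bar>"
    have "circ_mean (\<lambda>z. poisson_kernel \<zeta> (\<phi> z)) r = poisson_kernel \<zeta> (\<phi> 0)"
      using r s \<zeta> s0 by (intro circ_mean_poisson_kernel_compose \<phi>c holomorphic_on_subset[OF \<phi>]) auto
    then show "circ_mean (\<lambda>z. poisson_kernel \<zeta> (\<phi> z) * g \<zeta>) r = poisson_kernel \<zeta> (\<phi> 0) * g \<zeta>"
      using circ_mean_cmult_real[of "g \<zeta>" "\<lambda>z. poisson_kernel \<zeta> (\<phi> z)" r] by (simp add: mult.commute)
  qed
  finally show ?thesis .
qed

lemma continuous_on_poisson_integral:
  assumes \<phi>: "\<phi> holomorphic_on ball 0 1" and r: "0 < r" "r < 1"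
    and s: "\<And>z. norm z \<le> r \<Longrightarrow> norm (\<phi> z) < s" and g: "continuous_on (sphere 0 s) g"
  shows "continuous_on (sphere 0 r) (\<lambda>z. circ_mean (\<lambda>\<zeta>. poisson_kernel \<zeta> (\<phi> z) * g \<zeta>) s)"
proof -
  have "norm (\<phi> 0) < s" using s[of 0] r by simp
  then have s0: "0 < s" using norm_ge_zero[of "\<phi> 0"] by linarith
  have \<phi>c: "continuous_on (cball 0 r) \<phi>"
    using r by (intro continuous_on_subset[OF holomorphic_on_imp_continuous_on[OF \<phi>]]) auto
  have nz: "\<zeta> \<noteq> \<phi> z" if "norm \<zeta> = s" "norm z \<le> r" for \<zeta> z using s[of z] that by auto
  have "continuous_on (sphere 0 r \<times> cbox 0 (2*pi)) (\<lambda>p. poisson_kernel (of_real s * cis (snd p)) (\<phi> (fst p)) * g (of_real s * cis (snd p)))"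
    using s0 by (intro continuous_intros continuous_on_compose2[OF \<phi>c] continuous_on_compose2[OF g]) (use nz in \<open>auto simp: norm_mult\<close>)
  then have "continuous_on (sphere 0 r) (\<lambda>z. integral (cbox 0 (2*pi)) (\<lambda>t. poisson_kernel (of_real s * cis t) (\<phi> z) * g (of_real s * cis t)))"
    by (intro integral_continuous_on_param) (simp add: case_prod_unfold)
  then show ?thesis unfolding circ_mean_real by (intro continuous_intros) auto
qed

lemma circ_mean_poisson_le:
  assumes w: "norm w < s" and g: "continuous_on (sphere 0 s) g" "\<And>z. norm z = s \<Longrightarrow> 0 \<le> g z"
  shows "circ_mean (\<lambda>\<zeta>. poisson_kernel \<zeta> w * g \<zeta>) s \<le> (s + norm w) / (s - norm w) * circ_mean g s"
proof -
  have s0: "0 < s" using w norm_ge_zero[of w] by linarith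
  have "circ_mean (\<lambda>\<zeta>. poisson_kernel \<zeta> w * g \<zeta>) s \<le> circ_mean (\<lambda>\<zeta>. (s + norm w) / (s - norm w) * g \<zeta>) s"
  proof (rule circ_mean_mono)
    fix z :: complex assume z: "norm z = \<bar>s\<bar>"
    then show "poisson_kernel z w * g z \<le> (s + norm w) / (s - norm w) * g z"
      using poisson_kernel_le[of w z] w g(2)[of z] s0 by (intro mult_right_mono) auto
  next
    show "continuous_on (sphere 0 \<bar>s\<bar>) (\<lambda>\<zeta>. poisson_kernel \<zeta> w * g \<zeta>)"
      using s0 w g by (intro continuous_intros) auto
    show "continuous_on (sphere 0 \<bar>s\<bar>) (\<lambda>\<zeta>. (s + norm w) / (s - norm w) * g \<zeta>)"
      using s0 g by (intro continuous_on_mult_left) auto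
  qed
  then show ?thesis by (simp only: circ_mean_cmult_real)
qed

lemma self_map_disk_bound:
  assumes "\<phi> holomorphic_on ball 0 1" "\<phi> ` ball 0 1 \<subseteq> ball 0 1" "0 < r" "r < 1" "s1 < 1"
  obtains s where "s1 < s" "s < 1" "\<And>z. norm z \<le> r \<Longrightarrow> norm (\<phi> z) < s"
proof -
  have "continuous_on (cball 0 r) (\<lambda>z. norm (\<phi> z))"
    using assms by (intro continuous_intros continuous_on_subset[OF holomorphic_on_imp_continuous_on[OF assms(1)]]) auto
  then obtain z0 where z0: "z0 \<in> cball 0 r" "\<And>z. z \<in> cball 0 r \<Longrightarrow> norm (\<phi> z) \<le> norm (\<phi> z0)"
    using continuous_attains_sup[of "cball (0::complex) r" "\<lambda>z. norm (\<phi> z)"] assms by auto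
  have "norm (\<phi> z0) < 1" using z0 assms by (force simp: image_subset_iff)
  then obtain s where "max s1 (norm (\<phi> z0)) < s" "s < 1" using dense[of "max s1 (norm (\<phi> z0))" 1] assms by auto
  then show ?thesis using z0 by (intro that[of s]) force+
qed

text \<open>|h|^2 lies below its Poisson integral over a larger circle, whose composition with
  \<phi> has as mean its value at \<open>\<phi> 0\<close>; Harnack compares that value with the
  plain mean. The result carries smallness in mean square through a composition.\<close>

lemma littlewood_subordination:
  assumes h: "h holomorphic_on ball 0 1" and \<phi>: "\<phi> holomorphic_on ball 0 1" "\<phi> ` ball 0 1 \<subseteq> ball 0 1"
    and r: "0 < r" "r < 1" and s0: "s0 < 1"
    and bound: "\<And>s. s0 < s \<Longrightarrow> s < 1 \<Longrightarrow> circ_mean (\<lambda>z. (norm (h z))\<^sup>2) s \<le> \<epsilon>"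
  shows "circ_mean (\<lambda>z. (norm (h (\<phi> z)))\<^sup>2) r \<le> 2 * (1 + norm (\<phi> 0)) / (1 - norm (\<phi> 0)) * \<epsilon>"
proof -
  define a where "a = norm (\<phi> 0)"
  have a: "0 \<le> a" "a < 1" using \<phi>(2) by (auto simp: a_def image_subset_iff)
  \<comment> \<open>Taking \<open>s\<close> above (1 + a) / 2 gives s - a \<ge> (1 - a) / 2, which
    makes the final constant independent of \<open>r\<close>.\<close>
  obtain s where s: "max s0 ((1 + a) / 2) < s" "s < 1" "\<And>z. norm z \<le> r \<Longrightarrow> norm (\<phi> z) < s"
    using self_map_disk_bound[OF \<phi> r, of "max s0 ((1 + a) / 2)"] s0 a by auto
  have sa: "a < s" "0 < s" using s(1) a by auto
  have hc: "continuous_on (cball 0 s) h" "h holomorphic_on ball 0 s"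
    using s by (auto intro!: continuous_on_subset[OF holomorphic_on_imp_continuous_on[OF h]] holomorphic_on_subset[OF h])
  have gc: "continuous_on (sphere 0 s) (\<lambda>z. (norm (h z))\<^sup>2)"
    by (intro continuous_intros continuous_on_subset[OF hc(1)]) auto
  have hpc: "continuous_on (sphere 0 r) (\<lambda>z. (norm (h (\<phi> z)))\<^sup>2)"
    using r \<phi>(2) by (intro continuous_intros continuous_on_compose2[OF holomorphic_on_imp_continuous_on[OF h]]
       continuous_on_subset[OF holomorphic_on_imp_continuous_on[OF \<phi>(1)]]) auto
  have "circ_mean (\<lambda>z. (norm (h (\<phi> z)))\<^sup>2) r \<le> circ_mean (\<lambda>z. circ_mean (\<lambda>\<zeta>. poisson_kernel \<zeta> (\<phi> z) * (norm (h \<zeta>))\<^sup>2) s) r"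
  proof (rule circ_mean_mono)
    show "(norm (h (\<phi> z)))\<^sup>2 \<le> circ_mean (\<lambda>\<zeta>. poisson_kernel \<zeta> (\<phi> z) * (norm (h \<zeta>))\<^sup>2) s" if "norm z = \<bar>r\<bar>" for z
      using that s r by (intro norm_square_le_poisson hc) auto
  qed (use r hpc continuous_on_poisson_integral[OF \<phi>(1) r s(3) gc] in auto)
  also have "\<dots> = circ_mean (\<lambda>\<zeta>. poisson_kernel \<zeta> (\<phi> 0) * (norm (h \<zeta>))\<^sup>2) s"
    by (rule poisson_subordination[OF \<phi>(1) r s(3) gc])
  also have "\<dots> \<le> (s + a) / (s - a) * circ_mean (\<lambda>\<zeta>. (norm (h \<zeta>))\<^sup>2) s"
    unfolding a_def using sa gc by (intro circ_mean_poisson_le) (auto simp: a_def)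
  also have "\<dots> \<le> (2 * (1 + a) / (1 - a)) * circ_mean (\<lambda>\<zeta>. (norm (h \<zeta>))\<^sup>2) s"
  proof (rule mult_right_mono)
    have "(s + a) / (s - a) \<le> (1 + a) / ((1 - a) / 2)"
      using s(1,2) a by (intro frac_le) auto
    then show "(s + a) / (s - a) \<le> 2 * (1 + a) / (1 - a)" by (simp add: mult.commute)
    show "0 \<le> circ_mean (\<lambda>\<zeta>. (norm (h \<zeta>))\<^sup>2) s"
      using sa gc by (intro circ_mean_nonneg) auto
  qed
  also have "\<dots> \<le> (2 * (1 + a) / (1 - a)) * \<epsilon>"
    using s a by (intro mult_left_mono bound) auto
  finally show ?thesis by (simp add: a_def)
qed

lemma holomorphic_dilation_lipschitz:
  assumes h: "h holomorphic_on ball 0 1" and R: "0 < R" "R < 1"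
  obtains L where "0 \<le> L" "\<And>z w. norm z \<le> 1 \<Longrightarrow> norm w \<le> 1 \<Longrightarrow> norm (h (of_real R * z) - h (of_real R * w)) \<le> L * norm (z - w)"
proof -
  have "continuous_on (cball 0 R) (deriv h)"
    using R by (intro continuous_on_subset[OF holomorphic_on_imp_continuous_on[OF holomorphic_deriv[OF h]]]) auto
  then have "bounded (deriv h ` cball 0 R)" by (intro compact_imp_bounded compact_continuous_image) auto
  then obtain B where "\<forall>x\<in>deriv h ` cball 0 R. norm x \<le> B" unfolding bounded_iff by blast
  then have B: "norm (deriv h z) \<le> B" if "norm z \<le> R" for z using that by simp
  have B0: "0 \<le> B" using order_trans[OF norm_ge_zero B[of 0]] R by simp
  show ?thesis
  proof (rule that[OF B0])
    fix z w :: complex assume zw: "norm z \<le> 1" "norm w \<le> 1"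
    have "norm (h (of_real R * z) - h (of_real R * w)) \<le> B * norm (of_real R * z - of_real R * w)"
    proof (rule field_differentiable_bound[of "cball 0 R" h "deriv h"])
      fix x :: complex assume "x \<in> cball 0 R"
      then show "(h has_field_derivative deriv h x) (at x within cball 0 R)"
        using R h by (intro has_field_derivative_at_within[OF holomorphic_derivI[of _ "ball 0 1"]]) auto
    qed (use B zw R in \<open>auto simp: norm_mult mult_left_le\<close>)
    also have "norm (of_real R * z - of_real R * w) = R * norm (z - w)"
      using R by (simp flip: right_diff_distrib add: norm_mult)
    also have "B * (R * norm (z - w)) \<le> B * norm (z - w)"
      using R B0 by (intro mult_left_mono mult_left_le_one_le) auto
    finally show "norm (h (of_real R * z) - h (of_real R * w)) \<le> B * norm (z - w)" .
  qed
qed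

text \<open>In the variance the Lipschitz bound produces |z - w|^2, which cancels the denominator of
  the Poisson kernel exactly. The remaining error is a multiple of 1 - |w|^2, small in mean when
  \<open>w\<close> runs through values of an inner function.\<close>

lemma poisson_norm_square_le_lipschitz:
  assumes h: "continuous_on (cball 0 1) h" "h holomorphic_on ball 0 1" and w: "norm w < 1"
    and L: "\<And>z w. norm z \<le> 1 \<Longrightarrow> norm w \<le> 1 \<Longrightarrow> norm (h z - h w) \<le> L * norm (z - w)"
  shows "circ_mean (\<lambda>z. poisson_kernel z w * (norm (h z))\<^sup>2) 1 \<le> (norm (h w))\<^sup>2 + L\<^sup>2 * (1 - (norm w)\<^sup>2)"
proof -
  have "circ_mean (\<lambda>z. poisson_kernel z w * (norm (h z - h w))\<^sup>2) 1 \<le> circ_mean (\<lambda>z. L\<^sup>2 * (1 - (norm w)\<^sup>2)) 1"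
  proof (rule circ_mean_mono)
    fix z :: complex assume z: "norm z = \<bar>1\<bar>"
    have "poisson_kernel z w * (norm (h z - h w))\<^sup>2 \<le> poisson_kernel z w * (L * norm (z - w))\<^sup>2"
      using z w L by (intro mult_left_mono power_mono poisson_kernel_nonneg) auto
    also have "\<dots> = L\<^sup>2 * (1 - (norm w)\<^sup>2)"
      using z w unfolding poisson_kernel_def by (auto simp: power_mult_distrib)
    finally show "poisson_kernel z w * (norm (h z - h w))\<^sup>2 \<le> L\<^sup>2 * (1 - (norm w)\<^sup>2)" .
  next
    have "continuous_on (sphere 0 1) h" by (rule continuous_on_subset[OF h(1)]) auto
    then show "continuous_on (sphere 0 \<bar>1\<bar>) (\<lambda>z. poisson_kernel z w * (norm (h z - h w))\<^sup>2)"
      using w by (intro continuous_intros) auto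
  qed auto
  then show ?thesis using poisson_variance[OF h w] by simp
qed

lemma circ_mean_one_minus:
  fixes f :: "complex \<Rightarrow> real"
  assumes "continuous_on (sphere 0 \<bar>r\<bar>) f"
  shows "circ_mean (\<lambda>z. 1 - f z) r = 1 - circ_mean f r"
  using assms by (simp add: circ_mean_diff)

lemma mean_innerI:
  assumes hol: "u holomorphic_on ball 0 1" and le: "\<And>z. z \<in> ball 0 1 \<Longrightarrow> norm (u z) \<le> 1"
    and low: "\<And>e. 0 < e \<Longrightarrow> e \<le> 1 \<Longrightarrow> \<forall>\<^sub>F r in at_left 1. 1 - e < circ_mean (\<lambda>z. (norm (u z))\<^sup>2) r"
  shows "mean_inner u"
proof -
  have "((\<lambda>r. circ_mean (\<lambda>z. (norm (u z))\<^sup>2) r) \<longlongrightarrow> 1) (at_left 1)"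
  proof (rule order_tendstoI)
    fix a :: real assume "a < 1"
    then have "\<forall>\<^sub>F r in at_left 1. 1 - min 1 (1 - a) < circ_mean (\<lambda>z. (norm (u z))\<^sup>2) r"
      by (intro low) auto
    then show "\<forall>\<^sub>F r in at_left 1. a < circ_mean (\<lambda>z. (norm (u z))\<^sup>2) r"
      by eventually_elim auto
  next
    fix a :: real assume a: "1 < a"
    have "\<forall>\<^sub>F r in at_left 1. r \<in> {0<..<(1::real)}"
      by (rule eventually_at_leftI[of 0]) auto
    then show "\<forall>\<^sub>F r in at_left 1. circ_mean (\<lambda>z. (norm (u z))\<^sup>2) r < a"
    proof eventually_elim
      case (elim r)
      then show ?case using circ_mean_norm_square_le_1[OF hol le, of r] a by auto
    qed
  qed
  then show ?thesis using hol le by (simp add: mean_inner_def)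
qed

text \<open>A dilation \<open>h\<close> of \<psi> is Lipschitz on the closed disc. For it the mean
  of |h o \<phi>|^2 is bounded below by a Poisson integral at \<open>\<phi> 0\<close> minus a
  multiple of the mean of 1 - |\<phi>|^2, which tends to 0. The error \<psi> - h is carried through
  \<phi> by Littlewood subordination.\<close>

theorem mean_inner_compose:
  assumes \<psi>: "mean_inner \<psi>" and \<phi>: "mean_inner \<phi>" "\<phi> ` ball 0 1 \<subseteq> ball 0 1"
  shows "mean_inner (\<lambda>z. \<psi> (\<phi> z))"
proof -
  have hol\<psi>: "\<psi> holomorphic_on ball 0 1" and hol\<phi>: "\<phi> holomorphic_on ball 0 1"
    using \<psi> \<phi> by (auto simp: mean_inner_def)
  have hol: "(\<lambda>z. \<psi> (\<phi> z)) holomorphic_on ball 0 1"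
    using holomorphic_on_compose_gen[OF hol\<phi> hol\<psi> \<phi>(2)] by (simp add: o_def)
  have le: "norm (\<psi> (\<phi> z)) \<le> 1" if "z \<in> ball 0 1" for z
    using that \<psi> \<phi>(2) by (auto simp: mean_inner_def image_subset_iff)
  define K where "K = (1 + norm (\<phi> 0)) / (1 - norm (\<phi> 0))"
  have \<phi>0: "norm (\<phi> 0) < 1" using \<phi>(2) by (auto simp: image_subset_iff)
  have K: "0 < K" using \<phi>0 by (auto simp: K_def intro!: divide_pos_pos add_pos_nonneg)
  show ?thesis
  proof (rule mean_innerI[OF hol le])
    fix e :: real assume e: "0 < e" "e \<le> 1"
    \<comment> \<open>Chosen so that K \<epsilon> is below e / 4 and the subordination error 16 K
      \<epsilon> / e equals e / 4. A third quarter is spent on linearising that error. The last goes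
      to the Lipschitz term: its constant depends on the dilation, so it is made small afterwards by
      letting r tend to 1.\<close>
    define \<epsilon> where "\<epsilon> = e\<^sup>2 / (64 * K)"
    have \<epsilon>: "0 < \<epsilon>" using e K by (simp add: \<epsilon>_def)
    obtain R where R: "1/2 \<le> R" "R < 1"
      and R1: "\<And>r. R \<le> r \<Longrightarrow> r < 1 \<Longrightarrow> 1 - \<epsilon> < circ_mean (\<lambda>z. (norm (\<psi> z))\<^sup>2) r"
      and R2: "\<And>s. sqrt R < s \<Longrightarrow> s < 1 \<Longrightarrow> circ_mean (\<lambda>z. (norm (\<psi> z - \<psi> (of_real R * z)))\<^sup>2) s \<le> 2 * \<epsilon>"
      by (rule mean_inner_dilation[OF \<psi> \<epsilon>]) (rule that)
    define h where "h z = \<psi> (of_real R * z)" for z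
    obtain L where L: "0 \<le> L" "\<And>z w. norm z \<le> 1 \<Longrightarrow> norm w \<le> 1 \<Longrightarrow> norm (h z - h w) \<le> L * norm (z - w)"
      unfolding h_def by (rule holomorphic_dilation_lipschitz[OF hol\<psi>, of R]) (use R in auto)
    have Rz: "of_real R * z \<in> ball 0 1" if "norm z \<le> 1" for z :: complex
    proof -
      have "R * norm z \<le> R" using that R by (intro mult_left_le) auto
      then have "R * norm z < 1" using R by linarith
      then show ?thesis using R by (simp add: norm_mult)
    qed
    have hc: "continuous_on (cball 0 1) h"
      unfolding h_def using Rz by (intro continuous_on_compose2[OF holomorphic_on_imp_continuous_on[OF hol\<psi>]] continuous_intros) auto
    have hh: "h holomorphic_on ball 0 1"
    proof -
      have "(\<psi> \<circ> (\<lambda>z. of_real R * z)) holomorphic_on ball 0 1"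
        using Rz by (intro holomorphic_on_compose_gen[OF _ hol\<psi>] holomorphic_intros) force
      then show ?thesis by (simp add: h_def[abs_def] o_def)
    qed
    have h1: "norm (h z) \<le> 1" if "norm z \<le> 1" for z
      unfolding h_def using \<psi> Rz[OF that] by (auto simp: mean_inner_def)
    have gc: "continuous_on (sphere 0 1) (\<lambda>z. (norm (h z))\<^sup>2)"
      by (intro continuous_intros continuous_on_subset[OF hc]) auto
    have Ph: "1 - K * \<epsilon> \<le> circ_mean (\<lambda>\<zeta>. poisson_kernel \<zeta> (\<phi> 0) * (norm (h \<zeta>))\<^sup>2) 1"
    proof -
      have pc: "continuous_on (sphere 0 \<bar>1\<bar>) (\<lambda>\<zeta>. poisson_kernel \<zeta> (\<phi> 0))"
        using \<phi>0 by (intro continuous_intros) auto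
      have "circ_mean (\<lambda>\<zeta>. poisson_kernel \<zeta> (\<phi> 0) * (1 - (norm (h \<zeta>))\<^sup>2)) 1 \<le> K * circ_mean (\<lambda>\<zeta>. 1 - (norm (h \<zeta>))\<^sup>2) 1"
        unfolding K_def using \<phi>0 h1 by (intro circ_mean_poisson_le continuous_on_diff continuous_on_const gc) (auto simp: power_le_one)
      also have "circ_mean (\<lambda>\<zeta>. 1 - (norm (h \<zeta>))\<^sup>2) 1 = 1 - circ_mean (\<lambda>\<zeta>. (norm (h \<zeta>))\<^sup>2) 1"
        using gc by (intro circ_mean_one_minus) auto
      also have "circ_mean (\<lambda>\<zeta>. (norm (h \<zeta>))\<^sup>2) 1 = circ_mean (\<lambda>\<zeta>. (norm (\<psi> \<zeta>))\<^sup>2) R"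
        by (simp add: circ_mean_def h_def)
      also have "K * (1 - circ_mean (\<lambda>\<zeta>. (norm (\<psi> \<zeta>))\<^sup>2) R) \<le> K * \<epsilon>"
        using R1[of R] R K by (intro mult_left_mono) auto
      finally have "circ_mean (\<lambda>\<zeta>. poisson_kernel \<zeta> (\<phi> 0) * (1 - (norm (h \<zeta>))\<^sup>2)) 1 \<le> K * \<epsilon>" .
      moreover have "circ_mean (\<lambda>\<zeta>. poisson_kernel \<zeta> (\<phi> 0) * (1 - (norm (h \<zeta>))\<^sup>2)) 1
         = circ_mean (\<lambda>\<zeta>. poisson_kernel \<zeta> (\<phi> 0)) 1 - circ_mean (\<lambda>\<zeta>. poisson_kernel \<zeta> (\<phi> 0) * (norm (h \<zeta>))\<^sup>2) 1"
        using pc gc by (subst circ_mean_diff[symmetric]) (auto simp: right_diff_distrib intro!: continuous_on_mult)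
      ultimately show ?thesis using circ_mean_poisson_kernel[OF \<phi>0] by simp
    qed
    have main: "1 - K * \<epsilon> - L\<^sup>2 * (1 - circ_mean (\<lambda>z. (norm (\<phi> z))\<^sup>2) r) - e / 4 - 4 / e * (2 * K * (2 * \<epsilon>))
        \<le> circ_mean (\<lambda>z. (norm (\<psi> (\<phi> z)))\<^sup>2) r" if r: "0 < r" "r < 1" for r
    proof -
      have \<phi>r: "norm (\<phi> z) < 1" if "norm z \<le> r" for z using that r \<phi>(2) by (auto simp: image_subset_iff)
      have \<phi>c: "continuous_on (sphere 0 \<bar>r\<bar>) \<phi>" using r by (intro continuous_on_circle_holomorphic hol\<phi>) auto
      have \<psi>c: "continuous_on (sphere 0 \<bar>r\<bar>) (\<lambda>z. \<psi> (\<phi> z))" using r by (intro continuous_on_circle_holomorphic[OF hol]) auto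
      have h\<phi>c: "continuous_on (sphere 0 \<bar>r\<bar>) (\<lambda>z. h (\<phi> z))"
        using r \<phi>r by (intro continuous_on_compose2[OF hc \<phi>c]) (auto simp: less_imp_le)
      define d where "d z = \<psi> z - h z" for z
      have hd: "d holomorphic_on ball 0 1" unfolding d_def by (intro holomorphic_intros hol\<psi> hh)
      have dc: "continuous_on (sphere 0 \<bar>r\<bar>) (\<lambda>z. d (\<phi> z))" unfolding d_def by (intro continuous_intros \<psi>c h\<phi>c)
      have A: "1 - K * \<epsilon> \<le> circ_mean (\<lambda>z. (norm (h (\<phi> z)))\<^sup>2) r + L\<^sup>2 * (1 - circ_mean (\<lambda>z. (norm (\<phi> z))\<^sup>2) r)"
      proof -
        have "1 - K * \<epsilon> \<le> circ_mean (\<lambda>z. circ_mean (\<lambda>\<zeta>. poisson_kernel \<zeta> (\<phi> z) * (norm (h \<zeta>))\<^sup>2) 1) r"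
          using Ph poisson_subordination[OF hol\<phi> r \<phi>r gc] by simp
        also have "\<dots> \<le> circ_mean (\<lambda>z. (norm (h (\<phi> z)))\<^sup>2 + L\<^sup>2 * (1 - (norm (\<phi> z))\<^sup>2)) r"
        proof (rule circ_mean_mono)
          show "circ_mean (\<lambda>\<zeta>. poisson_kernel \<zeta> (\<phi> z) * (norm (h \<zeta>))\<^sup>2) 1 \<le> (norm (h (\<phi> z)))\<^sup>2 + L\<^sup>2 * (1 - (norm (\<phi> z))\<^sup>2)"
            if "norm z = \<bar>r\<bar>" for z
            using that r L by (intro poisson_norm_square_le_lipschitz hc hh \<phi>r) auto
          show "continuous_on (sphere 0 \<bar>r\<bar>) (\<lambda>z. circ_mean (\<lambda>\<zeta>. poisson_kernel \<zeta> (\<phi> z) * (norm (h \<zeta>))\<^sup>2) 1)"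
            using continuous_on_poisson_integral[OF hol\<phi> r \<phi>r gc] r by simp
        qed (intro continuous_intros h\<phi>c \<phi>c)
        also have "\<dots> = circ_mean (\<lambda>z. (norm (h (\<phi> z)))\<^sup>2) r + L\<^sup>2 * (1 - circ_mean (\<lambda>z. (norm (\<phi> z))\<^sup>2) r)"
          by (subst circ_mean_add, (intro continuous_intros h\<phi>c \<phi>c)+)
             (simp only: circ_mean_cmult_real circ_mean_one_minus[OF continuous_on_power[OF continuous_on_norm[OF \<phi>c]]])
        finally show ?thesis .
      qed
      have B: "circ_mean (\<lambda>z. (norm (d (\<phi> z)))\<^sup>2) r \<le> 2 * K * (2 * \<epsilon>)"
        using littlewood_subordination[OF hd hol\<phi> \<phi>(2) r, of "sqrt R" "2 * \<epsilon>"] R R2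
        by (simp add: d_def h_def K_def)
      have "circ_mean (\<lambda>z. (norm (h (\<phi> z)))\<^sup>2) r \<le> circ_mean (\<lambda>z. ((norm (\<psi> (\<phi> z)))\<^sup>2 + e / 4) + 4 / e * (norm (d (\<phi> z)))\<^sup>2) r"
      proof (rule circ_mean_mono)
        fix z :: complex assume z: "norm z = \<bar>r\<bar>"
        have n: "norm (h (\<phi> z)) \<le> 1" "norm (\<psi> (\<phi> z)) \<le> 1" using h1 \<phi>r[of z] le[of z] z r by auto
        define x where "x = norm (d (\<phi> z))"
        have x: "0 \<le> x" "norm (h (\<phi> z)) - norm (\<psi> (\<phi> z)) \<le> x"
          using norm_triangle_ineq2[of "h (\<phi> z)" "\<psi> (\<phi> z)"] by (auto simp: x_def d_def norm_minus_commute)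
        have "(norm (h (\<phi> z)))\<^sup>2 - (norm (\<psi> (\<phi> z)))\<^sup>2 = (norm (h (\<phi> z)) - norm (\<psi> (\<phi> z))) * (norm (h (\<phi> z)) + norm (\<psi> (\<phi> z)))"
          by (simp add: power2_eq_square algebra_simps)
        also have "\<dots> \<le> x * (norm (h (\<phi> z)) + norm (\<psi> (\<phi> z)))"
          using x by (intro mult_right_mono) auto
        also have "\<dots> \<le> x * 2" using n x by (intro mult_left_mono) auto
        \<comment> \<open>Only the mean of x^2 is under control, so the linear error is traded for a
          quadratic one by the arithmetic-geometric inequality.\<close>
        also have "x * 2 \<le> e / 4 + 4 / e * x\<^sup>2"
        proof -
          have "0 \<le> (e / 4 - x)\<^sup>2 * (4 / e)" using e by simp
          also have "(e / 4 - x)\<^sup>2 * (4 / e) = e / 4 - x * 2 + 4 / e * x\<^sup>2"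
            using e by (simp add: power2_eq_square field_simps)
          finally show ?thesis by simp
        qed
        finally show "(norm (h (\<phi> z)))\<^sup>2 \<le> (norm (\<psi> (\<phi> z)))\<^sup>2 + e / 4 + 4 / e * (norm (d (\<phi> z)))\<^sup>2"
          by (simp add: x_def)
      qed (intro continuous_intros h\<phi>c \<psi>c dc)+
      also have "\<dots> = circ_mean (\<lambda>z. (norm (\<psi> (\<phi> z)))\<^sup>2) r + e / 4 + 4 / e * circ_mean (\<lambda>z. (norm (d (\<phi> z)))\<^sup>2) r"
        by (subst circ_mean_add, (intro continuous_intros \<psi>c dc)+)+ (simp only: circ_mean_cmult_real circ_mean_const)
      also have "4 / e * circ_mean (\<lambda>z. (norm (d (\<phi> z)))\<^sup>2) r \<le> 4 / e * (2 * K * (2 * \<epsilon>))"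
        using B e by (intro mult_left_mono) auto
      finally show ?thesis using A by linarith
    qed
    have "((\<lambda>r. L\<^sup>2 * (1 - circ_mean (\<lambda>z. (norm (\<phi> z))\<^sup>2) r)) \<longlongrightarrow> L\<^sup>2 * (1 - 1)) (at_left 1)"
      using \<phi> by (intro tendsto_intros) (auto simp: mean_inner_def)
    then have "\<forall>\<^sub>F r in at_left 1. L\<^sup>2 * (1 - circ_mean (\<lambda>z. (norm (\<phi> z))\<^sup>2) r) < e / 4"
      using e by (intro order_tendstoD(2)) auto
    moreover have "\<forall>\<^sub>F r in at_left 1. r \<in> {0<..<(1::real)}"
      by (rule eventually_at_leftI[of 0]) auto
    ultimately show "\<forall>\<^sub>F r in at_left 1. 1 - e < circ_mean (\<lambda>z. (norm (\<psi> (\<phi> z)))\<^sup>2) r"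
    proof eventually_elim
      case (elim r)
      have "K * \<epsilon> = e\<^sup>2 / 64" using K by (simp add: \<epsilon>_def)
      moreover have "e\<^sup>2 \<le> e" using e by (simp add: power2_eq_square mult_left_le)
      ultimately have K1: "K * \<epsilon> < e / 4" using e by simp
      have "4 / e * (2 * K * (2 * \<epsilon>)) = 16 / e * (K * \<epsilon>)" by simp
      also have "\<dots> = e / 4" unfolding \<open>K * \<epsilon> = e\<^sup>2 / 64\<close> using e by (simp add: power2_eq_square)
      finally show ?case using main[of r] elim K1 by simp
    qed
  qed
qed

lemma mean_inner_id: "mean_inner (\<lambda>z. z)"
proof -
  have "circ_mean (\<lambda>z. (norm z)\<^sup>2) r = r\<^sup>2" for r
    using circ_mean_cong[of r "\<lambda>z. (norm z)\<^sup>2" "\<lambda>z. r\<^sup>2"] by simp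
  moreover have "((\<lambda>r::real. r\<^sup>2) \<longlongrightarrow> 1\<^sup>2) (at_left 1)" by (intro tendsto_intros)
  ultimately show ?thesis by (simp add: mean_inner_def)
qed

section \<open>Limits of inner functions and the exponential\<close>

text \<open>The Poisson mean of 1 - |Q|^2 at \<open>w\<close> is at most 1 - |Q w|^2 by
  subharmonicity, so being almost unimodular at one point controls whole circles. For these radii
  the kernel is at least (1 - |w|) / 4, and factoring 1 - |Q w|^2 costs another 2; hence the
  8.\<close>

lemma circ_mean_one_minus_norm_le:
  assumes Q: "Q holomorphic_on ball 0 1" "\<And>z. z \<in> ball 0 1 \<Longrightarrow> norm (Q z) \<le> 1"
    and w: "norm w < 1" and r: "(1 + norm w) / 2 < r" "r < 1"
  shows "circ_mean (\<lambda>z. 1 - (norm (Q z))\<^sup>2) r \<le> 8 / (1 - norm w) * (1 - norm (Q w))"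
proof -
  have rw: "norm w < r" using r w by simp
  then have r0: "0 < r" using norm_ge_zero[of w] by linarith
  have Qc: "continuous_on (sphere 0 \<bar>r\<bar>) Q" using r0 r by (intro continuous_on_circle_holomorphic Q) auto
  have Q': "continuous_on (cball 0 r) Q" "Q holomorphic_on ball 0 r"
    using r by (auto intro!: continuous_on_subset[OF holomorphic_on_imp_continuous_on[OF Q(1)]] holomorphic_on_subset[OF Q(1)])
  have pc: "continuous_on (sphere 0 \<bar>r\<bar>) (\<lambda>z. poisson_kernel z w)"
    using rw r0 by (intro continuous_intros) auto
  have "(1 - norm w) / 4 * circ_mean (\<lambda>z. 1 - (norm (Q z))\<^sup>2) r
      = circ_mean (\<lambda>z. (1 - norm w) / 4 * (1 - (norm (Q z))\<^sup>2)) r"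
    by (simp only: circ_mean_cmult_real)
  also have "\<dots> \<le> circ_mean (\<lambda>z. poisson_kernel z w - poisson_kernel z w * (norm (Q z))\<^sup>2) r"
  proof (rule circ_mean_mono)
    fix z :: complex assume z: "norm z = \<bar>r\<bar>"
    have "(1 - norm w) / 4 \<le> (r - norm w) / 2" using r by simp
    also have "\<dots> \<le> (r - norm w) / (r + norm w)" using r rw r0 w by (intro divide_left_mono) (auto intro: add_pos_nonneg)
    also have "\<dots> \<le> poisson_kernel z w" using poisson_kernel_ge[of w z] z rw r0 by simp
    finally have "(1 - norm w) / 4 * (1 - (norm (Q z))\<^sup>2) \<le> poisson_kernel z w * (1 - (norm (Q z))\<^sup>2)"
      using Q(2)[of z] z r r0 by (intro mult_right_mono) (auto simp: power_le_one)
    then show "(1 - norm w) / 4 * (1 - (norm (Q z))\<^sup>2) \<le> poisson_kernel z w - poisson_kernel z w * (norm (Q z))\<^sup>2"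
      by (simp add: right_diff_distrib)
  qed (intro continuous_intros Qc pc; simp)+
  also have "\<dots> = 1 - circ_mean (\<lambda>z. poisson_kernel z w * (norm (Q z))\<^sup>2) r"
    by (subst circ_mean_diff, (intro continuous_intros Qc pc)+) (simp add: circ_mean_poisson_kernel[OF rw])
  also have "\<dots> \<le> 1 - (norm (Q w))\<^sup>2"
    using norm_square_le_poisson[OF Q' rw] by simp
  also have "\<dots> = (1 - norm (Q w)) * (1 + norm (Q w))" by (simp add: power2_eq_square algebra_simps)
  also have "\<dots> \<le> (1 - norm (Q w)) * 2" using Q(2)[of w] w by (intro mult_left_mono) auto
  finally show ?thesis using w by (simp add: field_simps)
qed

lemma circ_mean_dominated_convergence:
  fixes F :: "nat \<Rightarrow> complex \<Rightarrow> real"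
  assumes "\<And>n. continuous_on (sphere 0 \<bar>r\<bar>) (F n)" "\<And>n z. norm z = \<bar>r\<bar> \<Longrightarrow> \<bar>F n z\<bar> \<le> 1"
    and "\<And>z. norm z = \<bar>r\<bar> \<Longrightarrow> (\<lambda>n. F n z) \<longlonglongrightarrow> f z"
  shows "(\<lambda>n. circ_mean (F n) r) \<longlonglongrightarrow> circ_mean f r"
proof -
  have "(\<lambda>n. integral {0..2*pi} (\<lambda>t. F n (of_real r * cis t))) \<longlonglongrightarrow> integral {0..2*pi} (\<lambda>t. f (of_real r * cis t))"
    by (rule dominated_convergence(2)[where h="\<lambda>_. 1"])
       (use assms in \<open>auto intro!: integrable_circle simp: norm_mult\<close>)
  then show ?thesis unfolding circ_mean_real by (intro tendsto_intros) auto
qed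

text \<open>Multiplying by the quotient \<open>F m / F n\<close> costs little in mean because it is
  bounded by \<open>1\<close> and almost unimodular at \<open>w\<close>.\<close>
lemma mean_inner_limit:
  assumes F: "\<And>n. mean_inner (F n)" and f: "f holomorphic_on ball 0 1"
    and lim: "\<And>z. z \<in> ball 0 1 \<Longrightarrow> (\<lambda>n. F n z) \<longlonglongrightarrow> f z"
    and fac: "\<And>m n. n \<le> m \<Longrightarrow> \<exists>Q. Q holomorphic_on ball 0 1 \<and> (\<forall>z\<in>ball 0 1. norm (Q z) \<le> 1 \<and> F m z = F n z * Q z)"
    and w: "norm w < 1" and fw: "f w \<noteq> 0"
  shows "mean_inner f"
proof (rule mean_innerI[OF f])
  have F1: "norm (F n z) \<le> 1" if "z \<in> ball 0 1" for n z using F[of n] that by (auto simp: mean_inner_def)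
  show "norm (f z) \<le> 1" if "z \<in> ball 0 1" for z
    by (rule tendsto_upperbound[OF tendsto_norm[OF lim[OF that]]]) (auto simp: F1[OF that])
  fix e :: real assume e: "0 < e"
  define C where "C = 8 / (1 - norm w)"
  have C: "0 < C" using w by (simp add: C_def)
  \<comment> \<open>Divisibility passes a zero of \<open>F n\<close> at \<open>w\<close> on to all
    later functions and hence to the limit.\<close>
  have Fw: "F n w \<noteq> 0" for n
  proof
    assume "F n w = 0"
    have "F m w = 0" if "n \<le> m" for m using fac[OF that] w \<open>F n w = 0\<close> by force
    then have "\<forall>\<^sub>F m in sequentially. F m w = 0" unfolding eventually_sequentially by blast
    then have "(\<lambda>m. F m w) \<longlonglongrightarrow> 0" by (rule tendsto_eventually)
    then show False using lim[of w] w fw LIMSEQ_unique by force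
  qed
  have main: "circ_mean (\<lambda>z. (norm (F n z))\<^sup>2) r - C * (1 - norm (f w) / norm (F n w)) \<le> circ_mean (\<lambda>z. (norm (f z))\<^sup>2) r"
    if r: "(1 + norm w) / 2 < r" "r < 1" for n r
  proof (rule LIMSEQ_le)
    have "0 < (1 + norm w) / 2" by (simp add: add_pos_nonneg)
    then have r0: "0 < r" using r(1) by (rule less_trans)
    have Fc: "continuous_on (sphere 0 \<bar>r\<bar>) (F n)" for n
      using F[of n] r r0 by (intro continuous_on_circle_holomorphic) (auto simp: mean_inner_def)
    show "(\<lambda>m. circ_mean (\<lambda>z. (norm (F m z))\<^sup>2) r) \<longlonglongrightarrow> circ_mean (\<lambda>z. (norm (f z))\<^sup>2) r"
      using r r0 F1 by (intro circ_mean_dominated_convergence continuous_intros Fc tendsto_intros lim) (auto simp: power_le_one)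
    show "(\<lambda>m. circ_mean (\<lambda>z. (norm (F n z))\<^sup>2) r - C * (1 - norm (F m w) / norm (F n w))) \<longlonglongrightarrow>
        circ_mean (\<lambda>z. (norm (F n z))\<^sup>2) r - C * (1 - norm (f w) / norm (F n w))"
      using w Fw by (intro tendsto_intros lim) auto
    have "circ_mean (\<lambda>z. (norm (F n z))\<^sup>2) r - C * (1 - norm (F m w) / norm (F n w)) \<le> circ_mean (\<lambda>z. (norm (F m z))\<^sup>2) r" if nm: "n \<le> m" for m
    proof -
      obtain Q where Q: "Q holomorphic_on ball 0 1" "\<And>z. z \<in> ball 0 1 \<Longrightarrow> norm (Q z) \<le> 1"
        "\<And>z. z \<in> ball 0 1 \<Longrightarrow> F m z = F n z * Q z" using fac[OF nm] by blast
      have Qc: "continuous_on (sphere 0 \<bar>r\<bar>) Q" using r r0 by (intro continuous_on_circle_holomorphic Q) auto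
      have "circ_mean (\<lambda>z. (norm (F n z))\<^sup>2) r \<le> circ_mean (\<lambda>z. (norm (F m z))\<^sup>2 + (1 - (norm (Q z))\<^sup>2)) r"
      proof (rule circ_mean_mono)
        fix z :: complex assume "norm z = \<bar>r\<bar>"
        then have z: "z \<in> ball 0 1" using r r0 by simp
        \<comment> \<open>Expanded, this says |F n|^2 \<le> |F n Q|^2 + 1 - |Q|^2, and F n Q is F
          m.\<close>
        have "0 \<le> (1 - (norm (F n z))\<^sup>2) * (1 - (norm (Q z))\<^sup>2)"
          using F1[OF z] Q(2)[OF z] by (intro mult_nonneg_nonneg) (auto simp: power_le_one)
        then show "(norm (F n z))\<^sup>2 \<le> (norm (F m z))\<^sup>2 + (1 - (norm (Q z))\<^sup>2)"
          using Q(3)[OF z] by (simp add: norm_mult power_mult_distrib algebra_simps)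
      qed (intro continuous_intros Fc Qc)+
      also have "\<dots> = circ_mean (\<lambda>z. (norm (F m z))\<^sup>2) r + circ_mean (\<lambda>z. 1 - (norm (Q z))\<^sup>2) r"
        by (intro circ_mean_add continuous_intros Fc Qc)
      also have "circ_mean (\<lambda>z. 1 - (norm (Q z))\<^sup>2) r \<le> C * (1 - norm (Q w))"
        unfolding C_def by (rule circ_mean_one_minus_norm_le[OF Q(1,2) w r])
      also have "norm (Q w) = norm (F m w) / norm (F n w)"
        using Q(3)[of w] w Fw[of n] by (simp add: norm_mult)
      finally show ?thesis by simp
    qed
    then show "\<exists>N. \<forall>m\<ge>N. circ_mean (\<lambda>z. (norm (F n z))\<^sup>2) r - C * (1 - norm (F m w) / norm (F n w)) \<le> circ_mean (\<lambda>z. (norm (F m z))\<^sup>2) r"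
      by blast
  qed
  have "(\<lambda>n. C * (1 - norm (f w) / norm (F n w))) \<longlonglongrightarrow> C * (1 - norm (f w) / norm (f w))"
    using w fw by (intro tendsto_intros lim) auto
  then have "\<forall>\<^sub>F n in sequentially. C * (1 - norm (f w) / norm (F n w)) < e / 2"
    using fw e by (intro order_tendstoD(2)) auto
  then obtain n where n: "C * (1 - norm (f w) / norm (F n w)) < e / 2"
    using eventually_happens'[OF sequentially_bot] by blast
  have "\<forall>\<^sub>F r in at_left 1. 1 - e / 2 < circ_mean (\<lambda>z. (norm (F n z))\<^sup>2) r"
    using F[of n] e by (intro order_tendstoD(1)[of _ 1]) (auto simp: mean_inner_def)
  moreover have "\<forall>\<^sub>F r in at_left 1. r \<in> {(1 + norm w) / 2<..<1}"
    using w by (intro eventually_at_leftI[of "(1 + norm w) / 2"]) auto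
  ultimately show "\<forall>\<^sub>F r in at_left 1. 1 - e < circ_mean (\<lambda>z. (norm (f z))\<^sup>2) r"
  proof eventually_elim
    case (elim r)
    then show ?case using main[of r n] n by auto
  qed
qed

text \<open>Where \<open>g\<close> is large nothing is gained from \<open>1 - |f|\<^sup>2 = 4 Im g / |g + i|\<^sup>2\<close>, but
  the harmonic function \<open>ln |g + i|\<close> is nonnegative, so that set is small in mean.\<close>
lemma mean_inner_exp:
  assumes g: "g holomorphic_on ball 0 1" "\<And>z. z \<in> ball 0 1 \<Longrightarrow> 0 < Im (g z)" and c: "0 < c"
    and f: "mean_inner (\<lambda>z. (g z - \<i>) / (g z + \<i>))"
  shows "mean_inner (\<lambda>z. exp (\<i> * of_real c * g z))"
proof (rule mean_innerI)
  let ?u = "\<lambda>z. exp (\<i> * of_real c * g z)"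
  let ?f = "\<lambda>z. (g z - \<i>) / (g z + \<i>)"
  show "?u holomorphic_on ball 0 1" by (intro holomorphic_intros g)
  then have hu: "?u holomorphic_on ball 0 1" .
  have nu: "norm (?u z) = exp (- c * Im (g z))" for z by simp
  show "norm (?u z) \<le> 1" if "z \<in> ball 0 1" for z using g(2)[OF that] c by simp
  have gi: "1 < norm (g z + \<i>)" if "z \<in> ball 0 1" for z
    using abs_Im_le_cmod[of "g z + \<i>"] g(2)[OF that] by simp
  have gn: "g z + \<i> \<notin> \<real>\<^sub>\<le>\<^sub>0" if "z \<in> ball 0 1" for z
    using g(2)[OF that] by (auto simp: complex_nonpos_Reals_iff)
  define l where "l z = ln (norm (g z + \<i>))" for z
  have l0: "0 \<le> l z" if "z \<in> ball 0 1" for z using gi[OF that] by (simp add: l_def)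
  have gc: "continuous_on (sphere 0 \<bar>r\<bar>) g" if "0 < r" "r < 1" for r
    using that by (intro continuous_on_circle_holomorphic g) auto
  have gin: "g z + \<i> \<noteq> 0" if "z \<in> ball 0 1" for z using gi[OF that] by auto
  have lc: "continuous_on (sphere 0 \<bar>r\<bar>) l" if "0 < r" "r < 1" for r
    unfolding l_def using that gin by (intro continuous_intros gc) auto
  have lmean: "circ_mean l r = l 0" if r: "0 < r" "r < 1" for r
  proof -
    have hl: "(\<lambda>z. Ln (g z + \<i>)) holomorphic_on ball 0 1" using gn by (intro holomorphic_intros g) auto
    have "circ_mean (\<lambda>z. Ln (g z + \<i>)) r = Ln (g 0 + \<i>)"
      using r by (intro circ_mean_holomorphic continuous_on_subset[OF holomorphic_on_imp_continuous_on[OF hl]] holomorphic_on_subset[OF hl]) auto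
    moreover have "circ_mean (\<lambda>z. Re (Ln (g z + \<i>))) r = Re (circ_mean (\<lambda>z. Ln (g z + \<i>)) r)"
      using r by (intro circ_mean_linear bounded_linear_Re continuous_on_circle_holomorphic hl) auto
    moreover have "circ_mean (\<lambda>z. Re (Ln (g z + \<i>))) r = circ_mean l r"
      using r gin by (intro circ_mean_cong) (simp add: l_def)
    ultimately show ?thesis using gin[of 0] by (simp add: l_def)
  qed
  fix e :: real assume e: "0 < e"
  \<comment> \<open>With this cutoff the Chebyshev bound \<open>l 0 / ln K\<close> for the set where
    |g + i| > K is below e / 2; the added 1 makes \<open>ln K\<close> positive and the inequality
    strict.\<close>
  define K where "K = exp (2 * l 0 / e + 1)"
  have lnK: "ln K = 2 * l 0 / e + 1" by (simp add: K_def)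
  have lnK0: "0 < ln K" unfolding lnK using l0[of 0] e by (auto intro!: add_nonneg_pos)
  have K0: "0 < K" by (simp add: K_def)
  have lK: "l 0 / ln K < e / 2"
    using lnK0 e unfolding lnK by (simp add: field_simps)
  have pw: "1 - (norm (?u z))\<^sup>2 \<le> c * K\<^sup>2 / 2 * (1 - (norm (?f z))\<^sup>2) + 1 / ln K * l z" if z: "z \<in> ball 0 1" for z
  proof -
    have f1: "1 - (norm (?f z))\<^sup>2 = 4 * Im (g z) / (norm (g z + \<i>))\<^sup>2"
    proof -
      have "(norm (g z + \<i>))\<^sup>2 - (norm (g z - \<i>))\<^sup>2 = 4 * Im (g z)"
        unfolding cmod_power2 by (simp add: power2_eq_square algebra_simps)
      moreover have "1 - (norm (?f z))\<^sup>2 = ((norm (g z + \<i>))\<^sup>2 - (norm (g z - \<i>))\<^sup>2) / (norm (g z + \<i>))\<^sup>2"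
        using gin[OF z] unfolding norm_divide power_divide by (simp add: diff_divide_distrib)
      ultimately show ?thesis by simp
    qed
    then have f0: "0 \<le> 1 - (norm (?f z))\<^sup>2" using g(2)[OF z] by simp
    show ?thesis
    proof (cases "norm (g z + \<i>) \<le> K")
      case True
      have "(norm (?u z))\<^sup>2 = exp (- (2 * c * Im (g z)))"
        unfolding nu by (simp flip: exp_double)
      then have "1 - (norm (?u z))\<^sup>2 \<le> 2 * c * Im (g z)"
        using exp_ge_add_one_self[of "- (2 * c * Im (g z))"] by simp
      also have "\<dots> = c / 2 * (norm (g z + \<i>))\<^sup>2 * (1 - (norm (?f z))\<^sup>2)"
        unfolding f1 using gin[OF z] by simp
      also have "\<dots> \<le> c / 2 * K\<^sup>2 * (1 - (norm (?f z))\<^sup>2)"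
        using True c f0 by (intro mult_right_mono mult_left_mono power_mono) auto
      also have "\<dots> \<le> c * K\<^sup>2 / 2 * (1 - (norm (?f z))\<^sup>2) + 1 / ln K * l z"
        using lnK0 l0[OF z] by simp
      finally show ?thesis .
    next
      case False
      then have "ln K \<le> l z" unfolding l_def using K0 gi[OF z] by (subst ln_le_cancel_iff) auto
      then have "1 \<le> 1 / ln K * l z" using lnK0 by simp
      moreover have "0 \<le> c * K\<^sup>2 / 2 * (1 - (norm (?f z))\<^sup>2)" using c f0 by (intro mult_nonneg_nonneg) auto
      moreover have "1 - (norm (?u z))\<^sup>2 \<le> 1" by simp
      ultimately show ?thesis by linarith
    qed
  qed
  have "((\<lambda>r. c * K\<^sup>2 / 2 * (1 - circ_mean (\<lambda>z. (norm (?f z))\<^sup>2) r)) \<longlongrightarrow> c * K\<^sup>2 / 2 * (1 - 1)) (at_left 1)"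
    using f by (intro tendsto_intros) (auto simp: mean_inner_def)
  then have "\<forall>\<^sub>F r in at_left 1. c * K\<^sup>2 / 2 * (1 - circ_mean (\<lambda>z. (norm (?f z))\<^sup>2) r) < e / 2"
    using e by (intro order_tendstoD(2)) auto
  moreover have "\<forall>\<^sub>F r in at_left 1. r \<in> {0<..<(1::real)}"
    by (rule eventually_at_leftI[of 0]) auto
  ultimately show "\<forall>\<^sub>F r in at_left 1. 1 - e < circ_mean (\<lambda>z. (norm (?u z))\<^sup>2) r"
  proof eventually_elim
    case (elim r)
    then have r: "0 < r" "r < 1" by auto
    have uc: "continuous_on (sphere 0 \<bar>r\<bar>) (\<lambda>z. (norm (?u z))\<^sup>2)" by (intro continuous_intros gc r)
    have fc: "continuous_on (sphere 0 \<bar>r\<bar>) (\<lambda>z. (norm (?f z))\<^sup>2)" using gin r by (intro continuous_intros gc) auto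
    have "1 - circ_mean (\<lambda>z. (norm (?u z))\<^sup>2) r = circ_mean (\<lambda>z. 1 - (norm (?u z))\<^sup>2) r"
      by (rule circ_mean_one_minus[OF uc, symmetric])
    also have "\<dots> \<le> circ_mean (\<lambda>z. c * K\<^sup>2 / 2 * (1 - (norm (?f z))\<^sup>2) + 1 / ln K * l z) r"
      using r by (intro circ_mean_mono continuous_on_add continuous_on_diff continuous_on_mult continuous_on_const uc fc lc pw) auto
    also have "\<dots> = circ_mean (\<lambda>z. c * K\<^sup>2 / 2 * (1 - (norm (?f z))\<^sup>2)) r + circ_mean (\<lambda>z. 1 / ln K * l z) r"
      using r by (intro circ_mean_add continuous_on_diff continuous_on_mult continuous_on_const fc lc) auto
    also have "\<dots> = c * K\<^sup>2 / 2 * (1 - circ_mean (\<lambda>z. (norm (?f z))\<^sup>2) r) + 1 / ln K * l 0"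
      by (simp only: circ_mean_cmult_real circ_mean_one_minus[OF fc] lmean[OF r])
    finally have "1 - circ_mean (\<lambda>z. (norm (?u z))\<^sup>2) r
        \<le> c * K\<^sup>2 / 2 * (1 - circ_mean (\<lambda>z. (norm (?f z))\<^sup>2) r) + l 0 / ln K" by (simp only: mult_1 times_divide_eq_left)
    then show ?case using elim(1) lK by linarith
  qed
qed

section \<open>The half-plane model\<close>

definition cayley :: "complex \<Rightarrow> complex" where
  "cayley \<zeta> = (\<zeta> - \<i>) / (\<zeta> + \<i>)"

definition cayley_inv :: "complex \<Rightarrow> complex" where
  "cayley_inv z = \<i> * (1 + z) / (1 - z)"

lemma Im_cayley_inv: "Im (cayley_inv z) = (1 - (norm z)\<^sup>2) / (norm (1 - z))\<^sup>2"
\<comment> \<open>At z = 1 both sides are 0 by the convention for division by zero.\<close>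
proof (cases "z = 1")
  case False
  have "cayley_inv z = \<i> * (1 + z) * cnj (1 - z) / of_real ((norm (1 - z))\<^sup>2)"
    using False unfolding complex_norm_square cayley_inv_def by simp
  then have "Im (cayley_inv z) = Im (\<i> * (1 + z) * cnj (1 - z)) / (norm (1 - z))\<^sup>2"
    by (metis Im_divide_of_real)
  also have "Im (\<i> * (1 + z) * cnj (1 - z)) = 1 - (norm z)\<^sup>2"
    unfolding cmod_power2 by (simp add: algebra_simps power2_eq_square)
  finally show ?thesis .
qed (simp add: cayley_inv_def)

lemma Im_cayley_inv_pos: "norm z < 1 \<Longrightarrow> 0 < Im (cayley_inv z)"
  unfolding Im_cayley_inv by (intro divide_pos_pos) (auto simp: power_less_one_iff)

lemma plus_i_nonzero: "0 < Im \<zeta> \<Longrightarrow> \<zeta> + \<i> \<noteq> 0"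
  by (auto simp: complex_eq_iff)

lemma cayley_cayley_inv: "z \<noteq> 1 \<Longrightarrow> cayley (cayley_inv z) = z"
proof -
  assume z: "z \<noteq> 1"
  have "cayley_inv z - \<i> = 2 * \<i> * z / (1 - z)" "cayley_inv z + \<i> = 2 * \<i> / (1 - z)"
    using z by (auto simp: cayley_inv_def field_simps)
  then show ?thesis using z by (simp add: cayley_def)
qed

lemma cayley_inv_cayley: "0 < Im \<zeta> \<Longrightarrow> cayley_inv (cayley \<zeta>) = \<zeta>"
proof -
  assume "0 < Im \<zeta>"
  then have nz: "\<zeta> + \<i> \<noteq> 0" by (rule plus_i_nonzero)
  then have "1 + cayley \<zeta> = 2 * \<zeta> / (\<zeta> + \<i>)" "1 - cayley \<zeta> = 2 * \<i> / (\<zeta> + \<i>)"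
    by (auto simp: cayley_def field_simps)
  then show ?thesis using nz by (simp add: cayley_inv_def)
qed

lemma norm_diff_less_norm_diff_cnj:
  assumes "0 < Im \<zeta>" "0 < Im \<omega>"
  shows "norm (\<zeta> - \<omega>) < norm (\<zeta> - cnj \<omega>)"
proof (rule power2_less_imp_less)
  have "(norm (\<zeta> - cnj \<omega>))\<^sup>2 - (norm (\<zeta> - \<omega>))\<^sup>2 = 4 * (Im \<zeta> * Im \<omega>)"
    unfolding cmod_power2 by (simp add: power2_eq_square algebra_simps)
  then show "(norm (\<zeta> - \<omega>))\<^sup>2 < (norm (\<zeta> - cnj \<omega>))\<^sup>2"
    using mult_pos_pos[OF assms] by linarith
qed auto

lemma norm_cayley_less_1: "0 < Im \<zeta> \<Longrightarrow> norm (cayley \<zeta>) < 1"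
  using norm_diff_less_norm_diff_cnj[of \<zeta> \<i>] plus_i_nonzero[of \<zeta>]
  by (simp add: cayley_def norm_divide divide_less_eq)

lemma holomorphic_on_cayley [holomorphic_intros]:
  assumes "f holomorphic_on S" "\<And>z. z \<in> S \<Longrightarrow> 0 < Im (f z)"
  shows "(\<lambda>z. cayley (f z)) holomorphic_on S"
  unfolding cayley_def using assms plus_i_nonzero by (intro holomorphic_intros) auto

lemma holomorphic_on_cayley_inv [holomorphic_intros]:
  assumes "f holomorphic_on S" "\<And>z. z \<in> S \<Longrightarrow> norm (f z) < 1"
  shows "(\<lambda>z. cayley_inv (f z)) holomorphic_on S"
  unfolding cayley_inv_def using assms by (intro holomorphic_intros) force+

lemma tendsto_cayley_inv:
  assumes "(f \<longlongrightarrow> l) F" "norm l < 1"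
  shows "((\<lambda>x. cayley_inv (f x)) \<longlongrightarrow> cayley_inv l) F"
  unfolding cayley_inv_def using assms by (intro tendsto_intros) auto

text \<open>Normalising \<omega> to i and applying the Cayley map gives the pseudo-hyperbolic
  quotient of the half-plane; this turns moduli of normalised iterates into hyperbolic distances
  from the orbit.\<close>

lemma cayley_affine:
  assumes "0 < Im \<omega>"
  shows "cayley ((\<zeta> - of_real (Re \<omega>)) / of_real (Im \<omega>)) = (\<zeta> - \<omega>) / (\<zeta> - cnj \<omega>)"
proof -
  have y: "complex_of_real (Im \<omega>) \<noteq> 0" using assms by simp
  have "(\<zeta> - of_real (Re \<omega>)) / of_real (Im \<omega>) - \<i> = (\<zeta> - \<omega>) / of_real (Im \<omega>)"
    using y complex_eq[of \<omega>] by (simp add: field_simps)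
  moreover have "(\<zeta> - of_real (Re \<omega>)) / of_real (Im \<omega>) + \<i> = (\<zeta> - cnj \<omega>) / of_real (Im \<omega>)"
    using y by (simp add: field_simps complex_eq_iff)
  ultimately show ?thesis using y by (simp add: cayley_def)
qed

lemma one_minus_cnj_mult_nonzero: "norm a < 1 \<Longrightarrow> norm z < 1 \<Longrightarrow> 1 - cnj a * z \<noteq> 0"
proof
  assume "norm a < 1" "norm z < 1" "1 - cnj a * z = 0"
  then have "norm a * norm z = 1" by (metis complex_mod_cnj eq_iff_diff_eq_0 norm_mult norm_one)
  moreover have "norm a * norm z < 1 * 1" using \<open>norm a < 1\<close> \<open>norm z < 1\<close> by (intro mult_strict_mono') auto
  ultimately show False by simp
qed

text \<open>The two quotients differ by (1 - cnj a) / (1 - a), which has modulus 1; hence the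
  norms.\<close>

lemma cayley_inv_pseudo_hyp:
  assumes "norm z < 1" "norm a < 1"
  shows "norm ((cayley_inv z - cayley_inv a) / (cayley_inv z - cnj (cayley_inv a))) = norm ((z - a) / (1 - cnj a * z))"
proof -
  have nz: "1 - z \<noteq> 0" "1 - a \<noteq> 0" "1 - cnj a \<noteq> 0" using assms by auto
  have 1: "cayley_inv z - cayley_inv a = 2 * \<i> * (z - a) / ((1 - z) * (1 - a))"
    unfolding cayley_inv_def using nz by (simp add: field_simps)
  have 2: "cayley_inv z - cnj (cayley_inv a) = 2 * \<i> * (1 - cnj a * z) / ((1 - z) * (1 - cnj a))"
    unfolding cayley_inv_def using nz by (simp add: field_simps)
  have "norm (1 - cnj a) = norm (1 - a)" by (metis complex_cnj_diff complex_cnj_one complex_mod_cnj)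
  then show ?thesis unfolding 1 2 using nz by (simp add: norm_divide norm_mult)
qed

section \<open>Schwarz--Pick inequalities and radial limits\<close>

lemma one_minus_quotient_square:
  assumes "0 < Im \<zeta>" "0 < Im \<omega>"
  shows "1 - (norm ((\<zeta> - \<omega>) / (\<zeta> - cnj \<omega>)))\<^sup>2 = 4 * Im \<zeta> * Im \<omega> / (norm (\<zeta> - cnj \<omega>))\<^sup>2"
proof -
  have "(norm (\<zeta> - cnj \<omega>))\<^sup>2 - (norm (\<zeta> - \<omega>))\<^sup>2 = 4 * Im \<zeta> * Im \<omega>"
    unfolding cmod_power2 by (simp add: power2_eq_square algebra_simps)
  moreover have "norm (\<zeta> - cnj \<omega>) \<noteq> 0" using norm_diff_less_norm_diff_cnj[OF assms] norm_ge_zero[of "\<zeta> - \<omega>"] by linarith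
  ultimately show ?thesis unfolding norm_divide power_divide by (simp add: diff_divide_eq_iff)
qed

lemma Schwarz_factor:
  assumes "f holomorphic_on ball 0 1" "f 0 = 0" "\<And>z. norm z < 1 \<Longrightarrow> norm (f z) < 1"
  obtains h where "h holomorphic_on ball 0 1" "\<And>z. norm z < 1 \<Longrightarrow> f z = z * h z" "\<And>z. norm z < 1 \<Longrightarrow> norm (h z) \<le> 1"
proof -
  obtain h where h: "h holomorphic_on ball 0 1" "\<And>z. norm z < 1 \<Longrightarrow> f z = z * h z" "deriv f 0 = h 0"
    by (rule Schwarz3[OF assms(1,2)]) (rule that)
  have "norm (h z) \<le> 1" if "norm z < 1" for z
  proof (cases "z = 0")
    case True
    then show ?thesis using Schwarz_Lemma(2)[OF assms that] h(3) by simp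
  next
    case False
    have "norm z * norm (h z) \<le> norm z" using Schwarz_Lemma(1)[OF assms that] h(2)[OF that] by (simp add: norm_mult)
    then show ?thesis using False by (simp add: mult_le_cancel_left1)
  qed
  then show ?thesis using h that by blast
qed

text \<open>Precomposing with the disc automorphism taking 0 to \<open>a\<close>, and postcomposing
  with the quotient taking \<open>G a\<close> to 0, reduces this to the Schwarz lemma.\<close>

lemma Schwarz_Pick_half_plane:
  assumes G: "G holomorphic_on ball 0 1" "\<And>z. norm z < 1 \<Longrightarrow> 0 < Im (G z)" and z: "norm z < 1" and a: "norm a < 1"
  shows "norm ((G z - G a) / (G z - cnj (G a))) \<le> norm ((z - a) / (1 - cnj a * z))"
proof -
  define m where "m = Moebius_function 0 (-a)"
  define v where "v = Moebius_function 0 a z"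
  define h where "h x = (G (m x) - G a) / (G (m x) - cnj (G a))" for x
  have m1: "norm (m x) < 1" if "norm x < 1" for x
    unfolding m_def using a that by (intro Moebius_function_norm_lt_1) auto
  have v1: "norm v < 1" unfolding v_def using a z by (intro Moebius_function_norm_lt_1) auto
  have nz: "G x - cnj (G a) \<noteq> 0" if "norm x < 1" for x
    using norm_diff_less_norm_diff_cnj[OF G(2)[OF that] G(2)[OF a]] by auto
  have mhol: "m holomorphic_on ball 0 1" unfolding m_def using a by (intro Moebius_function_holomorphic) auto
  have "(G \<circ> m) holomorphic_on ball 0 1"
    using m1 by (intro holomorphic_on_compose_gen[OF mhol G(1)]) auto
  then have "h holomorphic_on ball 0 1"
    unfolding h_def using nz m1 by (intro holomorphic_intros) (auto simp: o_def)
  moreover have "h 0 = 0" by (simp add: h_def m_def Moebius_function_of_zero)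
  moreover have "norm (h x) < 1" if "norm x < 1" for x
  proof -
    have "norm (G (m x) - G a) < norm (G (m x) - cnj (G a))"
      using that a by (intro norm_diff_less_norm_diff_cnj G m1)
    then show ?thesis unfolding h_def norm_divide using nz[OF m1[OF that]] by (simp add: divide_less_eq)
  qed
  ultimately have "norm (h v) \<le> norm v" using v1 by (rule Schwarz_Lemma(1))
  moreover have "m v = z" unfolding m_def v_def using a z by (intro Moebius_function_compose) auto
  moreover have "v = (z - a) / (1 - cnj a * z)" unfolding v_def by (rule Moebius_function_simple)
  ultimately show ?thesis by (simp add: h_def)
qed

lemma angular_limit_radial:
  assumes "angular_limit g w l" "norm w = 1"
  shows "((\<lambda>r. g (of_real r * w)) \<longlongrightarrow> l) (at_left 1)"
proof -
  have ev: "\<forall>\<^sub>F r in at_left 1. r \<in> {0<..<(1::real)}"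
    by (rule eventually_at_leftI[of 0]) auto
  \<comment> \<open>On the radius |w - r w| = 1 - |r w|, so it lies in every Stolz angle with M > 1;
    the 2 is an arbitrary choice.\<close>
  have "filterlim (\<lambda>r. of_real r * w) (at w within stolz_angle w 2) (at_left 1)"
    unfolding filterlim_at
  proof
    show "\<forall>\<^sub>F r in at_left 1. of_real r * w \<in> stolz_angle w 2 \<and> of_real r * w \<noteq> w"
      using ev
    proof eventually_elim
      case (elim r)
      have "norm (w - of_real r * w) = norm (of_real (1 - r) * w)" by (simp add: algebra_simps)
      also have "\<dots> = 1 - r" using elim assms(2) by (simp only: norm_mult norm_of_real) simp
      finally have "norm (w - of_real r * w) = 1 - r" .
      then show ?case using elim assms(2) by (auto simp: stolz_angle_def norm_mult)
    qed
    have "((\<lambda>r. of_real r * w) \<longlongrightarrow> of_real 1 * w) (at_left 1)" by (intro tendsto_intros)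
    then show "((\<lambda>r. of_real r * w) \<longlongrightarrow> w) (at_left 1)" by simp
  qed
  moreover have "(g \<longlongrightarrow> l) (at w within stolz_angle w 2)" using assms(1) by (simp add: angular_limit_def)
  ultimately show ?thesis by (rule filterlim_compose[rotated])
qed

text \<open>The Moebius identity for 1 - |u|^2 bounds it by a constant times 1 - |v|^2. Only the
  modulus of \<open>u\<close> is prescribed because the normalised iterates are Moebius images of
  iterates up to a unimodular factor.\<close>

lemma mean_inner_Moebius:
  assumes v: "mean_inner v" "\<And>z. norm z < 1 \<Longrightarrow> norm (v z) < 1" and a: "norm a < 1"
    and u: "u holomorphic_on ball 0 1" "\<And>z. norm z < 1 \<Longrightarrow> norm (u z) = norm ((v z - a) / (1 - cnj a * v z))"
  shows "mean_inner u"
proof -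
  have vh: "v holomorphic_on ball 0 1" using v by (simp add: mean_inner_def)
  have u1: "1 - (norm (u z))\<^sup>2 = (1 - (norm a)\<^sup>2) * (1 - (norm (v z))\<^sup>2) / (norm (1 - cnj a * v z))\<^sup>2" if "norm z < 1" for z
  proof -
    have nz: "1 - cnj a * v z \<noteq> 0" using a v(2)[OF that] by (rule one_minus_cnj_mult_nonzero)
    have "(norm (1 - cnj a * v z))\<^sup>2 - (norm (v z - a))\<^sup>2 = (1 - (norm a)\<^sup>2) * (1 - (norm (v z))\<^sup>2)"
      unfolding cmod_power2 by (simp add: power2_eq_square algebra_simps)
    then show ?thesis unfolding u(2)[OF that] norm_divide power_divide using nz by (simp add: diff_divide_eq_iff)
  qed
  have n0: "0 < norm (1 - cnj a * v z)" if "norm z < 1" for z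
    using one_minus_cnj_mult_nonzero[OF a v(2)[OF that]] by simp
  have a2: "0 < 1 - (norm a)\<^sup>2" using a by (simp add: power_less_one_iff)
  show ?thesis
  proof (rule mean_innerI[OF u(1)])
    fix z :: complex assume "z \<in> ball 0 1"
    then have z: "norm z < 1" by simp
    have "0 \<le> 1 - (norm (u z))\<^sup>2"
      unfolding u1[OF z] using a2 v(2)[OF z] by (intro divide_nonneg_nonneg mult_nonneg_nonneg) (auto simp: power_le_one)
    then show "norm (u z) \<le> 1" by (simp add: power_le_one_iff abs_square_le_1)
  next
    fix e :: real assume e: "0 < e"
    define C where "C = (1 - (norm a)\<^sup>2) / (1 - norm a)\<^sup>2"
    have C: "0 < C" using a a2 by (simp add: C_def)
    have pw: "1 - (norm (u z))\<^sup>2 \<le> C * (1 - (norm (v z))\<^sup>2)" if z: "norm z < 1" for z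
    proof -
      have "norm (cnj a * v z) \<le> norm a * 1" unfolding norm_mult using v(2)[OF z] by (intro mult_mono) auto
      then have "1 - norm a \<le> norm (1 - cnj a * v z)" using norm_triangle_ineq2[of 1 "cnj a * v z"] by simp
      then have "(1 - norm a)\<^sup>2 \<le> (norm (1 - cnj a * v z))\<^sup>2" using a by (intro power_mono) auto
      then have "(1 - (norm a)\<^sup>2) * (1 - (norm (v z))\<^sup>2) / (norm (1 - cnj a * v z))\<^sup>2 \<le> (1 - (norm a)\<^sup>2) * (1 - (norm (v z))\<^sup>2) / (1 - norm a)\<^sup>2"
        using a a2 v(2)[OF z] n0[OF z] by (intro divide_left_mono mult_nonneg_nonneg mult_pos_pos) (auto simp: power_le_one)
      then show ?thesis unfolding u1[OF z] C_def by simp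
    qed
    have "((\<lambda>r. C * (1 - circ_mean (\<lambda>z. (norm (v z))\<^sup>2) r)) \<longlongrightarrow> C * (1 - 1)) (at_left 1)"
      using v by (intro tendsto_intros) (auto simp: mean_inner_def)
    then have "\<forall>\<^sub>F r in at_left 1. C * (1 - circ_mean (\<lambda>z. (norm (v z))\<^sup>2) r) < e"
      using e by (intro order_tendstoD(2)) auto
    moreover have "\<forall>\<^sub>F r in at_left 1. r \<in> {0<..<(1::real)}"
      by (rule eventually_at_leftI[of 0]) auto
    ultimately show "\<forall>\<^sub>F r in at_left 1. 1 - e < circ_mean (\<lambda>z. (norm (u z))\<^sup>2) r"
    proof eventually_elim
      case (elim r)
      then have r: "0 < r" "r < 1" by auto
      have uc: "continuous_on (sphere 0 \<bar>r\<bar>) (\<lambda>z. (norm (u z))\<^sup>2)"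
        using r by (intro continuous_intros continuous_on_circle_holomorphic u) auto
      have vc: "continuous_on (sphere 0 \<bar>r\<bar>) (\<lambda>z. (norm (v z))\<^sup>2)"
        using r by (intro continuous_intros continuous_on_circle_holomorphic vh) auto
      have "1 - circ_mean (\<lambda>z. (norm (u z))\<^sup>2) r = circ_mean (\<lambda>z. 1 - (norm (u z))\<^sup>2) r"
        by (rule circ_mean_one_minus[OF uc, symmetric])
      also have "\<dots> \<le> circ_mean (\<lambda>z. C * (1 - (norm (v z))\<^sup>2)) r"
        using r by (intro circ_mean_mono continuous_on_diff continuous_on_mult continuous_on_const uc vc pw) auto
      also have "\<dots> = C * (1 - circ_mean (\<lambda>z. (norm (v z))\<^sup>2) r)"
        by (simp only: circ_mean_cmult_real circ_mean_one_minus[OF vc])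
      finally show ?case using elim(1) by linarith
    qed
  qed
qed

section \<open>Dynamics near a parabolic Denjoy--Wolff point\<close>

locale parabolic_positive_step =
  fixes \<phi> :: "complex \<Rightarrow> complex" and w z0 :: complex and L :: real
  assumes self_map: "self_map_disk \<phi>" and w: "norm w = 1" and deriv_w: "angular_derivative \<phi> w 1"
    and z0: "norm z0 < 1" and L: "0 < L"
    and step: "(\<lambda>n. pseudo_hyp ((\<phi> ^^ n) z0) ((\<phi> ^^ Suc n) z0)) \<longlonglongrightarrow> L"
begin

lemma holomorphic: "\<phi> holomorphic_on ball 0 1"
  and norm_less_1: "norm z < 1 \<Longrightarrow> norm (\<phi> z) < 1"
  using self_map by (auto simp: self_map_disk_def image_subset_iff)

lemma norm_iterate_less_1: "norm z < 1 \<Longrightarrow> norm ((\<phi> ^^ n) z) < 1"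
  by (induction n) (auto intro: norm_less_1)

lemma holomorphic_iterate: "(\<phi> ^^ n) holomorphic_on ball 0 1"
proof (induction n)
  case 0
  then show ?case by (simp add: id_def)
next
  case (Suc n)
  show ?case unfolding funpow.simps
    by (rule holomorphic_on_compose_gen[OF Suc holomorphic]) (auto intro: norm_iterate_less_1)
qed

text \<open>\<open>cnj w\<close> rotates \<open>w\<close> to 1, the pole of
  \<open>cayley_inv\<close>; in this coordinate \<open>w\<close> is the point at infinity.\<close>

definition \<kappa> :: "complex \<Rightarrow> complex" where "\<kappa> z = cayley_inv (cnj w * z)"

lemma w_cnj: "w * cnj w = 1" "cnj w * w = 1"
  using complex_norm_square[of w] w by (auto simp: mult.commute)

lemma norm_cnj_w_mult [simp]: "norm (cnj w * z) = norm z" "norm (w * z) = norm z"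
  by (simp_all add: norm_mult w)

lemma Im_kappa_pos: "norm z < 1 \<Longrightarrow> 0 < Im (\<kappa> z)"
  unfolding \<kappa>_def by (rule Im_cayley_inv_pos) simp

lemma holomorphic_kappa:
  assumes "f holomorphic_on S" "\<And>z. z \<in> S \<Longrightarrow> norm (f z) < 1"
  shows "(\<lambda>z. \<kappa> (f z)) holomorphic_on S"
  unfolding \<kappa>_def using assms by (intro holomorphic_intros) simp_all

lemma kappa_cayley: "0 < Im \<zeta> \<Longrightarrow> \<kappa> (w * cayley \<zeta>) = \<zeta>"
  unfolding \<kappa>_def mult.assoc[symmetric] w_cnj by (simp add: cayley_inv_cayley)

lemma cayley_kappa: "norm z < 1 \<Longrightarrow> w * cayley (\<kappa> z) = z"
proof -
  assume "norm z < 1"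
  then have "cnj w * z \<noteq> 1" by (metis norm_cnj_w_mult(1) norm_one less_irrefl)
  then show ?thesis unfolding \<kappa>_def by (simp add: cayley_cayley_inv w_cnj flip: mult.assoc)
qed

lemma kappa_pseudo_hyp:
  assumes "norm z < 1" "norm a < 1"
  shows "norm ((\<kappa> z - \<kappa> a) / (\<kappa> z - cnj (\<kappa> a))) = norm ((z - a) / (1 - cnj a * z))"
proof -
  have "cnj (cnj w * a) * (cnj w * z) = (w * cnj w) * (cnj a * z)" by (simp add: mult_ac)
  then have "cnj (cnj w * a) * (cnj w * z) = cnj a * z" unfolding w_cnj by simp
  moreover have "norm (cnj w * z - cnj w * a) = norm (z - a)" by (metis norm_cnj_w_mult(1) right_diff_distrib)
  ultimately show ?thesis
    unfolding \<kappa>_def using cayley_inv_pseudo_hyp[of "cnj w * z" "cnj w * a"] assms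
    unfolding norm_divide norm_cnj_w_mult by (simp only:)
qed

section \<open>The angular derivative and Julia's lemma in the half-plane\<close>

lemma radial_quotient: "((\<lambda>r. (\<phi> (of_real r * w) - w) / (of_real r * w - w)) \<longlongrightarrow> 1) (at_left 1)"
  and radial_value: "((\<lambda>r. \<phi> (of_real r * w)) \<longlongrightarrow> w) (at_left 1)"
  using deriv_w unfolding angular_derivative_def
  by (auto intro: angular_limit_radial[OF _ w, of "\<lambda>z. (\<phi> z - w) / (z - w)"] angular_limit_radial[OF _ w, of \<phi>])

lemma eventually_radius: "\<forall>\<^sub>F r in at_left 1. r \<in> {0<..<(1::real)}"
  by (rule eventually_at_leftI[of 0]) auto

lemma kappa_radial: "r < 1 \<Longrightarrow> \<kappa> (of_real r * w) = \<i> * of_real ((1 + r) / (1 - r))"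
proof -
  have "cnj w * (of_real r * w) = of_real r" using w_cnj(2) by (metis mult.left_commute mult.right_neutral)
  then show ?thesis unfolding \<kappa>_def by (simp only:) (simp add: cayley_inv_def)
qed

text \<open>The point r w has coordinate i (1 + r) / (1 - r), so this says that the ratio of image
  coordinate to coordinate tends to 1 at infinity along the imaginary axis: angular derivative 1 as
  seen in the half-plane.\<close>

lemma kappa_image_radial:
  "((\<lambda>r. of_real ((1 - r) / (1 + r)) * \<kappa> (\<phi> (of_real r * w))) \<longlongrightarrow> \<i>) (at_left 1)"
proof -
  have "((\<lambda>r. \<i> * ((w + \<phi> (of_real r * w)) / (w * (1 + of_real r))) * inverse ((\<phi> (of_real r * w) - w) / (of_real r * w - w)))
    \<longlongrightarrow> \<i> * ((w + w) / (w * (1 + of_real 1))) * inverse 1) (at_left 1)"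
    using w by (intro tendsto_intros radial_quotient radial_value) auto
  also have "\<i> * ((w + w) / (w * (1 + of_real 1))) * inverse 1 = \<i>" using w by auto
  finally show ?thesis
  proof (rule Lim_transform_eventually)
    show "\<forall>\<^sub>F r in at_left 1. \<i> * ((w + \<phi> (of_real r * w)) / (w * (1 + of_real r))) * inverse ((\<phi> (of_real r * w) - w) / (of_real r * w - w))
       = of_real ((1 - r) / (1 + r)) * \<kappa> (\<phi> (of_real r * w))"
      using eventually_radius
    proof eventually_elim
      case (elim r)
      define p where "p = \<phi> (of_real r * w)"
      have p: "norm p < 1" unfolding p_def using elim w by (intro norm_less_1) (simp add: norm_mult)
      have nz: "w \<noteq> 0" "w - p \<noteq> 0" "p - w \<noteq> 0" using p w by auto
      have nr: "1 + complex_of_real r \<noteq> 0" "1 - complex_of_real r \<noteq> 0" using elim by (auto simp: complex_eq_iff)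
      have \<kappa>p: "\<kappa> p = \<i> * (w + p) / (w - p)"
      proof -
        have "\<kappa> p = \<i> * (w * (1 + cnj w * p)) / (w * (1 - cnj w * p))"
          using nz by (simp add: \<kappa>_def cayley_inv_def)
        moreover have "w * (1 + cnj w * p) = w + p" "w * (1 - cnj w * p) = w - p"
          using w_cnj(1) by (simp_all add: distrib_left right_diff_distrib flip: mult.assoc)
        ultimately show ?thesis by (simp only:)
      qed
      have "inverse ((p - w) / (of_real r * w - w)) = (- (w * (1 - of_real r))) / (- (w - p))"
        by (simp add: algebra_simps)
      then have q: "inverse ((p - w) / (of_real r * w - w)) = w * (1 - of_real r) / (w - p)"
        unfolding minus_divide_divide .
      show ?case
        unfolding p_def[symmetric] q \<kappa>p using nz nr by (simp add: mult_ac)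
    qed
  qed
qed

text \<open>Julia's lemma: let \<open>a = r w\<close> tend to \<open>w\<close> in the Schwarz--Pick inequality between \<open>z\<close> and \<open>a\<close>.\<close>
lemma Im_kappa_mono:
  assumes z: "norm z < 1"
  shows "Im (\<kappa> z) \<le> Im (\<kappa> (\<phi> z))"
proof -
  define G where "G z = \<kappa> (\<phi> z)" for z
  have G: "G holomorphic_on ball 0 1" "\<And>z. norm z < 1 \<Longrightarrow> 0 < Im (G z)"
    unfolding G_def by (auto intro!: holomorphic_kappa holomorphic Im_kappa_pos norm_less_1)
  define t where "t r = (1 - r) / (1 + r)" for r :: real
  have ineq: "\<forall>\<^sub>F r in at_left 1. Im (\<kappa> z) * (norm (of_real (t r) * G z - cnj (of_real (t r) * G (of_real r * w))))\<^sup>2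
      \<le> Im (G z) * Im (of_real (t r) * G (of_real r * w)) * (norm (of_real (t r) * \<kappa> z + \<i>))\<^sup>2"
    using eventually_radius
  proof eventually_elim
    case (elim r)
    define a where "a = of_real r * w"
    have a: "norm a < 1" using elim w by (simp add: a_def norm_mult)
    have t: "0 < t r" using elim by (simp add: t_def)
    have \<kappa>a: "\<kappa> a = \<i> * of_real (1 / t r)" using elim by (simp add: a_def kappa_radial t_def)
    have "norm ((G z - G a) / (G z - cnj (G a))) \<le> norm ((\<kappa> z - \<kappa> a) / (\<kappa> z - cnj (\<kappa> a)))"
      unfolding kappa_pseudo_hyp[OF z a] by (rule Schwarz_Pick_half_plane[OF G z a])
    then have "1 - (norm ((\<kappa> z - \<kappa> a) / (\<kappa> z - cnj (\<kappa> a))))\<^sup>2 \<le> 1 - (norm ((G z - G a) / (G z - cnj (G a))))\<^sup>2"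
      by (simp add: power_mono)
    then have 1: "4 * Im (\<kappa> z) * Im (\<kappa> a) / (norm (\<kappa> z - cnj (\<kappa> a)))\<^sup>2 \<le> 4 * Im (G z) * Im (G a) / (norm (G z - cnj (G a)))\<^sup>2"
      using z a by (simp add: one_minus_quotient_square Im_kappa_pos G)
    have pos: "0 < norm (\<kappa> z - cnj (\<kappa> a))" "0 < norm (G z - cnj (G a))"
      using norm_diff_less_norm_diff_cnj[OF Im_kappa_pos[OF z] Im_kappa_pos[OF a]]
        norm_diff_less_norm_diff_cnj[OF G(2)[OF z] G(2)[OF a]] by (auto intro: le_less_trans[OF norm_ge_zero])
    have 2: "Im (\<kappa> z) * Im (\<kappa> a) * (norm (G z - cnj (G a)))\<^sup>2 \<le> Im (G z) * Im (G a) * (norm (\<kappa> z - cnj (\<kappa> a)))\<^sup>2"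
      using 1 pos by (simp add: divide_le_eq pos_le_divide_eq mult_ac)
    have e1: "norm (of_real (t r) * G z - cnj (of_real (t r) * G a)) = t r * norm (G z - cnj (G a))"
    proof -
      have "of_real (t r) * G z - cnj (of_real (t r) * G a) = of_real (t r) * (G z - cnj (G a))"
        by (simp add: right_diff_distrib)
      then show ?thesis using t by (simp add: norm_mult)
    qed
    have e2: "norm (of_real (t r) * \<kappa> z + \<i>) = t r * norm (\<kappa> z - cnj (\<kappa> a))"
    proof -
      have "of_real (t r) * \<kappa> z + \<i> = of_real (t r) * (\<kappa> z - cnj (\<kappa> a))"
        unfolding \<kappa>a using t by (simp add: distrib_left)
      then show ?thesis using t by (simp add: norm_mult)
    qed
    \<comment> \<open>One factor t rescales the imaginary part at \<open>a\<close> and two rescale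
      the squared norm; after that every quantity has a finite limit as r tends to 1.\<close>
    have "(t r) ^ 3 * (Im (\<kappa> z) * Im (\<kappa> a) * (norm (G z - cnj (G a)))\<^sup>2) \<le> (t r) ^ 3 * (Im (G z) * Im (G a) * (norm (\<kappa> z - cnj (\<kappa> a)))\<^sup>2)"
      using 2 t by (intro mult_left_mono) auto
    moreover have "(t r) ^ 3 * (Im (\<kappa> z) * Im (\<kappa> a) * (norm (G z - cnj (G a)))\<^sup>2) = Im (\<kappa> z) * (t r * Im (\<kappa> a)) * (t r * norm (G z - cnj (G a)))\<^sup>2"
      by (simp add: power2_eq_square power3_eq_cube mult_ac)
    moreover have "t r * Im (\<kappa> a) = 1" unfolding \<kappa>a using t by simp
    moreover have "(t r) ^ 3 * (Im (G z) * Im (G a) * (norm (\<kappa> z - cnj (\<kappa> a)))\<^sup>2) = Im (G z) * (t r * Im (G a)) * (t r * norm (\<kappa> z - cnj (\<kappa> a)))\<^sup>2"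
      by (simp add: power2_eq_square power3_eq_cube mult_ac)
    ultimately show ?case
      unfolding a_def[symmetric] e1 e2 by simp
  qed
  have t0: "(t \<longlongrightarrow> 0) (at_left 1)"
  proof -
    have "(t \<longlongrightarrow> (1 - 1) / (1 + 1)) (at_left 1)" unfolding t_def by (intro tendsto_intros) auto
    then show ?thesis by simp
  qed
  have lim: "((\<lambda>r. of_real (t r) * G (of_real r * w)) \<longlongrightarrow> \<i>) (at_left 1)"
    unfolding t_def G_def by (rule kappa_image_radial)
  have "Im (\<kappa> z) * (norm (of_real 0 * G z - cnj \<i>))\<^sup>2 \<le> Im (G z) * Im \<i> * (norm (of_real 0 * \<kappa> z + \<i>))\<^sup>2"
    by (rule tendsto_le[OF _ _ _ ineq]; intro tendsto_intros t0 lim trivial_limit_at_left_real)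
  then show ?thesis by (simp add: G_def)
qed

section \<open>Normalised iterates and their transition maps\<close>

definition x :: "nat \<Rightarrow> real" where "x n = Re (\<kappa> ((\<phi> ^^ n) z0))"
definition y :: "nat \<Rightarrow> real" where "y n = Im (\<kappa> ((\<phi> ^^ n) z0))"
definition g :: "nat \<Rightarrow> complex \<Rightarrow> complex" where "g n z = (\<kappa> ((\<phi> ^^ n) z) - of_real (x n)) / of_real (y n)"
definition f :: "nat \<Rightarrow> complex \<Rightarrow> complex" where "f n z = cayley (g n z)"
text \<open>This is \<phi> read in the disc coordinate centred at the n-th orbit point in the source
  and at the next orbit point in the target, so it fixes 0.\<close>

definition \<tau> :: "nat \<Rightarrow> complex \<Rightarrow> complex" where
  "\<tau> n v = cayley ((\<kappa> (\<phi> (w * cayley (of_real (x n) + of_real (y n) * cayley_inv v))) - of_real (x (Suc n))) / of_real (y (Suc n)))"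

lemma y_pos: "0 < y n"
  unfolding y_def by (intro Im_kappa_pos norm_iterate_less_1 z0)

lemma y_mono: "y n \<le> y (Suc n)"
  unfolding y_def funpow.simps o_apply by (intro Im_kappa_mono norm_iterate_less_1 z0)

lemma Im_g_pos: "norm z < 1 \<Longrightarrow> 0 < Im (g n z)"
  unfolding g_def using y_pos by (simp add: Im_kappa_pos norm_iterate_less_1)

text \<open>An exact semiconjugacy except for the shifted index, which is harmless once both
  sequences share a limit. At \<open>z0\<close>, where \<open>g (Suc n)\<close> is i, it exhibits
  the two real coefficients as the imaginary and real parts of
  \<open>g n (\<phi> z0)\<close>.\<close>

lemma g_compose: "g n (\<phi> z) = of_real (y (Suc n) / y n) * g (Suc n) z + of_real ((x (Suc n) - x n) / y n)"
proof -
  have "(\<phi> ^^ n) (\<phi> z) = (\<phi> ^^ Suc n) z" by (simp add: funpow_swap1)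
  moreover have "of_real (y (Suc n) / y n) * g (Suc n) z = (\<kappa> ((\<phi> ^^ Suc n) z) - of_real (x (Suc n))) / of_real (y n)"
    unfolding g_def using y_pos[of "Suc n"] by simp
  ultimately show ?thesis
    unfolding g_def[of n] by (simp only: of_real_divide of_real_diff) (simp add: diff_divide_distrib)
qed

lemma g_z0: "g n z0 = \<i>"
proof -
  have "\<kappa> ((\<phi> ^^ n) z0) - of_real (x n) = \<i> * of_real (y n)"
    by (simp add: x_def y_def complex_eq_iff)
  then show ?thesis unfolding g_def using y_pos[of n] by simp
qed

lemma f_z0: "f n z0 = 0"
  by (simp add: f_def g_z0 cayley_def)

lemma norm_f_less_1: "norm z < 1 \<Longrightarrow> norm (f n z) < 1"
  unfolding f_def by (intro norm_cayley_less_1 Im_g_pos)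

lemma holomorphic_g: "g n holomorphic_on ball 0 1"
  unfolding g_def using y_pos[of n]
  by (intro holomorphic_intros holomorphic_kappa holomorphic_iterate) (auto intro: norm_iterate_less_1)

lemma holomorphic_f: "f n holomorphic_on ball 0 1"
  unfolding f_def by (intro holomorphic_intros holomorphic_g Im_g_pos) simp

lemma cayley_inv_f: "norm z < 1 \<Longrightarrow> cayley_inv (f n z) = g n z"
  unfolding f_def by (intro cayley_inv_cayley Im_g_pos)

lemma norm_f: "norm z < 1 \<Longrightarrow> norm (f n z) = norm (((\<phi> ^^ n) z - (\<phi> ^^ n) z0) / (1 - cnj ((\<phi> ^^ n) z0) * (\<phi> ^^ n) z))"
  unfolding f_def g_def x_def y_def
  by (subst cayley_affine) (simp_all add: kappa_pseudo_hyp Im_kappa_pos norm_iterate_less_1 z0)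

text \<open>Through this identity the hyperbolic step becomes the modulus of the limit function at
  \<open>\<phi> z0\<close>.\<close>

lemma norm_f_step: "norm (f n (\<phi> z0)) = pseudo_hyp ((\<phi> ^^ n) z0) ((\<phi> ^^ Suc n) z0)"
proof -
  have "norm (1 - cnj b * a) = norm (1 - cnj a * b)" for a b
    by (metis complex_cnj_cnj complex_cnj_diff complex_cnj_mult complex_cnj_one complex_mod_cnj mult.commute)
  then show ?thesis
    by (simp add: norm_f norm_less_1 z0 pseudo_hyp_def norm_divide funpow_swap1)
qed

lemma Im_affine_pos: "norm v < 1 \<Longrightarrow> 0 < Im (of_real (x n) + of_real (y n) * cayley_inv v)"
  using y_pos[of n] Im_cayley_inv_pos[of v] by simp

lemma norm_tau_arg: "norm v < 1 \<Longrightarrow> norm (w * cayley (of_real (x n) + of_real (y n) * cayley_inv v)) < 1"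
  unfolding norm_cnj_w_mult by (intro norm_cayley_less_1 Im_affine_pos)

lemma Im_tau_arg: "norm v < 1 \<Longrightarrow>
    0 < Im ((\<kappa> (\<phi> (w * cayley (of_real (x n) + of_real (y n) * cayley_inv v))) - of_real (x (Suc n))) / of_real (y (Suc n)))"
  using y_pos[of "Suc n"] Im_kappa_pos[OF norm_less_1[OF norm_tau_arg[of v n]]] by simp

lemma norm_tau_less_1: "norm v < 1 \<Longrightarrow> norm (\<tau> n v) < 1"
  unfolding \<tau>_def by (intro norm_cayley_less_1 Im_tau_arg)

lemma holomorphic_tau: "\<tau> n holomorphic_on ball 0 1"
proof -
  have 1: "(\<lambda>v. w * cayley (of_real (x n) + of_real (y n) * cayley_inv v)) holomorphic_on ball 0 1"
    by (intro holomorphic_intros Im_affine_pos) auto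
  have "(\<lambda>v. \<phi> (w * cayley (of_real (x n) + of_real (y n) * cayley_inv v))) holomorphic_on ball 0 1"
    using holomorphic_on_compose_gen[OF 1 holomorphic] norm_tau_arg by (force simp: o_def)
  then have "(\<lambda>v. \<kappa> (\<phi> (w * cayley (of_real (x n) + of_real (y n) * cayley_inv v)))) holomorphic_on ball 0 1"
    by (rule holomorphic_kappa) (auto intro: norm_less_1 norm_tau_arg)
  then show ?thesis
    unfolding \<tau>_def using y_pos[of "Suc n"] Im_tau_arg by (intro holomorphic_intros) auto
qed

lemma tau_f: "norm z < 1 \<Longrightarrow> \<tau> n (f n z) = f (Suc n) z"
proof -
  assume z: "norm z < 1"
  have "of_real (x n) + of_real (y n) * cayley_inv (f n z) = \<kappa> ((\<phi> ^^ n) z)"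
    using y_pos[of n] by (simp add: cayley_inv_f z g_def)
  then show ?thesis
    unfolding \<tau>_def by (simp add: cayley_kappa norm_iterate_less_1 z f_def g_def)
qed

lemma tau_0: "\<tau> n 0 = 0"
  using tau_f[OF z0, of n] by (simp add: f_z0)

text \<open>Julia's lemma in normalised coordinates: heights are divided by \<open>y n\<close> in
  the source and by \<open>y (Suc n)\<close> in the target.\<close>

lemma Im_tau_ge: "norm v < 1 \<Longrightarrow> y n / y (Suc n) * Im (cayley_inv v) \<le> Im (cayley_inv (\<tau> n v))"
proof -
  assume v: "norm v < 1"
  let ?\<zeta> = "of_real (x n) + of_real (y n) * cayley_inv v"
  have "y n * Im (cayley_inv v) = Im (\<kappa> (w * cayley ?\<zeta>))"
    by (subst kappa_cayley[OF Im_affine_pos[OF v]]) simp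
  also have "\<dots> \<le> Im (\<kappa> (\<phi> (w * cayley ?\<zeta>)))" by (intro Im_kappa_mono norm_tau_arg v)
  also have "\<dots> = y (Suc n) * Im (cayley_inv (\<tau> n v))"
    unfolding \<tau>_def cayley_inv_cayley[OF Im_tau_arg[OF v]] using y_pos[of "Suc n"] by simp
  finally show ?thesis using y_pos[of "Suc n"] by (simp add: field_simps)
qed

end

lemma tendsto_uniform_limit_compose:
  fixes B :: "complex \<Rightarrow> complex"
  assumes ul: "uniform_limit K F B sequentially" and cont: "continuous_on K B"
    and v: "\<And>n. v n \<in> K" "l \<in> K" "v \<longlonglongrightarrow> l"
  shows "(\<lambda>n. F n (v n)) \<longlonglongrightarrow> B l"
proof -
  have "(\<lambda>n. B (v n)) \<longlonglongrightarrow> B l"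
    using continuous_on_tendsto_compose[OF cont v(3,2)] v(1) by (simp add: always_eventually)
  moreover have "(\<lambda>n. F n (v n) - B (v n)) \<longlonglongrightarrow> 0"
  proof (rule tendstoI)
    fix e :: real assume "0 < e"
    then have "\<forall>\<^sub>F n in sequentially. \<forall>x\<in>K. dist (F n x) (B x) < e" by (rule uniform_limitD[OF ul])
    then show "\<forall>\<^sub>F n in sequentially. dist (F n (v n) - B (v n)) 0 < e"
      by eventually_elim (use v in \<open>auto simp: dist_norm\<close>)
  qed
  ultimately show ?thesis using tendsto_add by fastforce
qed

lemma Montel_unit_bound:
  fixes X :: "nat \<Rightarrow> complex \<Rightarrow> complex"
  assumes "\<And>n. X n holomorphic_on ball 0 1" "\<And>n z. norm z < 1 \<Longrightarrow> norm (X n z) \<le> 1"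
  obtains F \<sigma> where "F holomorphic_on ball 0 1" "strict_mono (\<sigma> :: nat \<Rightarrow> nat)"
    "\<And>z. z \<in> ball 0 1 \<Longrightarrow> (\<lambda>k. X (\<sigma> k) z) \<longlonglongrightarrow> F z"
    "\<And>K. compact K \<Longrightarrow> K \<subseteq> ball 0 1 \<Longrightarrow> uniform_limit K (\<lambda>k. X (\<sigma> k)) F sequentially"
proof (rule Montel[of "ball 0 1" "range X" X])
  show "h holomorphic_on ball 0 1" if "h \<in> range X" for h using assms(1) that by auto
  show "\<exists>B. \<forall>h\<in>range X. \<forall>z\<in>K. norm (h z) \<le> B" if "K \<subseteq> ball 0 1" for K
    using assms(2) that by (intro exI[of _ 1]) (auto simp: subset_iff)
qed (auto simp: o_def intro: that)

context parabolic_positive_step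
begin

section \<open>Convergence of the normalised iterates\<close>

lemma f_quotients:
  obtains B where "\<And>n. B n holomorphic_on ball 0 1" "\<And>n v. norm v < 1 \<Longrightarrow> \<tau> n v = v * B n v"
    "\<And>n v. norm v < 1 \<Longrightarrow> norm (B n v) \<le> 1"
proof -
  have "\<forall>n. \<exists>B. B holomorphic_on ball 0 1 \<and> (\<forall>v. norm v < 1 \<longrightarrow> \<tau> n v = v * B v) \<and> (\<forall>v. norm v < 1 \<longrightarrow> norm (B v) \<le> 1)"
  proof
    fix n
    obtain h where "h holomorphic_on ball 0 1" "\<And>z. norm z < 1 \<Longrightarrow> \<tau> n z = z * h z" "\<And>z. norm z < 1 \<Longrightarrow> norm (h z) \<le> 1"
      by (rule Schwarz_factor[OF holomorphic_tau tau_0 norm_tau_less_1]) auto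
    then show "\<exists>B. B holomorphic_on ball 0 1 \<and> (\<forall>v. norm v < 1 \<longrightarrow> \<tau> n v = v * B v) \<and> (\<forall>v. norm v < 1 \<longrightarrow> norm (B v) \<le> 1)"
      by blast
  qed
  from choice[OF this] obtain B
    where "\<And>n. B n holomorphic_on ball 0 1" "\<And>n v. norm v < 1 \<Longrightarrow> \<tau> n v = v * B n v"
      "\<And>n v. norm v < 1 \<Longrightarrow> norm (B n v) \<le> 1" by auto
  then show ?thesis by (rule that)
qed

text \<open>Since f_(n+1) is \<tau>_n applied to f_n, and \<tau>_n v = v B_n v, each step multiplies
  by B_n o f_n, which is bounded by 1.\<close>

lemma f_factor:
  assumes "n \<le> m"
  shows "\<exists>Q. Q holomorphic_on ball 0 1 \<and> (\<forall>z\<in>ball 0 1. norm (Q z) \<le> 1 \<and> f m z = f n z * Q z)"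
  using assms
proof (induction m rule: dec_induct)
  case base
  show ?case by (rule exI[of _ "\<lambda>_. 1"]) auto
next
  case (step m)
  obtain Q where Q: "Q holomorphic_on ball 0 1" "\<forall>z\<in>ball 0 1. norm (Q z) \<le> 1 \<and> f m z = f n z * Q z"
    using step.IH by blast
  obtain B where B: "\<And>n. B n holomorphic_on ball 0 1" "\<And>n v. norm v < 1 \<Longrightarrow> \<tau> n v = v * B n v"
    "\<And>n v. norm v < 1 \<Longrightarrow> norm (B n v) \<le> 1"
    by (rule f_quotients) (rule that)
  have "(B m \<circ> f m) holomorphic_on ball 0 1"
    by (rule holomorphic_on_compose_gen[OF holomorphic_f B(1)]) (auto intro: norm_f_less_1)
  then have "(\<lambda>z. Q z * B m (f m z)) holomorphic_on ball 0 1"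
    using Q(1) by (intro holomorphic_intros) (simp_all add: o_def)
  moreover have "norm (Q z * B m (f m z)) \<le> 1 \<and> f (Suc m) z = f n z * (Q z * B m (f m z))" if "z \<in> ball 0 1" for z
  proof
    have z: "norm z < 1" using that by simp
    have "norm (Q z) \<le> 1" and e: "f m z = f n z * Q z" using Q(2) that by blast+
    then show "norm (Q z * B m (f m z)) \<le> 1"
      unfolding norm_mult using B(3)[OF norm_f_less_1[OF z, of m], of m] by (simp only: mult_le_one norm_ge_zero)
    have "f (Suc m) z = f m z * B m (f m z)"
      using tau_f[OF z, of m] B(2)[OF norm_f_less_1[OF z]] by simp
    then show "f (Suc m) z = f n z * (Q z * B m (f m z))" by (metis e mult.assoc)
  qed
  ultimately show ?case by blast
qed

lemma norm_f_antimono: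
  assumes "n \<le> m" "norm z < 1"
  shows "norm (f m z) \<le> norm (f n z)"
proof -
  obtain Q where Q: "\<forall>z\<in>ball 0 1. norm (Q z) \<le> 1 \<and> f m z = f n z * Q z" using f_factor[OF assms(1)] by blast
  have "norm (f m z) = norm (f n z) * norm (Q z)" using Q assms(2) by (simp add: norm_mult)
  also have "\<dots> \<le> norm (f n z)" using Q assms(2) by (intro mult_left_le) auto
  finally show ?thesis .
qed

lemma mean_inner_iterate:
  assumes "mean_inner \<phi>"
  shows "mean_inner (\<phi> ^^ n)"
proof (induction n)
  case 0
  then show ?case using mean_inner_id by (simp add: id_def)
next
  case (Suc n)
  have "mean_inner (\<lambda>z. \<phi> ((\<phi> ^^ n) z))"
    by (rule mean_inner_compose[OF assms Suc]) (auto intro: norm_iterate_less_1)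
  then show ?case by (simp add: o_def)
qed

lemma mean_inner_f:
  assumes "mean_inner \<phi>"
  shows "mean_inner (f n)"
  by (rule mean_inner_Moebius[OF mean_inner_iterate[OF assms] norm_iterate_less_1 _ holomorphic_f norm_f])
     (auto intro: norm_iterate_less_1 z0)

lemma step_limit: "(\<lambda>n. norm (f n (\<phi> z0))) \<longlonglongrightarrow> L"
  using step unfolding norm_f_step .

text \<open>The self-maps \<open>\<tau> n\<close> of the disc fix \<open>0\<close> and lose no modulus along the orbit in the limit, so they
  approach a rotation; by Julia's lemma this rotation fixes the boundary point \<open>1\<close>.\<close>
lemma subsequence_limit:
  obtains F \<sigma> where "F holomorphic_on ball 0 1" "strict_mono (\<sigma> :: nat \<Rightarrow> nat)"
    "\<And>z. norm z < 1 \<Longrightarrow> (\<lambda>k. f (\<sigma> k) z) \<longlonglongrightarrow> F z"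
    "\<And>z. norm z < 1 \<Longrightarrow> (\<lambda>k. f (Suc (\<sigma> k)) z) \<longlonglongrightarrow> F z"
proof -
  obtain B where B: "\<And>n. B n holomorphic_on ball 0 1" "\<And>n v. norm v < 1 \<Longrightarrow> \<tau> n v = v * B n v"
    "\<And>n v. norm v < 1 \<Longrightarrow> norm (B n v) \<le> 1"
    by (rule f_quotients) (rule that)
  \<comment> \<open>Two extractions: the normalised iterates, then along that subsequence the
    quotients. The latter must converge uniformly on compact sets because they are evaluated at the
    moving points f_n z.\<close>
  obtain F \<sigma>1 where F: "F holomorphic_on ball 0 1" and \<sigma>1: "strict_mono \<sigma>1"
    and F1: "\<And>z. z \<in> ball 0 1 \<Longrightarrow> (\<lambda>k. f (\<sigma>1 k) z) \<longlonglongrightarrow> F z"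
    by (rule Montel_unit_bound[of f, OF holomorphic_f less_imp_le[OF norm_f_less_1]]) (auto intro: that)
  obtain B0 \<sigma>2 where B0: "B0 holomorphic_on ball 0 1" and \<sigma>2: "strict_mono \<sigma>2"
    and B01: "\<And>z. z \<in> ball 0 1 \<Longrightarrow> (\<lambda>k. B (\<sigma>1 (\<sigma>2 k)) z) \<longlonglongrightarrow> B0 z"
    and B02: "\<And>K. compact K \<Longrightarrow> K \<subseteq> ball 0 1 \<Longrightarrow> uniform_limit K (\<lambda>k. B (\<sigma>1 (\<sigma>2 k))) B0 sequentially"
    by (rule Montel_unit_bound[of "\<lambda>k. B (\<sigma>1 k)", OF B(1,3)]) (auto intro: that)
  define \<sigma> where "\<sigma> = \<sigma>1 \<circ> \<sigma>2"
  have \<sigma>: "strict_mono \<sigma>" unfolding \<sigma>_def using \<sigma>1 \<sigma>2 by (rule strict_mono_o)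
  have Fl: "(\<lambda>k. f (\<sigma> k) z) \<longlonglongrightarrow> F z" if "norm z < 1" for z
    using LIMSEQ_subseq_LIMSEQ[OF F1 \<sigma>2, of z] that by (simp add: \<sigma>_def o_def)
  have Fn: "norm (F z) \<le> norm (f 0 z)" if "norm z < 1" for z
    by (rule tendsto_upperbound[OF tendsto_norm[OF Fl[OF that]]]) (simp_all add: norm_f_antimono that)
  have conv: "(\<lambda>k. B (\<sigma> k) (f (\<sigma> k) z)) \<longlonglongrightarrow> B0 (F z)" if z: "norm z < 1" for z
  proof (rule tendsto_uniform_limit_compose[where F="\<lambda>k. B (\<sigma> k)" and v="\<lambda>k. f (\<sigma> k) z"
        and l="F z" and B=B0 and K="cball 0 (norm (f 0 z))"])
    have sub: "cball 0 (norm (f 0 z)) \<subseteq> ball (0::complex) 1" using norm_f_less_1[OF z, of 0] by auto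
    show "uniform_limit (cball 0 (norm (f 0 z))) (\<lambda>k. B (\<sigma> k)) B0 sequentially"
      using B02[OF _ sub] by (simp add: \<sigma>_def)
    show "continuous_on (cball 0 (norm (f 0 z))) B0"
      using B0 sub by (meson continuous_on_subset holomorphic_on_imp_continuous_on)
  qed (use Fl[OF z] Fn[OF z] norm_f_antimono[of 0 _ z] z in auto)
  have Suc: "f (Suc n) z = f n z * B n (f n z)" if z: "norm z < 1" for n z
    using tau_f[OF z, of n] B(2)[OF norm_f_less_1[OF z]] by simp
  define z1 where "z1 = \<phi> z0"
  have z1: "norm z1 < 1" unfolding z1_def using z0 by (rule norm_less_1)
  have FL: "norm (F z1) = L"
    using LIMSEQ_unique[OF tendsto_norm[OF Fl[OF z1]]] LIMSEQ_subseq_LIMSEQ[OF step_limit \<sigma>]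
    by (simp add: z1_def o_def)
  \<comment> \<open>Going from n to n + 1 multiplies |f_n z1| by |B_n (f_n z1)|, and both moduli
    tend to L; since L > 0 it cancels. The maximum principle then makes \<open>B0\<close>
    constant.\<close>
  have "norm (B0 (F z1)) = 1"
  proof -
    have "(\<lambda>k. norm (f (\<sigma> k) z1) * norm (B (\<sigma> k) (f (\<sigma> k) z1))) \<longlonglongrightarrow> L * norm (B0 (F z1))"
      using tendsto_mult[OF tendsto_norm[OF Fl[OF z1]] tendsto_norm[OF conv[OF z1]]] by (simp add: FL)
    moreover have "(\<lambda>k. norm (f (\<sigma> k) z1) * norm (B (\<sigma> k) (f (\<sigma> k) z1))) \<longlonglongrightarrow> L"
      using LIMSEQ_subseq_LIMSEQ[OF LIMSEQ_Suc[OF step_limit] \<sigma>] Suc[OF z1]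
      by (simp add: o_def z1_def norm_mult)
    ultimately have "L * norm (B0 (F z1)) = L" by (rule LIMSEQ_unique)
    then show ?thesis using L by simp
  qed
  moreover have B0n: "norm (B0 v) \<le> 1" if "norm v < 1" for v
    by (rule tendsto_upperbound[OF tendsto_norm[OF B01]]) (use that B(3) in auto)
  moreover have Fz1: "norm (F z1) < 1" using Fn[OF z1] norm_f_less_1[OF z1, of 0] by linarith
  ultimately have "B0 constant_on ball 0 1"
    by (intro maximum_modulus_principle[OF B0, of "ball 0 1" "F z1"]) auto
  then obtain \<beta> where \<beta>: "\<And>v. norm v < 1 \<Longrightarrow> B0 v = \<beta>" unfolding constant_on_def by auto
  have "\<beta> = 1"
  proof -
    define \<alpha> where "\<alpha> = cayley_inv (F z1)"
    have "(\<lambda>k. cayley_inv (f (\<sigma> k) z1)) \<longlonglongrightarrow> \<alpha>"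
      unfolding \<alpha>_def by (intro tendsto_cayley_inv Fl z1 Fz1)
    then have "(\<lambda>k. Im (cayley_inv (f (\<sigma> k) z1))) \<longlonglongrightarrow> Im \<alpha>" by (rule tendsto_Im)
    moreover have "Im (cayley_inv (f n z1)) = y (Suc n) / y n" for n
      using z1 unfolding z1_def by (simp add: cayley_inv_f g_compose g_z0)
    ultimately have lam: "(\<lambda>k. y (Suc (\<sigma> k)) / y (\<sigma> k)) \<longlonglongrightarrow> Im \<alpha>" by simp
    have lam1: "1 \<le> Im \<alpha>"
      by (rule tendsto_lowerbound[OF lam]) (use y_mono y_pos in auto)
    \<comment> \<open>This is Julia's inequality in the limit. As |v \<beta>| = |v|, the numerators
      1 - |v|^2 cancel, and v = r tending to 1 leaves |1 - \<beta>|^2 \<le> 0.\<close>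
    have ineq: "(norm (1 - v * \<beta>))\<^sup>2 \<le> Im \<alpha> * (norm (1 - v))\<^sup>2" if v: "norm v < 1" for v
    proof -
      have \<beta>1: "norm (v * \<beta>) < 1"
      proof -
        have "norm \<beta> \<le> 1" using B0n[of 0] \<beta>[of 0] by simp
        then have "norm v * norm \<beta> \<le> norm v" by (intro mult_left_le) auto
        then show ?thesis using v by (simp add: norm_mult)
      qed
      have "(\<lambda>k. \<tau> (\<sigma> k) v) \<longlonglongrightarrow> v * \<beta>"
        using tendsto_mult[OF tendsto_const B01[of v]] v \<beta>[OF v] B(2)[OF v] by (simp add: \<sigma>_def)
      then have l1: "(\<lambda>k. Im (cayley_inv (\<tau> (\<sigma> k) v))) \<longlonglongrightarrow> Im (cayley_inv (v * \<beta>))"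
        using \<beta>1 by (intro tendsto_Im tendsto_cayley_inv)
      have "(\<lambda>k. (y (Suc (\<sigma> k)) / y (\<sigma> k)) * Im (cayley_inv (\<tau> (\<sigma> k) v))) \<longlonglongrightarrow> Im \<alpha> * Im (cayley_inv (v * \<beta>))"
        by (intro tendsto_mult lam l1)
      moreover have "Im (cayley_inv v) \<le> (y (Suc n) / y n) * Im (cayley_inv (\<tau> n v))" for n
        using Im_tau_ge[OF v, of n] y_pos[of n] y_pos[of "Suc n"] by (simp add: field_simps)
      ultimately have i: "Im (cayley_inv v) \<le> Im \<alpha> * Im (cayley_inv (v * \<beta>))"
        by (intro tendsto_lowerbound) auto
      have n: "0 < (norm (1 - v))\<^sup>2" "0 < (norm (1 - v * \<beta>))\<^sup>2" using v \<beta>1 by auto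
      have "Im (cayley_inv (v * \<beta>)) = (1 - (norm v)\<^sup>2) / (norm (1 - v * \<beta>))\<^sup>2"
      proof -
        have "norm \<beta> = 1" using \<open>norm (B0 (F z1)) = 1\<close> \<beta>[OF Fz1] by simp
        then show ?thesis by (simp add: Im_cayley_inv norm_mult)
      qed
      with i have "(1 - (norm v)\<^sup>2) * (norm (1 - v * \<beta>))\<^sup>2 \<le> (1 - (norm v)\<^sup>2) * (Im \<alpha> * (norm (1 - v))\<^sup>2)"
        using n unfolding Im_cayley_inv[of v] by (simp add: field_simps)
      moreover have "0 < 1 - (norm v)\<^sup>2" using v by (simp add: power_less_one_iff)
      ultimately show ?thesis by (simp add: mult_le_cancel_left_pos)
    qed
    have "(norm (1 - of_real 1 * \<beta>))\<^sup>2 \<le> Im \<alpha> * (norm (1 - complex_of_real 1))\<^sup>2"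
    proof (rule tendsto_le[where F="at_left (1::real)"])
      show "((\<lambda>r. (norm (1 - of_real r * \<beta>))\<^sup>2) \<longlongrightarrow> (norm (1 - of_real 1 * \<beta>))\<^sup>2) (at_left 1)"
        by (intro tendsto_intros)
      show "((\<lambda>r. Im \<alpha> * (norm (1 - complex_of_real r))\<^sup>2) \<longlongrightarrow> Im \<alpha> * (norm (1 - complex_of_real 1))\<^sup>2) (at_left 1)"
        by (intro tendsto_intros)
      show "\<forall>\<^sub>F r in at_left 1. (norm (1 - of_real r * \<beta>))\<^sup>2 \<le> Im \<alpha> * (norm (1 - complex_of_real r))\<^sup>2"
        using eventually_radius by eventually_elim (intro ineq, simp)
    qed simp
    then show ?thesis by simp
  qed
  have "(\<lambda>k. f (Suc (\<sigma> k)) z) \<longlonglongrightarrow> F z" if z: "norm z < 1" for z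
  proof -
    have "norm (F z) < 1" using Fn[OF z] norm_f_less_1[OF z, of 0] by linarith
    then have "B0 (F z) = 1" using \<beta> \<open>\<beta> = 1\<close> by simp
    then show ?thesis using tendsto_mult[OF Fl[OF z] conv[OF z]] Suc[OF z] by simp
  qed
  then show ?thesis using that F \<sigma> Fl by blast
qed

text \<open>Otherwise \<open>G\<close> would be, up to a translation, a semiconjugacy to \<open>\<zeta> \<mapsto> \<mu> \<zeta>\<close>, which moves all points by a
  hyperbolic distance bounded below, while \<open>\<phi>\<close> hardly moves \<open>r w\<close> for \<open>r\<close> close to \<open>1\<close>.\<close>
lemma multiplier_eq_1:
  assumes G: "G holomorphic_on ball 0 1" "\<And>z. norm z < 1 \<Longrightarrow> 0 < Im (G z)"
    and eq: "\<And>z. norm z < 1 \<Longrightarrow> G (\<phi> z) = of_real \<mu> * G z + of_real d" and \<mu>: "1 \<le> \<mu>"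
  shows "\<mu> = 1"
proof (rule ccontr)
  assume "\<mu> \<noteq> 1"
  then have \<mu>1: "1 < \<mu>" using \<mu> by simp
  \<comment> \<open>The translation moves the fixed point of \<zeta> \<mapsto> \<mu> \<zeta> + d to
    0.\<close>
  define H where "H z = G z + of_real (d / (\<mu> - 1))" for z
  have H: "H holomorphic_on ball 0 1" "\<And>z. norm z < 1 \<Longrightarrow> 0 < Im (H z)"
    unfolding H_def using G by (auto intro!: holomorphic_intros)
  have Heq: "H (\<phi> z) = of_real \<mu> * H z" if "norm z < 1" for z
  proof -
    have "d + d / (\<mu> - 1) = \<mu> * (d / (\<mu> - 1))" using \<mu>1 by (simp add: field_simps)
    then have "complex_of_real d + of_real (d / (\<mu> - 1)) = of_real \<mu> * of_real (d / (\<mu> - 1))"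
      by (metis of_real_add of_real_mult)
    then show ?thesis unfolding H_def eq[OF that] distrib_left by (simp only: add.assoc)
  qed
  \<comment> \<open>The numerator is exactly (\<mu> - 1) |H a| and the denominator at most (\<mu> +
    1) |H a|, so the bound does not depend on \<open>a\<close>; Schwarz--Pick carries it to the
    disc.\<close>
  have low: "(\<mu> - 1) / (\<mu> + 1) \<le> norm ((\<phi> a - a) / (1 - cnj a * \<phi> a))" if a: "norm a < 1" for a
  proof -
    have Ha: "0 < norm (H a)" using H(2)[OF a] by auto
    have "norm (of_real \<mu> * H a - H a) = (\<mu> - 1) * norm (H a)"
    proof -
      have "of_real \<mu> * H a - H a = of_real (\<mu> - 1) * H a" by (simp add: left_diff_distrib)
      then show ?thesis using \<mu>1 by (metis abs_of_pos diff_gt_0_iff_gt norm_mult norm_of_real)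
    qed
    moreover have "norm (of_real \<mu> * H a - cnj (H a)) \<le> (\<mu> + 1) * norm (H a)"
      using norm_triangle_ineq4[of "of_real \<mu> * H a" "cnj (H a)"] \<mu>1 by (simp add: norm_mult distrib_right)
    moreover have "0 < norm (of_real \<mu> * H a - cnj (H a))"
      using norm_diff_less_norm_diff_cnj[of "of_real \<mu> * H a" "H a"] H(2)[OF a] \<mu>1
      by (auto intro: le_less_trans[OF norm_ge_zero])
    ultimately have "((\<mu> - 1) * norm (H a)) / ((\<mu> + 1) * norm (H a)) \<le> norm ((H (\<phi> a) - H a) / (H (\<phi> a) - cnj (H a)))"
      unfolding Heq[OF a] norm_divide using \<mu>1 Ha by (intro frac_le) auto
    also have "\<dots> \<le> norm ((\<phi> a - a) / (1 - cnj a * \<phi> a))"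
      by (rule Schwarz_Pick_half_plane[OF H norm_less_1[OF a] a])
    finally show ?thesis using Ha by simp
  qed
  have "((\<lambda>r. norm ((\<phi> (of_real r * w) - w) / (of_real r * w - w) - 1)) \<longlongrightarrow> norm (1 - 1 :: complex)) (at_left 1)"
    by (intro tendsto_intros radial_quotient)
  moreover have "\<forall>\<^sub>F r in at_left 1. (\<mu> - 1) / (\<mu> + 1) \<le> norm ((\<phi> (of_real r * w) - w) / (of_real r * w - w) - 1)"
    using eventually_radius
  proof eventually_elim
    case (elim r)
    define a where "a = of_real r * w"
    have na: "norm a = r" using elim w by (simp add: a_def norm_mult)
    then have a: "norm a < 1" using elim by simp
    have "norm (cnj a * \<phi> a) \<le> r * 1" unfolding norm_mult using norm_less_1[OF a] na elim by (intro mult_mono) auto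
    \<comment> \<open>As 1 - r is also |a - w|, the pseudo-hyperbolic displacement is at most
      |(\<phi> a - a) / (a - w)|, the modulus of the difference quotient at \<open>w\<close> minus
      1, which tends to 0.\<close>
    then have den: "1 - r \<le> norm (1 - cnj a * \<phi> a)" using norm_triangle_ineq2[of 1 "cnj a * \<phi> a"] by simp
    have aw: "norm (a - w) = 1 - r"
    proof -
      have "a - w = of_real (r - 1) * w" by (simp add: a_def left_diff_distrib)
      then show ?thesis using elim w by (simp only: norm_mult norm_of_real) simp
    qed
    have "(\<mu> - 1) / (\<mu> + 1) \<le> norm (\<phi> a - a) / norm (1 - cnj a * \<phi> a)"
      using low[OF a] by (simp add: norm_divide)
    also have "\<dots> \<le> norm (\<phi> a - a) / (1 - r)"
      using den elim by (intro divide_left_mono mult_pos_pos) auto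
    also have "\<dots> = norm ((\<phi> a - w) / (a - w) - 1)"
    proof -
      have "a - w \<noteq> 0" using aw elim by auto
      then have "(\<phi> a - w) / (a - w) - 1 = (\<phi> a - a) / (a - w)" by (simp add: field_simps)
      then show ?thesis by (simp add: norm_divide aw)
    qed
    finally show ?case by (simp add: a_def)
  qed
  ultimately have "(\<mu> - 1) / (\<mu> + 1) \<le> norm (1 - 1 :: complex)"
    by (rule tendsto_lowerbound) simp
  then show False using \<mu>1 by (simp add: divide_le_0_iff)
qed

text \<open>The coefficients converge because they are the imaginary and real parts of g_n at
  \<open>\<phi> z0\<close>. With multiplier 1, d = 0 would make \<open>F\<close> agree at
  \<open>z0\<close> and \<open>\<phi> z0\<close>, yet it is 0 at the former and has modulus L > 0 at
  the latter.\<close>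

theorem translation_semiconjugacy:
  assumes inner: "mean_inner \<phi>"
  obtains G b where "G holomorphic_on ball 0 1" "\<And>z. norm z < 1 \<Longrightarrow> 0 < Im (G z)" "b \<noteq> 0"
    "\<And>z. norm z < 1 \<Longrightarrow> G (\<phi> z) = G z + of_real b" "mean_inner (\<lambda>z. cayley (G z))"
proof -
  obtain F \<sigma> where F: "F holomorphic_on ball 0 1" and \<sigma>: "strict_mono (\<sigma> :: nat \<Rightarrow> nat)"
    and F0: "\<And>z. norm z < 1 \<Longrightarrow> (\<lambda>k. f (\<sigma> k) z) \<longlonglongrightarrow> F z"
    and F1: "\<And>z. norm z < 1 \<Longrightarrow> (\<lambda>k. f (Suc (\<sigma> k)) z) \<longlonglongrightarrow> F z"
    by (rule subsequence_limit) (rule that)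
  have Fn: "norm (F z) < 1" if z: "norm z < 1" for z
  proof -
    have "norm (F z) \<le> norm (f 0 z)"
      by (rule tendsto_upperbound[OF tendsto_norm[OF F0[OF z]]]) (simp_all add: norm_f_antimono z)
    then show ?thesis using norm_f_less_1[OF z, of 0] by linarith
  qed
  define z1 where "z1 = \<phi> z0"
  have z1: "norm z1 < 1" unfolding z1_def using z0 by (rule norm_less_1)
  have FL: "norm (F z1) = L"
    using LIMSEQ_unique[OF tendsto_norm[OF F0[OF z1]]] LIMSEQ_subseq_LIMSEQ[OF step_limit \<sigma>]
    by (simp add: z1_def o_def)
  have Fz0: "F z0 = 0" using LIMSEQ_unique[OF F0[OF z0], of 0] by (simp add: f_z0)
  define G where "G z = cayley_inv (F z)" for z
  have Ghol: "G holomorphic_on ball 0 1" unfolding G_def using F Fn by (intro holomorphic_intros) auto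
  have GIm: "0 < Im (G z)" if "norm z < 1" for z unfolding G_def using Fn[OF that] by (rule Im_cayley_inv_pos)
  have cG: "cayley (G z) = F z" if "norm z < 1" for z
    unfolding G_def using Fn[OF that] by (intro cayley_cayley_inv) auto
  have g0: "(\<lambda>k. g (\<sigma> k) z) \<longlonglongrightarrow> G z" if z: "norm z < 1" for z
    using tendsto_cayley_inv[OF F0[OF z] Fn[OF z]] by (simp add: G_def cayley_inv_f[OF z])
  have g1: "(\<lambda>k. g (Suc (\<sigma> k)) z) \<longlonglongrightarrow> G z" if z: "norm z < 1" for z
    using tendsto_cayley_inv[OF F1[OF z] Fn[OF z]] by (simp add: G_def cayley_inv_f[OF z])
  define \<mu> where "\<mu> = Im (G z1)"
  define d where "d = Re (G z1)"
  have lam: "(\<lambda>k. y (Suc (\<sigma> k)) / y (\<sigma> k)) \<longlonglongrightarrow> \<mu>"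
    using tendsto_Im[OF g0[OF z1]] by (simp add: \<mu>_def z1_def g_compose g_z0)
  have dl: "(\<lambda>k. (x (Suc (\<sigma> k)) - x (\<sigma> k)) / y (\<sigma> k)) \<longlonglongrightarrow> d"
    using tendsto_Re[OF g0[OF z1]] by (simp add: d_def z1_def g_compose g_z0)
  have \<mu>1: "1 \<le> \<mu>"
    by (rule tendsto_lowerbound[OF lam]) (use y_mono y_pos in auto)
  have eq: "G (\<phi> z) = of_real \<mu> * G z + of_real d" if z: "norm z < 1" for z
  proof (rule LIMSEQ_unique[OF g0[OF norm_less_1[OF z]]])
    show "(\<lambda>k. g (\<sigma> k) (\<phi> z)) \<longlonglongrightarrow> of_real \<mu> * G z + of_real d"
      unfolding g_compose by (intro tendsto_intros lam dl g1 z)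
  qed
  have l1: "\<mu> = 1" by (rule multiplier_eq_1[OF Ghol GIm eq \<mu>1])
  have d0: "d \<noteq> 0"
  proof
    assume "d = 0"
    then have "G z1 = G z0" using eq[OF z0] l1 by (simp add: z1_def)
    then have "F z1 = F z0" using cG[OF z1] cG[OF z0] by simp
    then show False using FL Fz0 L by simp
  qed
  have eqd: "G (\<phi> z) = G z + of_real d" if "norm z < 1" for z using eq[OF that] l1 by simp
  have mF: "mean_inner F"
  \<comment> \<open>The base point is \<open>z1\<close>, where the limit has modulus L > 0; at
    \<open>z0\<close> all normalised iterates vanish.\<close>
  proof (rule mean_inner_limit[where F="\<lambda>k. f (\<sigma> k)" and w=z1])
    show "\<exists>Q. Q holomorphic_on ball 0 1 \<and> (\<forall>z\<in>ball 0 1. norm (Q z) \<le> 1 \<and> f (\<sigma> m) z = f (\<sigma> n) z * Q z)" if "n \<le> m" for m n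
      using that \<sigma> by (intro f_factor) (simp add: strict_mono_less_eq)
  qed (use F F0 z1 FL L in \<open>auto intro: mean_inner_f[OF inner]\<close>)
  have "mean_inner (\<lambda>z. cayley (G z))"
  \<comment> \<open>With a = 0 this merely transfers the property to \<open>cayley (G z)\<close>,
    which is known to equal \<open>F z\<close> on the disc only.\<close>
  proof (rule mean_inner_Moebius[OF mF Fn, of 0])
    show "(\<lambda>z. cayley (G z)) holomorphic_on ball 0 1" using Ghol GIm by (intro holomorphic_intros) auto
  qed (simp_all add: cG)
  then show ?thesis using that[of G d] Ghol GIm d0 eqd by simp
qed

end

section \<open>The eigenfunction\<close>

text \<open>For multiplier 1 the equation for \<open>u\<close> itself admits constants, so they are
  excluded through \<open>G\<close>: a constant exponential forces the derivative of
  \<open>G\<close> to vanish, and a constant \<open>G\<close> contradicts b \<noteq> 0.\<close>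

lemma exp_semiconjugacy_nonconstant:
  assumes G: "G holomorphic_on ball 0 1" and \<phi>: "\<And>z. norm z < 1 \<Longrightarrow> norm (\<phi> z) < 1"
    and eq: "\<And>z. norm z < 1 \<Longrightarrow> G (\<phi> z) = G z + of_real b" and b: "b \<noteq> 0" and c: "c \<noteq> 0"
  shows "\<not> (\<exists>k. \<forall>z\<in>ball 0 1. exp (\<i> * of_real c * G z) = k)"
proof
  assume "\<exists>k. \<forall>z\<in>ball 0 1. exp (\<i> * of_real c * G z) = k"
  then obtain k where k: "\<And>z. z \<in> ball 0 1 \<Longrightarrow> exp (\<i> * of_real c * G z) = k" by blast
  have "(G has_field_derivative 0) (at z)" if z: "z \<in> ball 0 1" for z
  proof -
    have dG: "(G has_field_derivative deriv G z) (at z)" using G z by (intro holomorphic_derivI) auto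
    then have "((\<lambda>z. exp (\<i> * of_real c * G z)) has_field_derivative exp (\<i> * of_real c * G z) * (\<i> * of_real c * deriv G z)) (at z)"
      by (intro derivative_eq_intros) auto
    moreover have "((\<lambda>z. exp (\<i> * of_real c * G z)) has_field_derivative 0) (at z)"
      by (rule has_field_derivative_transform_within_open[OF DERIV_const[of k] open_ball z]) (use k in auto)
    ultimately have "exp (\<i> * of_real c * G z) * (\<i> * of_real c * deriv G z) = 0" by (rule DERIV_unique)
    then show ?thesis using dG c by simp
  qed
  then have "\<exists>a. \<forall>z\<in>ball 0 1. G z = a"
    by (intro has_field_derivative_zero_constant) (auto intro: has_field_derivative_at_within)
  then have "G (\<phi> 0) = G 0" using \<phi>[of 0] by force
  then show False using eq[of 0] b by simp
qed

theorem theorem4p1: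
  fixes \<phi> :: "complex \<Rightarrow> complex"
  assumes "self_map_disk \<phi>" and "inner_function \<phi>"
    and "parabolic \<phi>" and "positive_hyperbolic_step \<phi>"
  shows "\<forall>\<tau>. norm \<tau> = 1 \<longrightarrow>
           (\<exists>u. inner_function u \<and> \<not> (\<exists>c. \<forall>z\<in>ball 0 1. u z = c) \<and>
                (\<forall>z\<in>ball 0 1. u (\<phi> z) = \<tau> * u z))"
proof (intro allI impI)
  fix \<tau> :: complex assume \<tau>: "norm \<tau> = 1"
  obtain w where w: "norm w = 1" "angular_derivative \<phi> w 1"
    using assms(3) by (auto simp: parabolic_def boundary_DW_point_def)
  obtain z0 L where "norm z0 < 1" "0 < L" "(\<lambda>n. pseudo_hyp ((\<phi> ^^ n) z0) ((\<phi> ^^ Suc n) z0)) \<longlonglongrightarrow> L"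
    using assms(4) by (auto simp: positive_hyperbolic_step_def)
  then interpret parabolic_positive_step \<phi> w z0 L
    using assms(1) w by unfold_locales
  obtain G b where G: "G holomorphic_on ball 0 1" "\<And>z. norm z < 1 \<Longrightarrow> 0 < Im (G z)" and b: "b \<noteq> 0"
    and eq: "\<And>z. norm z < 1 \<Longrightarrow> G (\<phi> z) = G z + of_real b" and inner: "mean_inner (\<lambda>z. cayley (G z))"
    by (rule translation_semiconjugacy[OF inner_function_imp_mean_inner[OF assms(2)]]) (rule that)
  \<comment> \<open>\<open>Arg \<tau>\<close> lies in (-pi, pi], so adding 2 pi with the sign of
    \<open>b\<close> gives the numerator that sign. Hence c > 0, even for \<tau> = 1, while
    \<open>c * b\<close> is still an argument of \<tau>.\<close>
  define c where "c = (Arg \<tau> + sgn b * (2 * pi)) / b"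
  have c0: "0 < c"
    using b mpi_less_Arg[of \<tau>] Arg_le_pi[of \<tau>] pi_gt_zero
    unfolding c_def by (cases "0 < b") (auto simp: divide_neg_neg)
  have "exp (\<i> * of_real (c * b)) = \<tau>"
  proof -
    have "c * b = Arg \<tau> + sgn b * (2 * pi)" using b by (simp add: c_def)
    then have "cis (c * b) = cis (Arg \<tau>) * cis (sgn b * (2 * pi))" by (simp add: cis_mult)
    also have "cis (sgn b * (2 * pi)) = 1" using b by (cases "0 < b") (auto simp: complex_eq_iff)
    also have "cis (Arg \<tau>) * 1 = cis (Arg \<tau>)" by simp
    also have "\<dots> = \<tau>" using \<tau> by (subst cis_Arg) (auto simp: sgn_eq)
    finally show ?thesis by (simp add: cis_conv_exp)
  qed
  then have "exp (\<i> * of_real c * G (\<phi> z)) = \<tau> * exp (\<i> * of_real c * G z)" if "norm z < 1" for z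
    unfolding eq[OF that] by (simp add: distrib_left exp_add mult_ac)
  moreover have "inner_function (\<lambda>z. exp (\<i> * of_real c * G z))"
    using inner G c0 by (intro mean_inner_imp_inner_function mean_inner_exp) (auto simp: cayley_def)
  moreover have "\<not> (\<exists>k. \<forall>z\<in>ball 0 1. exp (\<i> * of_real c * G z) = k)"
    using c0 by (intro exp_semiconjugacy_nonconstant[OF G(1) norm_less_1 eq b]) auto
  ultimately show "\<exists>u. inner_function u \<and> \<not> (\<exists>c. \<forall>z\<in>ball 0 1. u z = c) \<and> (\<forall>z\<in>ball 0 1. u (\<phi> z) = \<tau> * u z)"
    by (intro exI[of _ "\<lambda>z. exp (\<i> * of_real c * G z)"]) auto
qed

end
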